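(* For every positive integer $n$, \[ \sum_{w\in\mathrm{FC}(B_n)}\mathbf{x}^{\mathrm{Des}_B(w)}q^{\mathrm{bl}(w^{-1})} =\sum_{k=0}^{n}\sum_{(\mathsf P,\mathsf Q)\in\mathrm{SDT}(2n-k,k)^2}\mathbf{x}^{\mathrm{Des}_B(\mathsf Q)}q^{\,n-\mathrm{ldes}(\mathsf P)} +\sum_{k=1}^{\lfloor n/2\rfloor}\sum_{(\mathsf P,\mathsf Q)\in\mathrm{SDT}(2n-2k,2k-1,1)^2}\mathbf{x}^{\mathrm{Des}_B(\mathsf Q)}q^{\,n-\mathrm{ldes}(\mathsf P)}. \]
   Context: $B_n$: signed permutations $w=[w_1,\ldots,w_n]$ of $\{\pm1,\ldots,\pm n\}$, Coxeter generators $s_0=[-1,2,\ldots,n]$, $s_i=[1,\ldots,i+1,i,\ldots,n]$; $\mathrm{FC}(B_n)$ = fully commutative elements (any two reduced expressions related by commutations only). With $w_0=0$: $\mathrm{Des}_B(w)=\{0\le i\le n-1\mid w_i>w_{i+1}\}$; $\mathrm{bl}(w)=1+\#\{1\le i\le n-1\mid\max(w_1..w_i)<\min(w_{i+1}..w_n)\}$; $\mathbf{x}^J=\prod_{i\in J}x_i$. For $\lambda\vdash 2n$, $\mathrm{SDT}(\lambda)$ is the set of standard domino tableaux of shape $\lambda$: tilings of the Young diagram of $\lambda$ by $n$ dominoes labelled bijectively by $1,\ldots,n$, strictly increasing along rows (left to right) and columns (top to bottom). For $\mathsf T\in\mathrm{SDT}(\lambda)$, $\mathrm{Des}(\mathsf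 T)$ is the set of $1\le i<n$ such that the north-east cell of the domino labelled $i+1$ lies in a lower row than the north-east cell of the domino labelled $i$; $\mathrm{Des}_B(\mathsf T)=\mathrm{Des}(\mathsf T)\cup\{0\}$ if the domino labelled $1$ is vertical (occupies cells $(1,1),(2,1)$) and $\mathrm{Des}_B(\mathsf T)=\mathrm{Des}(\mathsf T)$ otherwise; $\mathrm{ldes}(\mathsf T)=\max\mathrm{Des}_B(\mathsf T)$, or $0$ if empty. *)

theory Defs
  imports Main
begin

text \<open>A signed permutation w of {+-1,...,+-n} is represented as a bijection of the
integers with w(-i) = -w(i) that fixes every i with |i| > n. The window notation
[w_1,...,w_n] corresponds to w 1, ..., w n.\<close>

definition Bn :: "nat \<Rightarrow> (int \<Rightarrow> int) set" where
  "Bn n = {w. bij w \<and> (\<forall>i. w (- i) = - w i) \<and> (\<forall>i. int n < \<bar>i\<bar> \<longrightarrow> w i = i)}"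

definition gen :: "nat \<Rightarrow> int \<Rightarrow> int" where
  "gen a j =
     (if a = 0 then (if \<bar>j\<bar> = 1 then - j else j)
      else if j = int a then int a + 1
      else if j = int a + 1 then int a
      else if j = - int a then - int a - 1
      else if j = - int a - 1 then - int a
      else j)"

definition wprod :: "nat list \<Rightarrow> int \<Rightarrow> int" where
  "wprod ws = foldr (\<lambda>a f. gen a \<circ> f) ws id"

definition is_word :: "nat \<Rightarrow> nat list \<Rightarrow> bool" where
  "is_word n ws \<longleftrightarrow> set ws \<subseteq> {0..<n}"

definition coxlen :: "nat \<Rightarrow> (int \<Rightarrow> int) \<Rightarrow> nat" where
  "coxlen n w = (LEAST k. \<exists>ws. is_word n ws \<and> length ws = k \<and> wprod ws = w)"

definition reduced_word :: "nat \<Rightarrow> (int \<Rightarrow> int) \<Rightarrow> nat list \<Rightarrow> bool" where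
  "reduced_word n w ws \<longleftrightarrow> is_word n ws \<and> wprod ws = w \<and> length ws = coxlen n w"

text \<open>One commutation move: swap two adjacent commuting generators s_a s_b
(in B_n, s_a and s_b commute iff |a - b| >= 2).\<close>

definition comm_step :: "nat list \<Rightarrow> nat list \<Rightarrow> bool" where
  "comm_step u v \<longleftrightarrow> (\<exists>xs ys a b. (a + 2 \<le> b \<or> b + 2 \<le> a) \<and>
      u = xs @ [a, b] @ ys \<and> v = xs @ [b, a] @ ys)"

definition fully_commutative :: "nat \<Rightarrow> (int \<Rightarrow> int) \<Rightarrow> bool" where
  "fully_commutative n w \<longleftrightarrow>
     (\<forall>u v. reduced_word n w u \<and> reduced_word n w v \<longrightarrow> comm_step\<^sup>*\<^sup>* u v)"

definition FC :: "nat \<Rightarrow> (int \<Rightarrow> int) set" where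
  "FC n = {w \<in> Bn n. fully_commutative n w}"

text \<open>Des_B(w) = {0 <= i <= n-1 | w_i > w_{i+1}}, with w_0 = 0 (note w 0 = 0).\<close>

definition desB :: "nat \<Rightarrow> (int \<Rightarrow> int) \<Rightarrow> nat set" where
  "desB n w = {i \<in> {0..<n}. w (int i) > w (int i + 1)}"

definition bl :: "nat \<Rightarrow> (int \<Rightarrow> int) \<Rightarrow> nat" where
  "bl n w = 1 + card {i \<in> {1..<n}.
      Max (w ` {1..int i}) < Min (w ` {int i + 1..int n})}"

text \<open>Cells (row, column), 1-indexed, English convention (row 1 on top).
A partition is a list of row lengths.\<close>

definition cells :: "nat list \<Rightarrow> (nat \<times> nat) set" where
  "cells lam = {(i, j). 1 \<le> i \<and> i \<le> length lam \<and> 1 \<le> j \<and> j \<le> lam ! (i - 1)}"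

definition adjacent :: "nat \<times> nat \<Rightarrow> nat \<times> nat \<Rightarrow> bool" where
  "adjacent c d \<longleftrightarrow>
     (fst c = fst d \<and> (snd d = snd c + 1 \<or> snd c = snd d + 1)) \<or>
     (snd c = snd d \<and> (fst d = fst c + 1 \<or> fst c = fst d + 1))"

text \<open>A standard domino tableau of shape lam (|lam| = 2n) is encoded as the map
sending each cell to the label of the domino covering it (0 outside the diagram):
each label 1..n covers exactly two adjacent cells, and labels increase along rows
and columns.\<close>

definition SDT :: "nat list \<Rightarrow> (nat \<times> nat \<Rightarrow> nat) set" where
  "SDT lam = (let n = sum_list lam div 2 in
     {T. (\<forall>c. c \<notin> cells lam \<longrightarrow> T c = 0) \<and>
         (\<forall>c\<in>cells lam. T c \<in> {1..n}) \<and>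
         (\<forall>m\<in>{1..n}. \<exists>c d. c \<noteq> d \<and> adjacent c d \<and> {e \<in> cells lam. T e = m} = {c, d}) \<and>
         (\<forall>i j. (i, j) \<in> cells lam \<and> (i, j + 1) \<in> cells lam \<longrightarrow> T (i, j) \<le> T (i, j + 1)) \<and>
         (\<forall>i j. (i, j) \<in> cells lam \<and> (i + 1, j) \<in> cells lam \<longrightarrow> T (i, j) \<le> T (i + 1, j))})"

text \<open>Row of the north-east cell of the domino labelled m (its topmost row).\<close>

definition ne_row :: "(nat \<times> nat \<Rightarrow> nat) \<Rightarrow> nat \<Rightarrow> nat" where
  "ne_row T m = Min (fst ` {c. T c = m})"

definition tDes :: "nat \<Rightarrow> (nat \<times> nat \<Rightarrow> nat) \<Rightarrow> nat set" where
  "tDes n T = {i \<in> {1..<n}. ne_row T (i + 1) > ne_row T i}"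

definition tDesB :: "nat \<Rightarrow> (nat \<times> nat \<Rightarrow> nat) \<Rightarrow> nat set" where
  "tDesB n T = (if T (1, 1) = 1 \<and> T (2, 1) = 1 then tDes n T \<union> {0} else tDes n T)"

definition ldes :: "nat \<Rightarrow> (nat \<times> nat \<Rightarrow> nat) \<Rightarrow> nat" where
  "ldes n T = (if tDesB n T = {} then 0 else Max (tDesB n T))"

end

theory Submission
  imports Defs
begin

text \<open>
Factor a signed permutation as \<open>w = \<sigma> \<circ> u\<close> with \<open>\<sigma> \<in> S\<^sub>n\<close> and \<open>u\<^sup>-\<^sup>1\<close> increasing on \<open>1, \<dots>, n\<close>. Then
\<open>w\<^sup>-\<^sup>1\<close> and \<open>\<sigma>\<^sup>-\<^sup>1\<close> have the same blocks, \<open>w\<close> can be fully commutative only if \<open>\<sigma>\<close> avoids 321, and the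
descent generating function of the fully commutative elements above \<open>\<sigma>\<close> depends only on the descent
set of \<open>\<sigma>\<close>. Hence the left-hand side is a linear functional of the joint distribution of descent set
and block number on 321-avoiding permutations.

That joint distribution equals the sum over \<open>k\<close> of \<open>f(Des Q) q^(n - ldes P)\<close> over pairs of ballot
words with \<open>k\<close> down steps. Both sides obey the same recursion in \<open>n\<close>: adding to a prefix a new maximum
and then the least missing value has the same effect on heights as adding one of the two letters.
Pushing this identity through the functional leaves identities between
descent generating functions of words with \<open>m\<close> minus letters and of ballot words, all of which
follow from
\<open>Z(n + 2, k + 1)[f] = Z(n + 1, k + 1)[f] + Z(n + 1, k)[f] + Z(n, k)[D \<mapsto> f(D \<union> {n + 1}) - f(D)]\<close>.
Removing the largest domino shows that tableaux of shape \<open>(2n - k, k)\<close> have the descent distribution of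
words with \<open>k/2\<close> or \<open>n - (k - 1)/2\<close> minus letters, and those of shape \<open>(2n - 2k, 2k - 1, 1)\<close> that of
ballot words with \<open>k\<close> down steps.
\<close>

text \<open>The tableau sums treat P and Q differently. The P-weight sees only the last descent and
  ignores the descent 0, so words with m minus letters split into ballot words with k at most min(m,
  n - m) (\<open>wsum_eq_bsum\<close>). The Q-weight sees the descent 0, and no such splitting is
  available for it. Exchanging the sums over m and k leaves, for each k, the P-weight
  \<open>ldsum\<close> times the words with m between k and n - k. This interval is what the first
  kind of fully commutative elements produces (\<open>bsum_fiber_first\<close>); the second kind
  adds one plain copy of the ballot words (\<open>bsum_fiber_second\<close>), namely the three-row
  shapes. Both sides thus become the same bilinear sum over k, and no bijection between elements and
  pairs of tableaux is built. The obstacle is that the fiber weights do not match their targets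
  descent set by descent set; only the sums over ballot words agree. The sets {} and {1}, where the
  weights depend on n, force separate base cases.\<close>

section \<open>Descents of words and of ballot words\<close>

text \<open>A word over plus and minus is given by the set \<open>N\<close> of positions of its minus letters. Since
\<open>0 \<notin> N\<close>, it behaves as if preceded by a plus, so \<open>0\<close> is a descent iff the first letter is minus.\<close>

definition wdes :: "nat set \<Rightarrow> nat set" where
  "wdes N = {i. i \<notin> N \<and> Suc i \<in> N}"

definition wsub :: "nat \<Rightarrow> nat \<Rightarrow> nat set set" where
  "wsub n m = {N. N \<subseteq> {1..n} \<and> card N = m}"

text \<open>\<open>B\<close> is the second row of a standard Young tableau of shape (n - k, k), and
  \<open>wdes B\<close> is the descent set of that tableau.\<close>

definition ballot :: "nat \<Rightarrow> nat \<Rightarrow> nat set set" where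
  "ballot n k = {B. B \<subseteq> {1..n} \<and> card B = k \<and> (\<forall>i\<le>n. 2 * card (B \<inter> {1..i}) \<le> i)}"

definition wsum :: "nat \<Rightarrow> nat \<Rightarrow> (nat set \<Rightarrow> 'a) \<Rightarrow> 'a::comm_ring_1" where
  "wsum n m f = (\<Sum>N\<in>wsub n m. f (wdes N))"

definition bsum :: "nat \<Rightarrow> nat \<Rightarrow> (nat set \<Rightarrow> 'a) \<Rightarrow> 'a::comm_ring_1" where
  "bsum n k f = (\<Sum>B\<in>ballot n k. f (wdes B))"

lemma finite_wsub [simp]: "finite (wsub n m)"
  unfolding wsub_def by (rule finite_subset[of _ "Pow {1..n}"]) auto

lemma finite_ballot [simp]: "finite (ballot n m)"
  unfolding ballot_def by (rule finite_subset[of _ "Pow {1..n}"]) auto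

lemma wdes_empty [simp]: "wdes {} = {}"
  by (simp add: wdes_def)

lemma wdes_insert_Suc:
  "N \<subseteq> {1..n} \<Longrightarrow> wdes (insert (Suc n) N) = (if n \<in> N then wdes N else insert n (wdes N))"
  by (force simp: wdes_def)

lemma wdes_subset: "N \<subseteq> {1..n} \<Longrightarrow> wdes N \<subseteq> {..<n}"
  by (force simp: wdes_def)

lemma finite_wdes: "N \<subseteq> {1..n} \<Longrightarrow> finite (wdes N)"
  by (meson finite_lessThan finite_subset wdes_subset)

text \<open>A minus appended after n letters creates the descent n only behind a plus. Recording
  this as a correction by \<open>f (insert n D) - f D\<close> keeps \<open>f\<close> arbitrary; the
  words ending in plus that remain are later replaced by words one letter shorter.\<close>

lemma sum_insert_Suc_wdes:
  fixes f :: "nat set \<Rightarrow> 'a::comm_ring_1"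
  assumes "finite A" "\<And>N. N \<in> A \<Longrightarrow> N \<subseteq> {1..n}"
  shows "(\<Sum>N\<in>insert (Suc n) ` A. f (wdes N)) =
    (\<Sum>N\<in>A. f (wdes N)) + (\<Sum>N\<in>{N\<in>A. n \<notin> N}. f (insert n (wdes N)) - f (wdes N))"
proof -
  have inj: "inj_on (insert (Suc n)) A"
  proof (rule inj_onI)
    fix N M assume "N \<in> A" "M \<in> A" and eq: "insert (Suc n) N = insert (Suc n) M"
    then have "Suc n \<notin> N" "Suc n \<notin> M" using assms(2) by fastforce+
    with eq show "N = M" by (metis insert_ident)
  qed
  have "(\<Sum>N\<in>insert (Suc n) ` A. f (wdes N)) = (\<Sum>N\<in>A. f (wdes (insert (Suc n) N)))"
    by (simp add: sum.reindex[OF inj])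
  also have "\<dots> = (\<Sum>N\<in>A. f (wdes N) + (if n \<notin> N then f (insert n (wdes N)) - f (wdes N) else 0))"
    using assms(2) by (intro sum.cong) (auto simp: wdes_insert_Suc)
  also have "\<dots> = (\<Sum>N\<in>A. f (wdes N)) + (\<Sum>N\<in>{N\<in>A. n \<notin> N}. f (insert n (wdes N)) - f (wdes N))"
    using assms(1) by (simp only: sum.distrib) (simp add: sum.inter_filter)
  finally show ?thesis .
qed

lemma Suc_notin_wsub: "N \<in> wsub n m \<Longrightarrow> Suc n \<notin> N"
  by (auto simp: wsub_def)

lemma wsub_no_last: "{N\<in>wsub (Suc n) m. Suc n \<notin> N} = wsub n m"
  by (force simp: wsub_def subset_iff le_Suc_eq)

lemma wsub_Suc_Suc: "wsub (Suc n) (Suc m) = wsub n (Suc m) \<union> insert (Suc n) ` wsub n m"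
proof (intro subset_antisym subsetI)
  fix N assume N: "N \<in> wsub (Suc n) (Suc m)"
  show "N \<in> wsub n (Suc m) \<union> insert (Suc n) ` wsub n m"
  proof (cases "Suc n \<in> N")
    case True
    have "finite N" using N by (auto simp: wsub_def intro: finite_subset)
    then have "N - {Suc n} \<in> wsub n m" using N True
      by (force simp: wsub_def le_Suc_eq)
    then show ?thesis using True by (metis UnI2 image_eqI insert_Diff)
  next
    case False
    then show ?thesis using N wsub_no_last by blast
  qed
next
  fix N assume "N \<in> wsub n (Suc m) \<union> insert (Suc n) ` wsub n m"
  then show "N \<in> wsub (Suc n) (Suc m)"
  proof
    assume "N \<in> wsub n (Suc m)" then show ?thesis using wsub_no_last by blast
  next
    assume "N \<in> insert (Suc n) ` wsub n m"
    then obtain M where M: "M \<in> wsub n m" "N = insert (Suc n) M" by blast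
    then have "finite M" "Suc n \<notin> M" by (auto simp: wsub_def intro: finite_subset)
    then show ?thesis using M by (force simp: wsub_def)
  qed
qed

lemma wsum_0 [simp]: "wsum n 0 f = f {}"
proof -
  have "wsub n 0 = {{}}" by (auto simp: wsub_def finite_subset)
  then show ?thesis by (simp add: wsum_def)
qed

lemma wsum_gt: "m > n \<Longrightarrow> wsum n m f = 0"
proof -
  assume "m > n"
  then have "N \<notin> wsub n m" for N
    using card_mono[of "{1..n}" N] by (auto simp: wsub_def)
  then have "wsub n m = {}" by blast
  then show ?thesis by (simp add: wsum_def)
qed

lemma wsum_step:
  "wsum (Suc n) (Suc m) f = wsum n (Suc m) f + wsum n m f +
     (\<Sum>N\<in>{N\<in>wsub n m. n \<notin> N}. f (insert n (wdes N)) - f (wdes N))"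
proof -
  have "wsum (Suc n) (Suc m) f = wsum n (Suc m) f + (\<Sum>N\<in>insert (Suc n) ` wsub n m. f (wdes N))"
    unfolding wsum_def wsub_Suc_Suc
    by (subst sum.union_disjoint) (auto dest: Suc_notin_wsub)
  then show ?thesis
    by (subst (asm) sum_insert_Suc_wdes) (auto simp: wsum_def wsub_def[of n m] add.assoc)
qed

lemma wsum_Suc:
  "wsum (Suc (Suc n)) (Suc m) f = wsum (Suc n) (Suc m) f + wsum (Suc n) m f +
     wsum n m (\<lambda>D. f (insert (Suc n) D) - f D)"
  by (subst wsum_step) (simp only: wsub_no_last wsum_def)

lemma wsum_1_1: "wsum (Suc 0) (Suc 0) f = f {0}"
proof -
  have "{N \<in> wsub 0 0. 0 \<notin> N} = {{}}" by (auto simp: wsub_def)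
  then show ?thesis by (simp add: wsum_step wsum_gt)
qed

lemma ballot_subset: "B \<in> ballot n k \<Longrightarrow> B \<subseteq> {1..n}"
  by (simp add: ballot_def)

lemma ballot_bound: "B \<in> ballot n k \<Longrightarrow> 2 * k \<le> n"
  unfolding ballot_def by (auto dest!: spec[of _ n] simp: Int_absorb2)

lemma bsum_gt: "2 * k > n \<Longrightarrow> bsum n k f = 0"
proof -
  assume "2 * k > n"
  then have "ballot n k = {}" using ballot_bound[of _ n k] by fastforce
  then show ?thesis by (simp add: bsum_def)
qed

lemma bsum_0 [simp]: "bsum n 0 f = f {}"
proof -
  have "ballot n 0 = {{}}" by (auto simp: ballot_def finite_subset)
  then show ?thesis by (simp add: bsum_def)
qed

text \<open>A final plus never breaks the ballot condition, so it can be stripped or added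
  freely.\<close>

lemma ballot_no_last: "{B\<in>ballot (Suc n) k. Suc n \<notin> B} = ballot n k"
proof (intro subset_antisym subsetI)
  fix B assume "B \<in> {B\<in>ballot (Suc n) k. Suc n \<notin> B}"
  then show "B \<in> ballot n k" by (auto simp: ballot_def subset_iff le_Suc_eq)
next
  fix B assume B: "B \<in> ballot n k"
  then have s: "B \<subseteq> {1..n}" and "card B = k" by (auto simp: ballot_def)
  moreover have "2 * card (B \<inter> {1..Suc n}) \<le> Suc n"
  proof -
    have "B \<inter> {1..Suc n} = B" using s by auto
    then show ?thesis using ballot_bound[OF B] B by (simp add: ballot_def)
  qed
  ultimately show "B \<in> {B\<in>ballot (Suc n) k. Suc n \<notin> B}"
    using B by (auto simp: ballot_def le_Suc_eq)
qed

lemma ballot_Suc_Suc: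
  assumes "2 * k < n"
  shows "ballot (Suc n) (Suc k) = ballot n (Suc k) \<union> insert (Suc n) ` ballot n k" (is "?L = ?R")
proof (intro subset_antisym subsetI)
  fix B assume B: "B \<in> ?L"
  show "B \<in> ?R"
  proof (cases "Suc n \<in> B")
    case True
    have fin: "finite B" using B by (auto simp: ballot_def intro: finite_subset)
    have "(B - {Suc n}) \<inter> {1..i} = B \<inter> {1..i}" if "i \<le> n" for i using that by auto
    then have "B - {Suc n} \<in> ballot n k" using B True fin
      by (force simp: ballot_def le_Suc_eq)
    then show ?thesis using True by (metis UnI2 image_eqI insert_Diff)
  next
    case False
    then show ?thesis using B ballot_no_last by blast
  qed
next
  fix B assume "B \<in> ?R"
  then show "B \<in> ?L"
  proof
    assume "B \<in> ballot n (Suc k)" then show ?thesis using ballot_no_last by blast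
  next
    assume "B \<in> insert (Suc n) ` ballot n k"
    then obtain M where M: "M \<in> ballot n k" "B = insert (Suc n) M" by blast
    then have s: "finite M" "Suc n \<notin> M" "M \<subseteq> {1..n}" by (auto simp: ballot_def intro: finite_subset)
    have 1: "insert (Suc n) M \<inter> {1..i} = M \<inter> {1..i}" if "i \<le> n" for i using that by auto
    have 2: "insert (Suc n) M \<inter> {1..Suc n} = insert (Suc n) M" using s by auto
    have c: "card (insert (Suc n) M) = Suc k" using M s by (simp add: ballot_def)
    have "2 * card (B \<inter> {1..i}) \<le> i" if "i \<le> Suc n" for i
    proof (cases "i = Suc n")
      case True
      show ?thesis unfolding True M(2) 2 c using assms by simp
    next
      case False
      then show ?thesis using 1[of i] M that by (simp add: ballot_def)
    qed
    then show ?thesis using M s c by (auto simp: ballot_def)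
  qed
qed

text \<open>The bound leaves room for one more minus; at 2 k = n + 1 the left side is zero while
  \<open>bsum (Suc n) k f\<close> need not be.\<close>

lemma bsum_Suc:
  assumes "2 * k \<le> n"
  shows "bsum (Suc (Suc n)) (Suc k) f = bsum (Suc n) (Suc k) f + bsum (Suc n) k f +
     bsum n k (\<lambda>D. f (insert (Suc n) D) - f D)"
proof -
  have "bsum (Suc (Suc n)) (Suc k) f =
      bsum (Suc n) (Suc k) f + (\<Sum>N\<in>insert (Suc (Suc n)) ` ballot (Suc n) k. f (wdes N))"
    unfolding bsum_def using assms
    by (subst ballot_Suc_Suc, simp, subst sum.union_disjoint) (auto simp: ballot_def)
  also have "(\<Sum>N\<in>insert (Suc (Suc n)) ` ballot (Suc n) k. f (wdes N)) =
      bsum (Suc n) k f + bsum n k (\<lambda>D. f (insert (Suc n) D) - f D)"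
    by (subst sum_insert_Suc_wdes) (auto simp: bsum_def ballot_no_last dest!: ballot_subset)
  finally show ?thesis by (simp add: add.assoc)
qed

lemma bsum_cong:
  assumes "\<And>B. B \<in> ballot n k \<Longrightarrow> f (wdes B) = g (wdes B)"
  shows "bsum n k f = bsum n k g"
  unfolding bsum_def using assms by (intro sum.cong) auto

lemma wsum_cong:
  assumes "\<And>B. B \<in> wsub n k \<Longrightarrow> f (wdes B) = g (wdes B)"
  shows "wsum n k f = wsum n k g"
  unfolding wsum_def using assms by (intro sum.cong) auto

lemma bsum_mult_left: "bsum n k (\<lambda>D. c * f D) = c * bsum n k f"
  by (simp add: bsum_def sum_distrib_left)

lemma wsum_mult_left: "wsum n k (\<lambda>D. c * f D) = c * wsum n k f"
  by (simp add: wsum_def sum_distrib_left)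

lemma bsum_add: "bsum n k (\<lambda>D. f D + g D) = bsum n k f + bsum n k g"
  by (simp add: bsum_def sum.distrib)

lemma bsum_diff: "bsum n k (\<lambda>D. f D - g D) = bsum n k f - bsum n k g"
  by (simp add: bsum_def sum_subtractf)

lemma bsum_one: "bsum n (Suc 0) f = (\<Sum>p=1..<n. f {p})"
proof (induction n rule: induct_nat_012)
  case (ge2 n)
  then show ?case using bsum_Suc[of 0 n f] by simp
qed (simp_all add: bsum_gt)

text \<open>These facts keep the later induction steps away from the special descent sets: {} has
  its own branch in \<open>fiber_first\<close>, {1} in \<open>fiber_second\<close>.\<close>

lemma ballot_wdes:
  assumes "B \<in> ballot n k"
  shows "wdes B \<subseteq> {1..<n}" and "k > 0 \<Longrightarrow> wdes B \<noteq> {}" and "k > 1 \<Longrightarrow> wdes B \<noteq> {1}"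
proof -
  have B: "B \<subseteq> {1..n}" "card B = k" "\<And>i. i \<le> n \<Longrightarrow> 2 * card (B \<inter> {1..i}) \<le> i"
    using assms by (auto simp: ballot_def)
  have "1 \<notin> B"
  proof
    assume 1: "1 \<in> B"
    then have "2 * card (B \<inter> {1..1}) \<le> 1" using B(1,3) by fastforce
    moreover have "B \<inter> {1..1} = {1}" using 1 by auto
    ultimately show False by simp
  qed
  then have "0 \<notin> wdes B" by (simp add: wdes_def)
  then show "wdes B \<subseteq> {1..<n}" using wdes_subset[OF B(1)]
    by (metis One_nat_def Suc_leI atLeastLessThan_iff gr0I in_mono lessThan_iff subsetI)
  show "wdes B \<noteq> {}" if "k > 0"
  proof -
    have "B \<noteq> {}" using that B(2) by auto
    moreover have "finite B" using B(1) finite_subset by blast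
    ultimately have m: "Min B \<in> B" "\<And>b. b \<in> B \<Longrightarrow> Min B \<le> b" by auto
    then have "Min B - 1 \<in> wdes B" using B(1) by (force simp: wdes_def)
    then show ?thesis by auto
  qed
  show "wdes B \<noteq> {1}" if k: "k > 1"
  proof
    assume w: "wdes B = {1}"
    then have 2: "2 \<in> B" by (auto simp: wdes_def numeral_2_eq_2)
    have "B \<noteq> {2}" using k B(2) by auto
    then obtain b where b: "b \<in> B" "b \<noteq> 2" using 2 by auto
    \<comment> \<open>With 1 the only descent, every minus beyond position 2 is preceded by a minus,
      so 2 and 3 are both minus; this violates the ballot condition at 3.\<close>
    have down: "Suc i \<in> B \<Longrightarrow> i \<noteq> 1 \<Longrightarrow> i \<in> B" for i using w by (auto simp: wdes_def)
    have "b > 2" using b \<open>1 \<notin> B\<close> B(1) by (metis One_nat_def Suc_1 atLeastAtMost_iff in_mono le_antisym linorder_not_le not_less_eq_eq)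
    then have "3 \<in> B" using b(1)
    proof (induction b)
      case (Suc b) then show ?case using down[of b] by (cases "b = 2") (auto simp: numeral_3_eq_3)
    qed simp
    then have "{2,3} \<subseteq> B \<inter> {1..3}" "3 \<le> n" using 2 B(1) by auto
    then have "card {2::nat,3} \<le> card (B \<inter> {1..3})" by (intro card_mono) auto
    then show False using B(3)[of 3] \<open>3 \<le> n\<close> by simp
  qed
qed

section \<open>Weights attached to a descent set\<close>

lemma Min_insert_gt:
  fixes D :: "nat set"
  assumes "finite D" "D \<noteq> {}" "\<And>d. d \<in> D \<Longrightarrow> d < m"
  shows "Min (insert m D) = Min D"
  using assms by (simp add: min_def) (meson Min_in leD less_imp_le)

lemma wsub_wdes: "N \<in> wsub n m \<Longrightarrow> wdes N \<subseteq> {..<n}"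
  by (simp add: wsub_def wdes_subset)

lemma wsum_prod_Suc:
  fixes x :: "nat \<Rightarrow> 'a::comm_ring_1"
  shows "wsum (Suc (Suc n)) (Suc m) (prod x) = wsum (Suc n) (Suc m) (prod x) +
     wsum (Suc n) m (prod x) + (x (Suc n) - 1) * wsum n m (prod x)"
proof -
  have "wsum n m (\<lambda>D. prod x (insert (Suc n) D) - prod x D) = wsum n m (\<lambda>D. (x (Suc n) - 1) * prod x D)"
  proof (rule wsum_cong)
    fix B assume "B \<in> wsub n m"
    then have "wdes B \<subseteq> {..<n}" by (rule wsub_wdes)
    then have "finite (wdes B)" "Suc n \<notin> wdes B" by (auto simp: finite_subset)
    then show "prod x (insert (Suc n) (wdes B)) - prod x (wdes B) = (x (Suc n) - 1) * prod x (wdes B)"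
      by (simp add: algebra_simps)
  qed
  then show ?thesis by (simp add: wsum_Suc wsum_mult_left)
qed

lemma ballot_wdes_lt:
  assumes "B \<in> ballot n k"
  shows "finite (wdes B)" "d \<in> wdes B \<Longrightarrow> d < n"
  using ballot_wdes(1)[OF assms] by (auto simp: finite_subset)

lemma bsum_prod_Suc:
  fixes x :: "nat \<Rightarrow> 'a::comm_ring_1"
  assumes "2 * k \<le> n"
    and "\<And>B. B \<in> ballot n k \<Longrightarrow> g (insert (Suc n) (wdes B)) = x (Suc n) * g (wdes B)"
  shows "bsum (Suc (Suc n)) (Suc k) g = bsum (Suc n) (Suc k) g +
     bsum (Suc n) k g + (x (Suc n) - 1) * bsum n k g"
proof -
  have "bsum n k (\<lambda>D. g (insert (Suc n) D) - g D) = bsum n k (\<lambda>D. (x (Suc n) - 1) * g D)"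
    using assms(2) by (intro bsum_cong) (simp add: algebra_simps)
  then show ?thesis by (simp add: bsum_Suc[OF assms(1)] bsum_mult_left)
qed

text \<open>The middle range of word sums obeys the recursion of \<open>bsum_prod_Suc\<close>, which
  is why ballot words can produce it.\<close>

lemma mid_wsum_Suc:
  fixes x :: "nat \<Rightarrow> 'a::comm_ring_1"
  assumes "2 * k \<le> n"
  shows "(\<Sum>m=Suc k..Suc (Suc n) - Suc k. wsum (Suc (Suc n)) m (prod x)) =
     (\<Sum>m=Suc k..Suc n - Suc k. wsum (Suc n) m (prod x)) +
     (\<Sum>m=k..Suc n - k. wsum (Suc n) m (prod x)) +
     (x (Suc n) - 1) * (\<Sum>m=k..n - k. wsum n m (prod x))"
proof -
  let ?w = "\<lambda>m. wsum (Suc n) m (prod x)"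
  have e: "Suc (Suc n) - Suc k = Suc (n - k)" "Suc n - Suc k = n - k" "Suc n - k = Suc (n - k)" "k \<le> n - k"
    using assms by auto
  have "(\<Sum>m=Suc k..Suc (n - k). wsum (Suc (Suc n)) m (prod x)) =
      (\<Sum>m=k..n - k. wsum (Suc (Suc n)) (Suc m) (prod x))"
    by (rule sum.shift_bounds_cl_Suc_ivl)
  also have "\<dots> = (\<Sum>m=k..n-k. ?w (Suc m)) + (\<Sum>m=k..n-k. ?w m) +
       (x (Suc n) - 1) * (\<Sum>m=k..n - k. wsum n m (prod x))"
    by (simp add: wsum_prod_Suc sum.distrib sum_distrib_left)
  also have "(\<Sum>m=k..n-k. ?w (Suc m)) = (\<Sum>m=Suc k..Suc (n-k). ?w m)"
    by (rule sum.shift_bounds_cl_Suc_ivl[symmetric])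
  \<comment> \<open>The two sums of length \<open>Suc n\<close> trade the term
    \<open>Suc (n - k)\<close>: taken off the first range, it extends the second.\<close>
  also have "\<dots> + (\<Sum>m=k..n-k. ?w m) = (\<Sum>m=Suc k..n-k. ?w m) + (\<Sum>m=k..Suc (n-k). ?w m)"
    using e(4) by simp
  finally show ?thesis unfolding e(1-3) .
qed

section \<open>Fiber weights summed over ballot words\<close>

definition word_total :: "(nat \<Rightarrow> 'a::comm_ring_1) \<Rightarrow> nat \<Rightarrow> 'a" where
  "word_total x n = (\<Sum>N\<in>Pow {1..n}. prod x (wdes N))"

text \<open>The forced minus in position p + 1 makes p a descent exactly when letter p is plus.
  Under this condition the first descent p of a permutation survives a choice of signs on its first
  run; see \<open>desB_first_fiber\<close>.\<close>

definition toggle :: "(nat \<Rightarrow> 'a::comm_ring_1) \<Rightarrow> nat \<Rightarrow> 'a" where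
  "toggle x p = (\<Sum>N\<in>Pow {1..p}. prod x (wdes (insert (Suc p) N)))"

text \<open>If a 321-avoiding permutation has descent set \<open>D\<close>, then \<open>fiber_first x n D\<close> and \<open>fiber_second x n D\<close>
are the descent generating functions of the two kinds of fully commutative elements above it:
arbitrary signs on the first increasing run of \<open>\<sigma>\<close>, and, if \<open>1 \<in> D\<close>, the element in which
\<open>-\<sigma>(1)\<close> is inserted later into the second run. See \<open>sum_fiber\<close>.\<close>

definition fiber_first :: "(nat \<Rightarrow> 'a::comm_ring_1) \<Rightarrow> nat \<Rightarrow> nat set \<Rightarrow> 'a" where
  "fiber_first x n D = (if D = {} then word_total x n else toggle x (Min D) * prod x (D - {Min D}))"

definition fiber_second :: "(nat \<Rightarrow> 'a::comm_ring_1) \<Rightarrow> nat \<Rightarrow> nat set \<Rightarrow> 'a" where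
  "fiber_second x n D = (if 1 \<notin> D then 0 else if D = {1} then \<Sum>i=1..<n. x i
     else let r = Min (D - {1}) in prod x (D - {1, r}) * (x (r - 1) + x r * (\<Sum>i=1..<r-1. x i)))"

text \<open>\<open>toggle x n\<close> sums over the words of length n + 1 ending in minus, so sums
  of \<open>toggle\<close> telescope.\<close>

lemma word_total_Suc: "word_total x (Suc n) = word_total x n + toggle x n"
proof -
  have inj: "inj_on (insert (Suc n)) (Pow {1..n})"
    by (intro inj_onI) (metis PowD atLeastAtMost_iff insert_ident not_less_eq_eq order_refl subsetD)
  have "Pow {1..Suc n} = Pow {1..n} \<union> insert (Suc n) ` Pow {1..n}"
    by (simp add: atLeastAtMostSuc_conv Pow_insert)
  then have "word_total x (Suc n) = word_total x n + (\<Sum>N\<in>insert (Suc n) ` Pow {1..n}. prod x (wdes N))"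
    unfolding word_total_def by (simp, subst sum.union_disjoint) auto
  then show ?thesis by (simp only: sum.reindex[OF inj] toggle_def o_def)
qed

lemma word_total_wsum: "word_total x n = (\<Sum>m=0..n. wsum n m (prod x))"
proof -
  have "Pow {1..n} = (\<Union>m\<in>{0..n}. wsub n m)"
    using card_mono[of "{1..n}"] by (auto simp: wsub_def)
  then have "word_total x n = (\<Sum>N\<in>(\<Union>m\<in>{0..n}. wsub n m). prod x (wdes N))" by (simp add: word_total_def)
  also have "\<dots> = (\<Sum>m=0..n. \<Sum>N\<in>wsub n m. prod x (wdes N))"
    by (rule sum.UNION_disjoint) (auto simp: wsub_def)
  finally show ?thesis by (simp add: wsum_def)
qed

lemma word_total_1: "word_total x (Suc 0) = 1 + x 0"
proof -
  have "wdes {Suc 0} = {0}" by (auto simp: wdes_def)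
  then show ?thesis by (simp add: word_total_Suc word_total_def[of x 0] toggle_def)
qed

lemma wsum_full: "wsum (Suc n) (Suc n) f = f {0}"
proof -
  have "wsub (Suc n) (Suc n) = {{1..Suc n}}"
  proof -
    have "N \<in> wsub (Suc n) (Suc n) \<longleftrightarrow> N = {1..Suc n}" for N
      using card_subset_eq[of "{1..Suc n}" N] by (auto simp: wsub_def)
    then show ?thesis by blast
  qed
  moreover have "wdes {1..Suc n} = {0}" by (auto simp: wdes_def)
  ultimately show ?thesis by (simp add: wsum_def)
qed

text \<open>From k = 2 on both sides obey the recursion of \<open>mid_wsum_Suc\<close>, because a
  new largest descent does not touch the minimum. For k = 1 that recursion would involve the empty
  descent set, whose weight depends on n.\<close>

lemma bsum_fiber_first:
  fixes x :: "nat \<Rightarrow> 'a::comm_ring_1"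
  shows "bsum n k (fiber_first x n) = (\<Sum>m=k..n-k. wsum n m (prod x))"
proof (induction n arbitrary: k rule: less_induct)
  case (less n)
  consider "k = 0" | "2 * k > n" | "k = 1" "2 \<le> n" | "k \<ge> 2" "2 * k \<le> n" by linarith
  then show ?case
  proof cases
    case 1
    then show ?thesis by (simp add: fiber_first_def word_total_wsum)
  next
    case 2
    then show ?thesis by (simp add: bsum_gt)
  next
    case 3
    obtain p where n: "n = Suc (Suc p)" using 3 by (metis add_2_eq_Suc le_Suc_ex)
    \<comment> \<open>A ballot word with one minus has a single descent, anywhere in 1..n-1, so its
      weights are exactly these toggles.\<close>
    have tel: "word_total x (Suc 0) + (\<Sum>i=Suc 0..<Suc m. toggle x i) = word_total x (Suc m)" for m
      by (induction m) (simp_all add: word_total_Suc add.assoc)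
    have "bsum n k (fiber_first x n) = (\<Sum>i=Suc 0..<Suc (Suc p). toggle x i)"
      using 3 n by (simp add: bsum_one fiber_first_def)
    also have "\<dots> = word_total x n - word_total x (Suc 0)"
      using tel[of "Suc p"] n by (simp add: algebra_simps)
    also have "\<dots> = (\<Sum>m=0..n. wsum n m (prod x)) - 1 - x 0"
      by (simp add: word_total_wsum[of x n] word_total_1)
    \<comment> \<open>The two terms removed, 1 and \<open>x 0\<close>, belong to the all-plus and
      the all-minus word.\<close>
    also have "\<dots> = (\<Sum>m=1..n-1. wsum n m (prod x))"
      unfolding n by (simp add: wsum_full sum.atLeast_Suc_atMost)
    finally show ?thesis using 3 by simp
  next
    case 4
    obtain p where n: "n = Suc (Suc p)" using 4 by (cases n; cases "n - 1") auto
    obtain j where k: "k = Suc j" using 4 by (cases k) auto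
    have j: "j > 0" "2 * j \<le> p" using 4 n k by auto
    have ne: "bsum m i (fiber_first x n) = bsum m i (fiber_first x m)" if "i > 0" for m i
      by (rule bsum_cong) (use ballot_wdes(2) that in \<open>simp add: fiber_first_def\<close>)
    have ins: "fiber_first x n (insert (Suc p) (wdes B)) = x (Suc p) * fiber_first x n (wdes B)" if "B \<in> ballot p j" for B
    proof -
      have D: "finite (wdes B)" "wdes B \<noteq> {}" "\<And>d. d \<in> wdes B \<Longrightarrow> d < Suc p"
        using ballot_wdes_lt[OF that] ballot_wdes(2)[OF that] j(1) by (auto simp: less_Suc_eq)
      then have "Min (wdes B) \<in> wdes B" by simp
      then have "insert (Suc p) (wdes B) - {Min (wdes B)} = insert (Suc p) (wdes B - {Min (wdes B)})"
        using D(3)[of "Min (wdes B)"] by auto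
      moreover have "Suc p \<notin> wdes B" using D(3) by blast
      ultimately show ?thesis using D by (simp add: fiber_first_def Min_insert_gt)
    qed
    have "bsum n k (fiber_first x n) = bsum (Suc p) k (fiber_first x (Suc p)) + bsum (Suc p) j (fiber_first x (Suc p)) +
        (x (Suc p) - 1) * bsum p j (fiber_first x p)"
      unfolding n k by (subst bsum_prod_Suc[where x = x]) (use j ins n ne in auto)
    also have "\<dots> = (\<Sum>m=k..n-k. wsum n m (prod x))"
      using mid_wsum_Suc[OF j(2), of x] less.IH[of "Suc p"] less.IH[of p]
      unfolding n k by simp
    finally show ?thesis .
  qed
qed

text \<open>For k = 1 the descent set {1} alone carries the weights of all singletons. From k = 3 on
  both sides obey the same recursion.\<close>

lemma bsum_fiber_second:
  fixes x :: "nat \<Rightarrow> 'a::comm_ring_1"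
  assumes "k > 0"
  shows "bsum n k (fiber_second x n) = bsum n k (prod x)"
  using assms
proof (induction n arbitrary: k rule: less_induct)
  case (less n)
  have px: "prod x (insert (Suc p) (wdes B)) = x (Suc p) * prod x (wdes B)" if "B \<in> ballot p j" for B p j
  proof -
    have "Suc p \<notin> wdes B" using ballot_wdes_lt(2)[OF that] by force
    then show ?thesis using ballot_wdes_lt(1)[OF that] by simp
  qed
  have ne: "bsum m i (fiber_second x n) = bsum m i (fiber_second x m)" if "i > 1" for m i
    by (rule bsum_cong) (use ballot_wdes(3) that in \<open>simp add: fiber_second_def\<close>)
  consider "2 * k > n" | "k = 1" "2 \<le> n" | "k = 2" "2 * k \<le> n" | "k \<ge> 3" "2 * k \<le> n"
    using less.prems by linarith
  then show ?case
  proof cases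
    case 1
    then show ?thesis by (simp add: bsum_gt)
  next
    case 2
    have "(\<Sum>p=Suc 0..<n. fiber_second x n {p}) = (\<Sum>p=Suc 0..<n. if p = Suc 0 then \<Sum>i=1..<n. x i else 0)"
      by (intro sum.cong) (auto simp: fiber_second_def)
    then show ?thesis using 2 by (simp add: bsum_one)
  next
    case 3
    obtain p where n: "n = Suc (Suc p)" using 3 by (cases n; cases "n - 1") auto
    have p: "2 * Suc 0 \<le> p" using 3 n by simp
    \<comment> \<open>Words with one minus include the descent set {1}, where the weight depends on
      n. Hence n stays fixed in the weight while the length drops, and the two copies of its value
      on {1} cancel below.\<close>
    let ?F = "fiber_second x n"
    have "bsum n k ?F = bsum (Suc p) 2 ?F + bsum (Suc p) (Suc 0) ?F +
        bsum p (Suc 0) (\<lambda>D. ?F (insert (Suc p) D) - ?F D)"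
      using bsum_Suc[OF p, of ?F] 3 n by (simp add: numeral_2_eq_2)
    also have "bsum (Suc p) 2 ?F = bsum (Suc p) 2 (prod x)"
      using less.IH[of "Suc p" 2] ne[of 2 "Suc p"] n by simp
    also have "bsum (Suc p) (Suc 0) ?F = (\<Sum>i=1..<n. x i)"
    proof -
      have "(\<Sum>i=Suc 0..<Suc p. fiber_second x n {i}) = (\<Sum>i=Suc 0..<Suc p. if i = Suc 0 then \<Sum>i=1..<n. x i else 0)"
        by (intro sum.cong) (auto simp: fiber_second_def)
      then show ?thesis using p by (simp add: bsum_one)
    qed
    also have "bsum p (Suc 0) (\<lambda>D. ?F (insert (Suc p) D) - ?F D) =
        x p + x (Suc p) * (\<Sum>i=1..<p. x i) - (\<Sum>i=1..<n. x i)"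
    proof -
      have "{Suc p, Suc 0} - {Suc 0} = {Suc p}" "{Suc p, Suc 0} - {Suc 0, Suc p} = {}" using p by auto
      then have "?F {Suc p, Suc 0} = x p + x (Suc p) * (\<Sum>i=1..<p. x i)"
        using p by (auto simp: fiber_second_def doubleton_eq_iff Let_def)
      then have "(\<Sum>i=Suc 0..<p. ?F {Suc p, i} - ?F {i}) = (\<Sum>i=Suc 0..<p. if i = Suc 0 then
          x p + x (Suc p) * (\<Sum>i=1..<p. x i) - (\<Sum>i=1..<n. x i) else 0)"
        using p by (intro sum.cong) (auto simp: fiber_second_def)
      then show ?thesis using p by (simp add: bsum_one)
    qed
    also have "bsum (Suc p) 2 (prod x) + (\<Sum>i=1..<n. x i) +
        (x p + x (Suc p) * (\<Sum>i=1..<p. x i) - (\<Sum>i=1..<n. x i)) =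
        bsum (Suc p) 2 (prod x) + bsum (Suc p) (Suc 0) (prod x) +
        (x (Suc p) - 1) * bsum p (Suc 0) (prod x)"
      using p by (simp add: bsum_one algebra_simps)
    also have "\<dots> = bsum n k (prod x)"
      using bsum_prod_Suc[OF p, of "prod x" x] px 3 n by (simp add: numeral_2_eq_2)
    finally show ?thesis .
  next
    case 4
    obtain p where n: "n = Suc (Suc p)"
      using 4 by (cases n; cases "n - 1") auto
    obtain j where k: "k = Suc j" using 4 by (cases k) auto
    have j: "j > 1" "2 * j \<le> p" using 4 n k by auto
    have ins: "fiber_second x n (insert (Suc p) (wdes B)) = x (Suc p) * fiber_second x n (wdes B)" if "B \<in> ballot p j" for B
    proof (cases "1 \<in> wdes B")
      case True
      let ?D = "wdes B - {1}"
      have lt: "\<And>d. d \<in> wdes B \<Longrightarrow> d < Suc p" using ballot_wdes_lt(2)[OF that] by (simp add: less_Suc_eq)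
      have D: "finite ?D" "?D \<noteq> {}" "\<And>d. d \<in> ?D \<Longrightarrow> d < Suc p"
        using ballot_wdes_lt(1)[OF that] ballot_wdes(3)[OF that] j(1) True lt by auto
      have "Suc p \<noteq> 1" using j by auto
      then have i: "insert (Suc p) (wdes B) - {1} = insert (Suc p) ?D" by auto
      have M: "Min ?D \<in> ?D" using D by (intro Min_in)
      then have i2: "insert (Suc p) (wdes B) - {1, Min ?D} = insert (Suc p) (wdes B - {1, Min ?D})"
        using D(3)[OF M] \<open>Suc p \<noteq> 1\<close> by auto
      have "Suc p \<notin> wdes B" using lt by blast
      moreover have "wdes B \<noteq> {1}" "insert (Suc p) (wdes B) \<noteq> {1}" using D(2) \<open>Suc p \<noteq> 1\<close> by auto
      moreover have M2: "Min (insert (Suc p) (wdes B) - {1}) = Min ?D"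
        unfolding i by (rule Min_insert_gt[OF D])
      ultimately show ?thesis using j True ballot_wdes_lt(1)[OF that]
        unfolding fiber_second_def Let_def M2 i2 by (simp del: One_nat_def add: mult.assoc)
    qed (use j in \<open>auto simp: fiber_second_def\<close>)
    have "bsum n k (fiber_second x n) = bsum (Suc p) k (fiber_second x (Suc p)) + bsum (Suc p) j (fiber_second x (Suc p)) +
        (x (Suc p) - 1) * bsum p j (fiber_second x p)"
      unfolding n k by (subst bsum_prod_Suc[where x = x]) (use j ins n ne in auto)
    also have "\<dots> = bsum n k (prod x)"
      using bsum_prod_Suc[OF j(2), of "prod x" x] px j less.IH[of "Suc p"] less.IH[of p]
      unfolding n k by simp
    finally show ?thesis .
  qed
qed

text \<open>RSK for two-letter words: for each shape (n - k, k) the content fixes the insertion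
  tableau, and the recording tableau carries the descents. The proof compares recursions instead.
  \<open>f\<close> must ignore 0, as a word may begin with minus and a ballot word may not.\<close>

lemma wsum_eq_bsum:
  assumes "m \<le> n" "\<And>D. f (insert 0 D) = f D"
  shows "wsum n m f = (\<Sum>k=0..min m (n - m). bsum n k f)"
  using assms
proof (induction n arbitrary: m f rule: less_induct)
  case (less n)
  consider "m = 0" | "m > 0" "m = n" | "m > 0" "m < n" using less.prems by linarith
  then show ?case
  proof cases
    case 2
    then obtain p where "n = Suc p" by (cases n) auto
    then show ?thesis using 2 less.prems(2)[of "{}"] by (simp add: wsum_full)
  next
    case 3
    then obtain p where n: "n = Suc (Suc p)" by (cases n; cases "n - 1") auto
    obtain j where m: "m = Suc j" using 3 by (cases m) auto
    have j: "j \<le> p" using 3 n m by simp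
    define L where "L = min j (p - j)"
    have K: "min m (n - m) = Suc L" using n m j by (auto simp: L_def min_def)
    let ?g = "\<lambda>D. f (insert (Suc p) D) - f D"
    have g0: "?g (insert 0 D) = ?g D" for D
      using less.prems(2)[of D] less.prems(2)[of "insert (Suc p) D"] by (simp add: insert_commute)
    have "(\<Sum>k=0..Suc L. bsum n k f) = bsum n 0 f + (\<Sum>k=0..L. bsum n (Suc k) f)"
      by (simp only: sum.atLeast0_atMost_Suc_shift o_def)
    also have "(\<Sum>k=0..L. bsum n (Suc k) f) =
        (\<Sum>k=0..L. bsum (Suc p) (Suc k) f + bsum (Suc p) k f + bsum p k ?g)"
      unfolding n by (intro sum.cong refl bsum_Suc) (auto simp: L_def)
    also have "bsum n 0 f + \<dots> = (bsum (Suc p) 0 f + (\<Sum>k=0..L. bsum (Suc p) (Suc k) f)) +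
         (\<Sum>k=0..L. bsum (Suc p) k f) + (\<Sum>k=0..L. bsum p k ?g)"
      by (simp add: sum.distrib)
    also have "bsum (Suc p) 0 f + (\<Sum>k=0..L. bsum (Suc p) (Suc k) f) = (\<Sum>k=0..Suc L. bsum (Suc p) k f)"
      by (simp only: sum.atLeast0_atMost_Suc_shift o_def)
    also have "(\<Sum>k=0..L. bsum p k ?g) = wsum p j ?g"
      using less.IH[of p j ?g] n j g0 by (simp add: L_def)
    also have "(\<Sum>k=0..Suc L. bsum (Suc p) k f) + (\<Sum>k=0..L. bsum (Suc p) k f) =
        wsum (Suc p) (Suc j) f + wsum (Suc p) j f"
    proof -
      have 1: "wsum (Suc p) (Suc j) f = (\<Sum>k=0..min (Suc j) (p - j). bsum (Suc p) k f)"
        using less.IH[of "Suc p" "Suc j" f] n j less.prems(2) by simp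
      have 2: "wsum (Suc p) j f = (\<Sum>k=0..min j (Suc p - j). bsum (Suc p) k f)"
        using less.IH[of "Suc p" j f] n j less.prems(2) by simp
      \<comment> \<open>The two ranges end at \<open>L\<close> and \<open>Suc L\<close> in one order
        or the other. In the balanced case both end at \<open>L\<close>, and the term
        \<open>Suc L\<close> vanishes because it exceeds the ballot bound.\<close>
      consider "Suc j \<le> p - j" | "p - j < j" | "j = p - j" by linarith
      then show ?thesis
      proof cases
        case 1
        then have "min (Suc j) (p - j) = Suc L" "min j (Suc p - j) = L" by (auto simp: L_def)
        then show ?thesis unfolding \<open>wsum (Suc p) (Suc j) f = _\<close> 2 by simp
      next
        case 2
        then have "min (Suc j) (p - j) = L" "min j (Suc p - j) = Suc L" using j by (auto simp: L_def)
        then show ?thesis unfolding \<open>wsum (Suc p) j f = _\<close> 1 by simp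
      next
        case 3
        then have "min (Suc j) (p - j) = L" "min j (Suc p - j) = L" "2 * Suc L > Suc p" by (auto simp: L_def)
        then show ?thesis unfolding 1 2 by (simp add: bsum_gt)
      qed
    qed
    finally show ?thesis unfolding K by (simp add: n m wsum_Suc)
  qed simp
qed

text \<open>Inserting 0 supplies the default of \<open>ldes\<close> for an empty descent set and
  makes the weight blind to the descent 0, as \<open>wsum_eq_bsum\<close> demands.\<close>

definition lq :: "'a::comm_ring_1 \<Rightarrow> nat \<Rightarrow> nat set \<Rightarrow> 'a" where
  "lq q n D = q ^ (n - Max (insert 0 D))"

definition ldsum :: "'a::comm_ring_1 \<Rightarrow> nat \<Rightarrow> nat \<Rightarrow> 'a" where
  "ldsum q n k = bsum n k (lq q n)"

lemma ldsum_0: "ldsum q n 0 = q ^ n"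
  by (simp add: ldsum_def lq_def)

lemma lq_shift:
  assumes "B \<in> ballot n k"
  shows "lq q (n + m) (wdes B) = q ^ m * lq q n (wdes B)"
proof -
  have "Max (insert 0 (wdes B)) \<le> n"
    using ballot_wdes_lt[OF assms] by (simp add: less_imp_le)
  then show ?thesis by (simp add: lq_def power_add[symmetric] add.commute)
qed

lemma lq_insert:
  assumes "B \<in> ballot n k"
  shows "lq q (Suc (Suc n)) (insert (Suc n) (wdes B)) = q"
proof -
  have "Max (insert 0 (insert (Suc n) (wdes B))) = Suc n"
    using ballot_wdes_lt[OF assms] by (intro Max_eqI) (auto simp: less_imp_le less_Suc_eq)
  then show ?thesis by (simp add: lq_def)
qed

text \<open>A new descent at n + 1 overrides all earlier ones and resets the weight to q; this is
  where the plain count of ballot words comes from.\<close>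

lemma ldsum_step:
  fixes q :: "'a::comm_ring_1"
  assumes "2 * j \<le> n"
  shows "ldsum q (Suc (Suc n)) (Suc j) = q * ldsum q (Suc n) (Suc j) + q * ldsum q (Suc n) j +
     q * bsum n j (\<lambda>_. 1) - q ^ 2 * ldsum q n j"
proof -
  have 1: "bsum (Suc n) i (lq q (Suc (Suc n))) = q * ldsum q (Suc n) i" for i
    unfolding ldsum_def bsum_mult_left[symmetric]
    by (rule bsum_cong) (use lq_shift[of _ "Suc n" i q 1] in simp)
  have 2: "bsum n j (\<lambda>D. lq q (Suc (Suc n)) (insert (Suc n) D) - lq q (Suc (Suc n)) D) =
      bsum n j (\<lambda>D. q * 1 - q ^ 2 * lq q n D)"
    by (rule bsum_cong) (use lq_shift[of _ n j q 2] lq_insert[of _ n j q] in simp)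
  show ?thesis
    unfolding ldsum_def[of q "Suc (Suc n)"] bsum_Suc[OF assms] 1 2 unfolding bsum_diff bsum_mult_left
    by (simp add: ldsum_def)
qed

lemma ldsum_gt: "2 * k > n \<Longrightarrow> ldsum q n k = 0"
  by (simp add: ldsum_def bsum_gt)

text \<open>A Pascal rule free of powers of q. The induction hypothesis is applied to the terms on
  the right of \<open>ldsum_step\<close>, and the outcome regroups into two instances of
  \<open>ldsum_step\<close> one size lower. At 2 k = n the left side would already be zero.\<close>

lemma ldsum_Suc:
  fixes q :: "'a::comm_ring_1"
  assumes "2 * k < n"
  shows "ldsum q (Suc n) (Suc k) = ldsum q n (Suc k) + ldsum q n k"
  using assms
proof (induction n arbitrary: k rule: less_induct)
  case (less n)
  obtain p where n: "n = Suc p" using less.prems by (cases n) auto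
  show ?case
  proof (cases k)
    case 0
    show ?thesis
    proof (cases p)
      case 0
      then show ?thesis using \<open>k = 0\<close> n ldsum_step[of 0 0 q] by (simp add: ldsum_0 ldsum_gt power2_eq_square)
    next
      case (Suc r)
      have "ldsum q (Suc n) (Suc 0) = q * ldsum q n (Suc 0) + q"
        using ldsum_step[of 0 p q] n by (simp add: ldsum_0 power2_eq_square)
      moreover have "ldsum q n (Suc 0) = q * ldsum q p (Suc 0) + q"
        using ldsum_step[of 0 r q] n Suc by (simp add: ldsum_0 power2_eq_square)
      moreover have "ldsum q n (Suc 0) = ldsum q p (Suc 0) + q ^ p"
        using less.IH[of p 0] n Suc by (simp add: ldsum_0)
      ultimately show ?thesis using \<open>k = 0\<close> n by (simp add: ldsum_0 algebra_simps)
    qed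
  next
    case (Suc i)
    then obtain p' where p: "p = Suc p'" using n less.prems by (cases p) auto
    have i: "2 * i < p'" using Suc n p less.prems by simp
    then obtain t where t: "p' = Suc t" by (cases p') auto
    define c where "c = (\<lambda>n k. bsum n k (\<lambda>_. 1) :: 'a)"
    have S1: "ldsum q (Suc n) (Suc k) = q * ldsum q n (Suc (Suc i)) + q * ldsum q n (Suc i) +
        q * c p (Suc i) - q^2 * ldsum q p (Suc i)"
      using ldsum_step[of "Suc i" p q] Suc n less.prems by (simp add: c_def)
    have S2: "ldsum q n (Suc i) = q * ldsum q p (Suc i) + q * ldsum q p i + q * c p' i - q^2 * ldsum q p' i"
      using ldsum_step[of i p' q] i n p by (simp add: c_def)
    have I1: "ldsum q n (Suc i) = ldsum q p (Suc i) + ldsum q p i"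
      using less.IH[of p i] i n p by simp
    have I2: "ldsum q p (Suc i) = ldsum q p' (Suc i) + ldsum q p' i"
      using less.IH[of p' i] i n p by simp
    \<comment> \<open>Plain counts satisfy the same rule, since the correction of a constant is
      zero.\<close>
    have C: "c p (Suc i) = c p' (Suc i) + c p' i"
      using bsum_Suc[of i t "\<lambda>_. 1::'a"] i p t by (simp add: c_def bsum_def)
    show ?thesis
    proof (cases "2 * Suc i \<le> p'")
      case True
      have S3: "ldsum q n (Suc (Suc i)) = q * ldsum q p (Suc (Suc i)) + q * ldsum q p (Suc i) +
          q * c p' (Suc i) - q^2 * ldsum q p' (Suc i)"
        using ldsum_step[of "Suc i" p' q] True n p by (simp add: c_def)
      have I3: "ldsum q n (Suc (Suc i)) = ldsum q p (Suc (Suc i)) + ldsum q p (Suc i)"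
        using less.IH[of p "Suc i"] True n p by simp
      have "ldsum q (Suc n) (Suc k) = q * (ldsum q p (Suc (Suc i)) + ldsum q p (Suc i)) + q * (ldsum q p (Suc i) + ldsum q p i)
         + q * (c p' (Suc i) + c p' i) - q^2 * (ldsum q p' (Suc i) + ldsum q p' i)"
        unfolding S1 C unfolding I1 I3 unfolding I2 ..
      also have "\<dots> = ldsum q n (Suc (Suc i)) + ldsum q n (Suc i)"
        unfolding S3 S2 by (simp add: algebra_simps)
      finally show ?thesis using Suc by simp
    next
      case False
      then have z: "ldsum q n (Suc (Suc i)) = 0" "ldsum q p' (Suc i) = 0" "c p' (Suc i) = 0"
        using n p i by (auto simp: ldsum_gt c_def bsum_gt)
      have "ldsum q (Suc n) (Suc k) = q * (ldsum q p (Suc i) + ldsum q p i) + q * c p' i - q^2 * ldsum q p' i"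
        unfolding S1 C unfolding I1 unfolding I2 z by simp
      also have "\<dots> = ldsum q n (Suc i)" unfolding S2 by (simp add: algebra_simps)
      finally show ?thesis using Suc z by simp
    qed
  qed
qed

section \<open>Permutations avoiding 321, letter by letter\<close>

definition mex :: "nat list \<Rightarrow> nat" where
  "mex l = (LEAST v. 1 \<le> v \<and> v \<notin> set l)"

text \<open>\<open>prefix321 n g\<close> collects the prefixes of length \<open>n\<close>, listed backwards, of 321-avoiding permutations
in which \<open>g\<close> values below the maximum are still missing. A new letter is either a new maximum or the
least missing value.\<close>

fun prefix321 :: "nat \<Rightarrow> nat \<Rightarrow> nat list set" where
  "prefix321 0 g = (if g = 0 then {[]} else {})"
| "prefix321 (Suc n) g = (\<Union>h\<in>{..g}. Cons (Suc n + g) ` prefix321 n h) \<union> (\<lambda>l. mex l # l) ` prefix321 n (Suc g)"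

text \<open>As lists run backwards, tails are prefixes of the permutation; on a complete permutation
  this counts the blocks. For the same reason the earlier letter is the second one in
  \<open>ldes_set\<close>.\<close>

fun zcount :: "nat list \<Rightarrow> nat" where
  "zcount [] = 0"
| "zcount (a # l) = (if set (a # l) = {1..length (a # l)} then 1 else 0) + zcount l"

fun ldes_set :: "nat list \<Rightarrow> nat set" where
  "ldes_set (a # b # l) = (if b > a then insert (Suc (length l)) (ldes_set (b # l)) else ldes_set (b # l))"
| "ldes_set _ = {}"

lemma mex_spec: "1 \<le> mex l" "mex l \<notin> set l"
proof -
  obtain v where "v > Max (insert 0 (set l))" by blast
  then have "1 \<le> v \<and> v \<notin> set l" by (metis List.finite_set Max_ge One_nat_def Suc_leI finite_insert insertCI leD not_gr_zero)
  then have "1 \<le> mex l \<and> mex l \<notin> set l" unfolding mex_def by (rule LeastI)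
  then show "1 \<le> mex l" "mex l \<notin> set l" by auto
qed

lemma mex_le: "1 \<le> v \<Longrightarrow> v \<notin> set l \<Longrightarrow> mex l \<le> v"
  unfolding mex_def by (rule Least_le) simp

lemma mex_mono: "mex l' \<le> mex (a # l')"
  using mex_spec[of "a # l'"] by (intro mex_le) auto

lemma prefix321_length: "l \<in> prefix321 n g \<Longrightarrow> length l = n"
  by (induction n arbitrary: l g) (auto split: if_splits)

text \<open>The maximum n + g of a nonempty prefix reveals \<open>g\<close>; this is what makes the
  sets for different \<open>g\<close> disjoint.\<close>

lemma prefix321_inv:
  "l \<in> prefix321 n g \<Longrightarrow> distinct l \<and> set l \<subseteq> {1..n+g} \<and> (n + g > 0 \<longrightarrow> n + g \<in> set l)"
proof (induction n arbitrary: l g)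
  case (Suc n)
  then consider h k where "h \<le> g" "k \<in> prefix321 n h" "l = (Suc n + g) # k" | k where "k \<in> prefix321 n (Suc g)" "l = mex k # k"
    by auto
  then show ?case
  proof cases
    case 1
    then have "distinct k" "set k \<subseteq> {1..n+h}" using Suc.IH by auto
    moreover have "Suc n + g \<notin> set k" using \<open>set k \<subseteq> {1..n+h}\<close> 1(1) by auto
    ultimately show ?thesis using 1 by force
  next
    case 2
    then have k: "distinct k" "set k \<subseteq> {1..n+Suc g}" "n + Suc g \<in> set k" using Suc.IH[OF 2(1)] by simp_all
    have "card (set k) = n" using k(1) prefix321_length[OF 2(1)] by (simp add: distinct_card)
    moreover have "card {1..n+Suc g} \<noteq> n" by simp
  ultimately have "set k \<noteq> {1..n+Suc g}" by metis
    then obtain v where "v \<in> {1..n+Suc g}" "v \<notin> set k" using k(2) by blast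
    then have "mex k \<le> n + Suc g" using mex_le[of v k] by auto
    then show ?thesis using k 2(2) mex_spec[of k] by auto
  qed
qed (auto split: if_splits)

text \<open>Some value below the maximum is missing. Hence the least missing value, placed right
  after the maximum, makes a descent.\<close>

lemma mex_less:
  assumes "l \<in> prefix321 n (Suc g)"
  shows "mex l < n + Suc g"
proof -
  have k: "distinct l" "set l \<subseteq> {1..n+Suc g}" "n + Suc g \<in> set l" using prefix321_inv[OF assms] by auto
  have "card (set l) = n" using k(1) prefix321_length[OF assms] by (simp add: distinct_card)
  moreover have "card {1..n+Suc g} \<noteq> n" by simp
  ultimately have "set l \<noteq> {1..n+Suc g}" by metis
  then obtain v where "v \<in> {1..n+Suc g}" "v \<notin> set l" using k(2) by blast
  then have "mex l \<le> n + Suc g" using mex_le[of v l] by auto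
  moreover have "mex l \<noteq> n + Suc g" using mex_spec(2)[of l] k(3) by auto
  ultimately show ?thesis by simp
qed

lemma finite_prefix321 [simp]: "finite (prefix321 n g)"
  by (induction n arbitrary: g) auto

lemma prefix321_disjoint: "h \<noteq> h' \<Longrightarrow> prefix321 n h \<inter> prefix321 n h' = {}"
proof (rule ccontr)
  assume h: "h \<noteq> h'" and "prefix321 n h \<inter> prefix321 n h' \<noteq> {}"
  then obtain l where l: "l \<in> prefix321 n h" "l \<in> prefix321 n h'" by auto
  show False
  proof (cases n)
    case 0
    then show False using l h by (auto split: if_splits)
  next
    case (Suc m)
    then have "n + h \<le> n + h'" "n + h' \<le> n + h" using prefix321_inv[OF l(1)] prefix321_inv[OF l(2)] by auto
    then show False using h by simp
  qed
qed

text \<open>Call the number of missing values the height. The new maximum n + 1 + g skips g - h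
  values and so may follow any height h up to g; filling the least hole lowers the height by
  one.\<close>

lemma sum_prefix321_Suc:
  fixes F :: "nat list \<Rightarrow> 'a::comm_ring_1"
  shows "(\<Sum>l\<in>prefix321 (Suc n) g. F l) =
    (\<Sum>h\<le>g. \<Sum>l\<in>prefix321 n h. F ((Suc n + g) # l)) + (\<Sum>l\<in>prefix321 n (Suc g). F (mex l # l))"
proof -
  have d: "(\<Union>h\<in>{..g}. Cons (Suc n + g) ` prefix321 n h) \<inter> (\<lambda>l. mex l # l) ` prefix321 n (Suc g) = {}"
    using mex_less by fastforce
  have i: "inj_on (\<lambda>l. mex l # l) A" for A by (auto intro: inj_onI)
  have "(\<Sum>l\<in>(\<Union>h\<in>{..g}. Cons (Suc n + g) ` prefix321 n h). F l) = (\<Sum>h\<le>g. \<Sum>l\<in>Cons (Suc n + g) ` prefix321 n h. F l)"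
    using prefix321_disjoint by (intro sum.UNION_disjoint) auto
  also have "\<dots> = (\<Sum>h\<le>g. \<Sum>l\<in>prefix321 n h. F ((Suc n + g) # l))"
    by (simp add: sum.reindex)
  finally show ?thesis
    by (simp only: prefix321.simps, subst sum.union_disjoint)
       (use d in \<open>auto simp: sum.reindex[OF i]\<close>)
qed

definition Lsum :: "'a::comm_ring_1 \<Rightarrow> nat \<Rightarrow> nat \<Rightarrow> (nat set \<Rightarrow> 'a) \<Rightarrow> 'a" where
  "Lsum q n g f = (\<Sum>l\<in>prefix321 n g. q ^ zcount l * f (ldes_set l))"

text \<open>Factor contributed by a prefix of height g: at height 0 it is complete and closes a
  block.\<close>

definition zw :: "'a::comm_ring_1 \<Rightarrow> nat \<Rightarrow> 'a" where
  "zw q g = (if g = 0 then q else 1)"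

lemma prefix321_full: "l \<in> prefix321 n g \<Longrightarrow> n > 0 \<Longrightarrow> set l = {1..n} \<longleftrightarrow> g = 0"
proof
  assume l: "l \<in> prefix321 n g" and n: "n > 0"
  { assume "set l = {1..n}"
    moreover have "n + g \<in> set l" using prefix321_inv[OF l] n by simp
    ultimately show "g = 0" by simp }
  { assume "g = 0"
    then have "set l \<subseteq> {1..n}" "card (set l) = n"
      using prefix321_inv[OF l] prefix321_length[OF l] by (auto simp: distinct_card)
    then show "set l = {1..n}" by (intro card_subset_eq) auto }
qed

lemma zcount_prefix321:
  "a # l \<in> prefix321 (Suc n) g \<Longrightarrow> q ^ zcount (a # l) = zw q g * q ^ zcount l"
  using prefix321_full[of "a # l" "Suc n" g] prefix321_length[of "a # l" "Suc n" g]
  by (auto simp: zw_def)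

lemma zcount_up: "l \<in> prefix321 n h \<Longrightarrow> h \<le> g \<Longrightarrow> q ^ zcount ((Suc n + g) # l) = zw q g * q ^ zcount l"
  by (rule zcount_prefix321[of _ _ n]) auto

lemma zcount_mex: "l \<in> prefix321 n (Suc g) \<Longrightarrow> q ^ zcount (mex l # l) = zw q g * q ^ zcount l"
  by (rule zcount_prefix321[of _ _ n]) auto

lemma ldes_set_up: "l \<in> prefix321 n h \<Longrightarrow> h \<le> g \<Longrightarrow> ldes_set ((Suc n + g) # l) = ldes_set l"
  using prefix321_inv[of l n h] by (cases l) auto

lemma Lsum_0: "Lsum q 0 g f = (if g = 0 then f {} else 0)"
  by (simp add: Lsum_def)

lemma Lsum_up:
  "(\<Sum>h\<le>g. \<Sum>l\<in>prefix321 n h. q ^ zcount ((Suc n + g) # l) * f (ldes_set ((Suc n + g) # l))) =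
     zw q g * (\<Sum>h\<le>g. Lsum q n h f)"
  unfolding Lsum_def sum_distrib_left
  by (intro sum.cong refl) (simp only: atMost_iff zcount_up ldes_set_up mult.assoc)

lemma Lsum_1: "Lsum q (Suc 0) g f = zw q g * f {}"
proof -
  have "(\<Sum>h\<le>g. Lsum q 0 h f) = f {}" by (simp add: Lsum_0)
  then show ?thesis by (subst Lsum_def, subst sum_prefix321_Suc, subst Lsum_up) simp
qed

text \<open>A descent arises exactly when a least missing value follows a new maximum, because
  successive least missing values increase (\<open>mex_mono\<close>). Stripping both letters turns
  the correction into a sum over prefixes of length n.\<close>

lemma Lsum_Suc_Suc:
  fixes f :: "nat set \<Rightarrow> 'a::comm_ring_1"
  shows "Lsum q (Suc (Suc n)) g f = zw q g * ((\<Sum>h\<le>Suc g. Lsum q (Suc n) h f) +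
     (\<Sum>h\<le>Suc g. Lsum q n h (\<lambda>D. f (insert (Suc n) D) - f D)))"
proof -
  let ?d = "\<lambda>D. f (insert (Suc n) D) - f D"
  have dn: "(\<Sum>l\<in>prefix321 (Suc n) (Suc g). q ^ zcount (mex l # l) * f (ldes_set (mex l # l))) =
      zw q g * (Lsum q (Suc n) (Suc g) f + (\<Sum>h\<le>Suc g. Lsum q n h ?d))"
  proof -
    have "(\<Sum>l\<in>prefix321 (Suc n) (Suc g). q ^ zcount (mex l # l) * f (ldes_set (mex l # l))) =
        zw q g * (\<Sum>l\<in>prefix321 (Suc n) (Suc g). q ^ zcount l * f (ldes_set (mex l # l)))"
      unfolding sum_distrib_left
      by (intro sum.cong refl) (simp only: zcount_mex mult.assoc)
    also have "(\<Sum>l\<in>prefix321 (Suc n) (Suc g). q ^ zcount l * f (ldes_set (mex l # l))) =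
        Lsum q (Suc n) (Suc g) f +
        (\<Sum>l\<in>prefix321 (Suc n) (Suc g). q ^ zcount l * (f (ldes_set (mex l # l)) - f (ldes_set l)))"
      by (simp add: Lsum_def sum.distrib[symmetric] algebra_simps)
    also have "(\<Sum>l\<in>prefix321 (Suc n) (Suc g). q ^ zcount l * (f (ldes_set (mex l # l)) - f (ldes_set l))) =
        (\<Sum>h\<le>Suc g. \<Sum>l\<in>prefix321 n h. q ^ zcount ((Suc n + Suc g) # l) *
            (f (ldes_set (mex ((Suc n + Suc g) # l) # (Suc n + Suc g) # l)) - f (ldes_set ((Suc n + Suc g) # l)))) +
        (\<Sum>l\<in>prefix321 n (Suc (Suc g)). q ^ zcount (mex l # l) * (f (ldes_set (mex (mex l # l) # mex l # l)) - f (ldes_set (mex l # l))))"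
      by (rule sum_prefix321_Suc)
    also have "(\<Sum>l\<in>prefix321 n (Suc (Suc g)). q ^ zcount (mex l # l) * (f (ldes_set (mex (mex l # l) # mex l # l)) - f (ldes_set (mex l # l)))) = 0"
    proof (rule sum.neutral, rule ballI)
      fix l
      have "\<not> mex l > mex (mex l # l)" using mex_mono[of l "mex l"] by simp
      then show "q ^ zcount (mex l # l) * (f (ldes_set (mex (mex l # l) # mex l # l)) - f (ldes_set (mex l # l))) = 0"
        by simp
    qed
    also have "(\<Sum>h\<le>Suc g. \<Sum>l\<in>prefix321 n h. q ^ zcount ((Suc n + Suc g) # l) *
            (f (ldes_set (mex ((Suc n + Suc g) # l) # (Suc n + Suc g) # l)) - f (ldes_set ((Suc n + Suc g) # l)))) =
         (\<Sum>h\<le>Suc g. Lsum q n h ?d)"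
    proof (intro sum.cong refl)
      fix h assume h: "h \<in> {..Suc g}"
      show "(\<Sum>l\<in>prefix321 n h. q ^ zcount ((Suc n + Suc g) # l) *
            (f (ldes_set (mex ((Suc n + Suc g) # l) # (Suc n + Suc g) # l)) - f (ldes_set ((Suc n + Suc g) # l)))) = Lsum q n h ?d"
        unfolding Lsum_def
      proof (intro sum.cong refl)
        fix l assume l: "l \<in> prefix321 n h"
        \<comment> \<open>The intermediate prefix has height \<open>Suc g\<close>, so it is not
          complete and contributes no q.\<close>
        have z: "q ^ zcount ((Suc n + Suc g) # l) = q ^ zcount l"
          using zcount_up[OF l, of "Suc g" q] h by (simp add: zw_def)
        have d: "ldes_set ((Suc n + Suc g) # l) = ldes_set l" using ldes_set_up[OF l, of "Suc g"] h by simp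
        have "(Suc n + Suc g) # l \<in> prefix321 (Suc n) (Suc g)" using l h by auto
        then have "mex ((Suc n + Suc g) # l) < Suc n + Suc g" by (rule mex_less)
        then have "ldes_set (mex ((Suc n + Suc g) # l) # (Suc n + Suc g) # l) = insert (Suc n) (ldes_set l)"
          using d prefix321_length[OF l] by simp
        then show "q ^ zcount ((Suc n + Suc g) # l) *
            (f (ldes_set (mex ((Suc n + Suc g) # l) # (Suc n + Suc g) # l)) - f (ldes_set ((Suc n + Suc g) # l))) =
            q ^ zcount l * ?d (ldes_set l)" unfolding z d by simp
      qed
    qed
    finally show ?thesis by simp
  qed
  have "Lsum q (Suc (Suc n)) g f = zw q g * (\<Sum>h\<le>g. Lsum q (Suc n) h f) +
      zw q g * (Lsum q (Suc n) (Suc g) f + (\<Sum>h\<le>Suc g. Lsum q n h ?d))"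
    by (subst Lsum_def, subst sum_prefix321_Suc, subst Lsum_up, subst dn) (rule refl)
  then show ?thesis by (simp add: algebra_simps)
qed

text \<open>Effect of one more letter on the distribution of heights, descents disregarded: a new
  maximum comes from heights up to g, a least missing value from g + 1. \<open>Lsum_Suc_Suc\<close>
  applies this operator at both of its lengths.\<close>

definition height_op :: "'a::comm_ring_1 \<Rightarrow> (nat \<Rightarrow> 'a) \<Rightarrow> nat \<Rightarrow> 'a" where
  "height_op q a g = zw q g * (\<Sum>h\<le>Suc g. a h)"

fun bcol :: "'a::comm_ring_1 \<Rightarrow> nat \<Rightarrow> nat \<Rightarrow> 'a" where
  "bcol q 0 g = (if g = 0 then 1 else 0)"
| "bcol q (Suc n) g = zw q g * (\<Sum>h\<le>g. bcol q n h)"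

text \<open>The coefficient of \<open>bsum n k\<close> in \<open>Lsum\<close>, by
  \<open>Lsum_eq\<close>. \<open>bcol\<close> weighs prefixes made of new maxima only; each minus
  letter stands for a pair of letters that acts as one \<open>height_op\<close>.\<close>

definition beta :: "'a::comm_ring_1 \<Rightarrow> nat \<Rightarrow> nat \<Rightarrow> nat \<Rightarrow> 'a" where
  "beta q n k = (if 2 * k \<le> n then (height_op q ^^ k) (bcol q (n - 2 * k)) else (\<lambda>_. 0))"

lemma height_op_add: "height_op q (\<lambda>g. a g + b g) = (\<lambda>g. height_op q a g + height_op q b g)"
  by (rule ext) (simp add: height_op_def sum.distrib algebra_simps)

lemma height_op_pow_add: "(height_op q ^^ k) (\<lambda>g. a g + b g) = (\<lambda>g. (height_op q ^^ k) a g + (height_op q ^^ k) b g)"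
  by (induction k) (simp_all add: height_op_add)

lemma height_op_bcol_0: "height_op q (bcol q 0) = bcol q (Suc 0)"
  by (rule ext) (simp add: height_op_def)

text \<open>Appending a new maximum and then a minimal missing value weighs as much as appending
either of them: both amount to summing over all heights up to \<open>g + 1\<close>.\<close>

lemma height_op_bcol_Suc: "height_op q (bcol q (Suc n)) = (\<lambda>g. bcol q (Suc (Suc n)) g + height_op q (bcol q n) g)"
  by (rule ext) (simp add: height_op_def zw_def algebra_simps)

lemma height_op_beta_shift: "2 * k \<le> n \<Longrightarrow> height_op q (beta q n k) = beta q (Suc (Suc n)) (Suc k)"
  by (simp add: beta_def)

text \<open>\<open>height_op\<close> commutes with its own powers, so this is
  \<open>height_op_bcol_Suc\<close> under k more applications; at n = 2 k the second summand is
  zero.\<close>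

lemma height_op_beta:
  assumes "2 * k \<le> n"
  shows "height_op q (beta q n k) = (\<lambda>g. beta q (Suc n) k g + beta q (Suc n) (Suc k) g)"
proof -
  have sw: "height_op q ((height_op q ^^ k) a) = (height_op q ^^ k) (height_op q a)" for a
    by (simp add: funpow_swap1)
  show ?thesis
  proof (cases "n - 2 * k")
    case 0
    then have "n = 2 * k" using assms by simp
    then show ?thesis by (simp add: beta_def sw height_op_bcol_0 del: bcol.simps)
  next
    case (Suc N)
    then have n: "n = Suc N + 2 * k" using assms by simp
    then show ?thesis
      by (simp add: beta_def sw height_op_bcol_Suc height_op_pow_add del: bcol.simps)
  qed
qed

lemma beta_gt: "2 * k > n \<Longrightarrow> beta q n k g = 0"
  by (simp add: beta_def)

lemma bcol_zero: "bcol q n 0 = q ^ n"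
  by (induction n) (simp_all add: zw_def)

text \<open>The two rules \<open>height_op_beta_shift\<close> and \<open>height_op_beta\<close>
  combine into a Pascal rule. At height 0 it is the one of \<open>ldsum_Suc\<close>, with the same
  start q to the power n.\<close>

lemma beta_zero: "beta q n k 0 = ldsum q n k"
proof (induction n arbitrary: k rule: less_induct)
  case (less n)
  show ?case
  proof (cases k)
    case 0
    then show ?thesis by (simp add: beta_def bcol_zero ldsum_0)
  next
    case (Suc j)
    show ?thesis
    proof (cases "2 * k \<le> n")
      case True
      then obtain p where n: "n = Suc (Suc p)" "2 * j \<le> p" using Suc by (cases n; cases "n - 1") auto
      have "beta q n k 0 = beta q (Suc p) j 0 + beta q (Suc p) (Suc j) 0"
        using height_op_beta_shift[OF n(2), of q] height_op_beta[OF n(2), of q] n(1) Suc by metis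
      also have "\<dots> = ldsum q (Suc p) j + ldsum q (Suc p) (Suc j)" using less.IH n(1) by simp
      also have "\<dots> = ldsum q n k" using ldsum_Suc[of j "Suc p" q] n Suc by simp
      finally show ?thesis .
    qed (simp add: beta_gt ldsum_gt)
  qed
qed

lemma height_op_sum: "zw q g * (\<Sum>h\<le>Suc g. \<Sum>k\<le>n. a k h * c k) = (\<Sum>k\<le>n. height_op q (a k) g * c k)"
  by (simp only: height_op_def sum_distrib_left sum_distrib_right mult.assoc) (rule sum.swap)

text \<open>The terms of \<open>bsum_Suc\<close> are collected by length:
  \<open>height_op_beta\<close> recombines those of length n + 1,
  \<open>height_op_beta_shift\<close> handles the correction of length n.\<close>

lemma Lsum_eq: "Lsum q n g f = (\<Sum>k\<le>n. beta q n k g * bsum n k f)"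
proof (induction n arbitrary: g f rule: induct_nat_012)
  case 0
  then show ?case by (simp add: Lsum_0 beta_def)
next
  case 1
  then show ?case by (simp add: Lsum_1 beta_def zw_def)
next
  case (ge2 n)
  let ?d = "\<lambda>D. f (insert (Suc n) D) - f D"
  let ?b = "\<lambda>k. beta q (Suc (Suc n)) k g"
  have e: "?b (Suc k) * bsum (Suc (Suc n)) (Suc k) f =
     ?b (Suc k) * bsum (Suc n) (Suc k) f + ?b (Suc k) * bsum (Suc n) k f + ?b (Suc k) * bsum n k ?d" for k
    by (cases "2 * k \<le> n") (simp_all add: bsum_Suc beta_gt algebra_simps)
  have "(\<Sum>k\<le>Suc (Suc n). ?b k * bsum (Suc (Suc n)) k f) =
     ?b 0 * f {} + (\<Sum>k\<le>Suc n. ?b (Suc k) * bsum (Suc (Suc n)) (Suc k) f)"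
    by (subst sum.atMost_Suc_shift) simp
  also have "\<dots> = (?b 0 * bsum (Suc n) 0 f + (\<Sum>k\<le>Suc n. ?b (Suc k) * bsum (Suc n) (Suc k) f)) +
     (\<Sum>k\<le>Suc n. ?b (Suc k) * bsum (Suc n) k f) + (\<Sum>k\<le>Suc n. ?b (Suc k) * bsum n k ?d)"
    unfolding e sum.distrib by (simp add: add.assoc)
  also have "?b 0 * bsum (Suc n) 0 f + (\<Sum>k\<le>Suc n. ?b (Suc k) * bsum (Suc n) (Suc k) f) =
      (\<Sum>k\<le>Suc (Suc n). ?b k * bsum (Suc n) k f)"
    by (rule sum.atMost_Suc_shift[symmetric])
  also have "\<dots> = (\<Sum>k\<le>Suc n. ?b k * bsum (Suc n) k f)"
    by (simp add: bsum_gt)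
  also have "\<dots> + (\<Sum>k\<le>Suc n. ?b (Suc k) * bsum (Suc n) k f) = (\<Sum>k\<le>Suc n. height_op q (beta q (Suc n) k) g * bsum (Suc n) k f)"
    unfolding sum.distrib[symmetric]
  proof (intro sum.cong refl)
    fix k
    show "?b k * bsum (Suc n) k f + ?b (Suc k) * bsum (Suc n) k f = height_op q (beta q (Suc n) k) g * bsum (Suc n) k f"
      by (cases "2 * k \<le> Suc n") (simp_all add: height_op_beta bsum_gt algebra_simps)
  qed
  also have "(\<Sum>k\<le>Suc n. ?b (Suc k) * bsum n k ?d) = (\<Sum>k\<le>n. height_op q (beta q n k) g * bsum n k ?d)"
  proof -
    have "?b (Suc k) * bsum n k ?d = height_op q (beta q n k) g * bsum n k ?d" for k
      by (cases "2 * k \<le> n") (simp_all add: height_op_beta_shift bsum_gt)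
    then show ?thesis by (simp add: bsum_gt)
  qed
  also have "(\<Sum>k\<le>Suc n. height_op q (beta q (Suc n) k) g * bsum (Suc n) k f) + (\<Sum>k\<le>n. height_op q (beta q n k) g * bsum n k ?d) =
      Lsum q (Suc (Suc n)) g f"
    unfolding Lsum_Suc_Suc ge2.IH distrib_left height_op_sum ..
  finally show ?case ..
qed

lemma sum_prefix321:
  "(\<Sum>l\<in>prefix321 n 0. q ^ zcount l * f (ldes_set l)) = (\<Sum>k\<le>n. ldsum q n k * bsum n k f)"
  using Lsum_eq[of q n 0 f] by (simp add: Lsum_def beta_zero)

section \<open>Removing the largest domino\<close>

text \<open>Tableaux on an arbitrary cell set with a separate number of labels: removing the largest
  domino stays in this family without rebuilding a partition.\<close>

definition DT :: "(nat \<times> nat) set \<Rightarrow> nat \<Rightarrow> (nat \<times> nat \<Rightarrow> nat) set" where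
  "DT C n = {T. (\<forall>c. c \<notin> C \<longrightarrow> T c = 0) \<and> (\<forall>c\<in>C. T c \<in> {1..n}) \<and>
     (\<forall>m\<in>{1..n}. \<exists>c d. c \<noteq> d \<and> adjacent c d \<and> {e \<in> C. T e = m} = {c, d}) \<and>
     (\<forall>i j. (i, j) \<in> C \<and> (i, j + 1) \<in> C \<longrightarrow> T (i, j) \<le> T (i, j + 1)) \<and>
     (\<forall>i j. (i, j) \<in> C \<and> (i + 1, j) \<in> C \<longrightarrow> T (i, j) \<le> T (i + 1, j))}"

text \<open>\<open>c\<close> is the left or upper cell, so \<open>fst c\<close> is the row of the
  north-east cell; the order also makes each domino occur as one pair only.\<close>

definition end_domino :: "(nat \<times> nat) set \<Rightarrow> nat \<times> nat \<Rightarrow> nat \<times> nat \<Rightarrow> bool" where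
  "end_domino C c d \<longleftrightarrow> c \<in> C \<and> d \<in> C \<and>
     (d = (fst c, Suc (snd c)) \<or> d = (Suc (fst c), snd c)) \<and>
     (\<forall>e\<in>{c, d}. \<forall>e'\<in>{(fst e, Suc (snd e)), (Suc (fst e), snd e)}. e' \<in> C \<longrightarrow> e' \<in> {c, d})"

definition add_domino :: "(nat \<times> nat \<Rightarrow> nat) \<Rightarrow> nat \<times> nat \<Rightarrow> nat \<times> nat \<Rightarrow> nat \<Rightarrow> nat \<times> nat \<Rightarrow> nat" where
  "add_domino T c d m = T(c := m, d := m)"

lemma SDT_DT: "SDT lam = DT (cells lam) (sum_list lam div 2)"
  by (simp add: SDT_def DT_def Let_def)

lemma end_domino_closed:
  "end_domino C c d \<Longrightarrow> e \<in> {c, d} \<Longrightarrow> e' = (fst e, Suc (snd e)) \<or> e' = (Suc (fst e), snd e) \<Longrightarrow>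
     e' \<in> C \<Longrightarrow> e' \<in> {c, d}"
  unfolding end_domino_def by blast

lemma end_domino_dir:
  "end_domino C c d \<Longrightarrow> d = (fst c, Suc (snd c)) \<or> d = (Suc (fst c), snd c)"
  unfolding end_domino_def by blast

lemma end_domino_neq: "end_domino C c d \<Longrightarrow> c \<noteq> d"
  by (drule end_domino_dir) (metis fst_conv snd_conv n_not_Suc_n)

lemma end_domino_iff:
  "end_domino C (i, j) (i', j') \<longleftrightarrow> (i, j) \<in> C \<and> (i', j') \<in> C \<and>
     (i' = i \<and> j' = Suc j \<and> (Suc i, j) \<notin> C \<and> (i, Suc (Suc j)) \<notin> C \<and> (Suc i, Suc j) \<notin> C \<or>
      i' = Suc i \<and> j' = j \<and> (i, Suc j) \<notin> C \<and> (Suc i, Suc j) \<notin> C \<and> (Suc (Suc i), j) \<notin> C)"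
proof -
  consider "i' = i" "j' = Suc j" | "i' = Suc i" "j' = j" | "(i', j') \<noteq> (i, Suc j)" "(i', j') \<noteq> (Suc i, j)"
    by auto
  then show ?thesis
  proof cases
    case 1
    then show ?thesis by (auto simp: end_domino_def)
  next
    case 2
    then show ?thesis by (auto simp: end_domino_def)
  next
    case 3
    then show ?thesis by (auto simp: end_domino_def)
  qed
qed

lemma DT_outside: "T \<in> DT C n \<Longrightarrow> c \<notin> C \<Longrightarrow> T c = 0"
  and DT_inside: "T \<in> DT C n \<Longrightarrow> c \<in> C \<Longrightarrow> 1 \<le> T c \<and> T c \<le> n"
  and DT_label: "T \<in> DT C n \<Longrightarrow> 1 \<le> m \<Longrightarrow> m \<le> n \<Longrightarrow> \<exists>c d. c \<noteq> d \<and> adjacent c d \<and> {e \<in> C. T e = m} = {c, d}"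
  unfolding DT_def mem_Collect_eq by (blast, fastforce, fastforce)

lemma DT_row: "T \<in> DT C n \<Longrightarrow> (i, j) \<in> C \<Longrightarrow> (i, Suc j) \<in> C \<Longrightarrow> T (i, j) \<le> T (i, Suc j)"
  and DT_col: "T \<in> DT C n \<Longrightarrow> (i, j) \<in> C \<Longrightarrow> (Suc i, j) \<in> C \<Longrightarrow> T (i, j) \<le> T (Suc i, j)"
  by (auto simp: DT_def)

lemma DT_le: "T \<in> DT C n \<Longrightarrow> T c \<le> n"
  using DT_outside[of T C n c] DT_inside[of T C n c] by (cases "c \<in> C") auto

lemma add_domino_in_DT:
  assumes ed: "end_domino C c d" and T: "T \<in> DT (C - {c, d}) n"
  shows "add_domino T c d (Suc n) \<in> DT C (Suc n)"
proof -
  let ?S = "add_domino T c d (Suc n)"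
  have cd: "c \<in> C" "d \<in> C" "c \<noteq> d" "adjacent c d"
    using ed end_domino_neq[OF ed] by (auto simp: end_domino_def adjacent_def)
  have le: "T e \<le> n" for e using DT_le[OF T] .
  have S: "?S c = Suc n" "?S d = Suc n" "\<And>e. e \<notin> {c, d} \<Longrightarrow> ?S e = T e"
    by (auto simp: add_domino_def)
  have Sle: "?S e \<le> Suc n" for e using le[of e] by (auto simp: add_domino_def)
  have "\<exists>c d. c \<noteq> d \<and> adjacent c d \<and> {e \<in> C. ?S e = m} = {c, d}" if m: "m \<in> {1..Suc n}" for m
  proof (cases "m = Suc n")
    case True
    have "{e \<in> C. ?S e = m} = {c, d}"
      using cd S le True by (auto simp: add_domino_def) (metis Suc_n_not_le_n)+
    then show ?thesis using cd by blast
  next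
    case False
    then obtain c' d' where 1: "c' \<noteq> d'" "adjacent c' d'" "{e \<in> C - {c, d}. T e = m} = {c', d'}"
      using DT_label[OF T, of m] m by auto
    have "e \<in> C \<and> ?S e = m \<longleftrightarrow> e \<in> C - {c, d} \<and> T e = m" for e
      using False S(1,2) S(3)[of e] by (cases "e \<in> {c, d}") auto
    then have "{e \<in> C. ?S e = m} = {e \<in> C - {c, d}. T e = m}" by blast
    then show ?thesis using 1 by metis
  qed
  moreover have "?S (i, j) \<le> ?S e" if e: "(i, j) \<in> C" "e \<in> C" "e = (i, Suc j) \<or> e = (Suc i, j)" for i j e
  proof (cases "e \<in> {c, d}")
    case True
    then show ?thesis using S Sle by auto
  next
    case False
    then have nin: "(i, j) \<notin> {c, d}" using end_domino_closed[OF ed, of "(i, j)" e] e by auto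
    then have "T (i, j) \<le> T e" using e False DT_row[OF T] DT_col[OF T] by auto
    then show ?thesis using S nin False by metis
  qed
  moreover have "?S e = 0" if "e \<notin> C" for e
    using that DT_outside[OF T, of e] cd S(3)[of e] by auto
  moreover have "?S e \<in> {1..Suc n}" if "e \<in> C" for e
    using that DT_inside[OF T, of e] S(1,2) S(3)[of e] by (cases "e \<in> {c, d}") auto
  ultimately show ?thesis unfolding DT_def by simp
qed

lemma DT_remove:
  assumes T: "T \<in> DT C (Suc n)"
  obtains c d T' where "end_domino C c d" "T' \<in> DT (C - {c, d}) n" "T = add_domino T' c d (Suc n)"
proof -
  obtain c0 d0 where 0: "c0 \<noteq> d0" "adjacent c0 d0" "{e \<in> C. T e = Suc n} = {c0, d0}"
    using DT_label[OF T, of "Suc n"] by auto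
  obtain c d where cd: "{e \<in> C. T e = Suc n} = {c, d}" "d = (fst c, Suc (snd c)) \<or> d = (Suc (fst c), snd c)"
  proof -
    have "(d0 = (fst c0, Suc (snd c0)) \<or> d0 = (Suc (fst c0), snd c0)) \<or>
        (c0 = (fst d0, Suc (snd d0)) \<or> c0 = (Suc (fst d0), snd d0))"
      using 0(2) by (auto simp: adjacent_def prod_eq_iff)
    then show ?thesis using that[of c0 d0] that[of d0 c0] 0(3) by (auto simp: insert_commute)
  qed
  have cdC: "c \<in> C" "d \<in> C" "T c = Suc n" "T d = Suc n" using cd(1) by auto
  have lab: "e \<in> C \<Longrightarrow> T e = Suc n \<Longrightarrow> e \<in> {c, d}" for e using cd(1) by auto
  have ed: "end_domino C c d"
    unfolding end_domino_def
  proof (intro conjI ballI impI cdC cd(2))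
    fix e e' assume e: "e \<in> {c, d}" "e' \<in> {(fst e, Suc (snd e)), (Suc (fst e), snd e)}" "e' \<in> C"
    have "e \<in> C" "T e = Suc n" using e(1) cdC by auto
    then have "Suc n \<le> T e'"
      using DT_row[OF T, of "fst e" "snd e"] DT_col[OF T, of "fst e" "snd e"] e by auto
    then have "T e' = Suc n" using DT_le[OF T, of e'] by simp
    then show "e' \<in> {c, d}" using lab e(3) by blast
  qed
  let ?T = "T(c := 0, d := 0)"
  have T': "e \<in> C - {c, d} \<Longrightarrow> ?T e = T e" for e by auto
  have "?T \<in> DT (C - {c, d}) n"
    unfolding DT_def
  proof (intro CollectI conjI allI ballI impI)
    fix e assume "e \<notin> C - {c, d}" then show "?T e = 0" using DT_outside[OF T, of e] by auto
  next
    fix e assume e: "e \<in> C - {c, d}"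
    then show "?T e \<in> {1..n}" using DT_inside[OF T, of e] lab[of e] by (auto simp: le_Suc_eq)
  next
    fix m assume m: "m \<in> {1..n}"
    then obtain c' d' where 1: "c' \<noteq> d'" "adjacent c' d'" "{e \<in> C. T e = m} = {c', d'}"
      using DT_label[OF T, of m] by auto
    have "{e \<in> C - {c, d}. ?T e = m} = {e \<in> C. T e = m}" using m cdC by auto
    then show "\<exists>c' d'. c' \<noteq> d' \<and> adjacent c' d' \<and> {e \<in> C - {c, d}. ?T e = m} = {c', d'}"
      using 1 by metis
  next
    fix i j assume "(i, j) \<in> C - {c, d} \<and> (i, j + 1) \<in> C - {c, d}"
    then show "?T (i, j) \<le> ?T (i, j + 1)" using DT_row[OF T, of i j] by auto
  next
    fix i j assume "(i, j) \<in> C - {c, d} \<and> (i + 1, j) \<in> C - {c, d}"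
    then show "?T (i, j) \<le> ?T (i + 1, j)" using DT_col[OF T, of i j] by auto
  qed
  moreover have "T = add_domino ?T c d (Suc n)" using cdC by (auto simp: add_domino_def)
  ultimately show ?thesis using that ed by blast
qed

lemma DT_Suc:
  "DT C (Suc n) = (\<Union>p\<in>{p. end_domino C (fst p) (snd p)}.
      (\<lambda>T. add_domino T (fst p) (snd p) (Suc n)) ` DT (C - {fst p, snd p}) n)" (is "_ = ?R")
proof (intro subset_antisym subsetI)
  fix T assume "T \<in> DT C (Suc n)"
  then obtain c d T' where "end_domino C c d" "T' \<in> DT (C - {c, d}) n" "T = add_domino T' c d (Suc n)"
    by (rule DT_remove)
  then show "T \<in> ?R" by (intro UN_I[of "(c, d)"]) auto
qed (auto intro: add_domino_in_DT)

lemma DT_0: "DT {} 0 = {\<lambda>_. 0}"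
  by (auto simp: DT_def)

lemma finite_end_dominoes:
  assumes "finite C"
  shows "finite {p. end_domino C (fst p) (snd p)}"
  by (rule finite_subset[of _ "C \<times> C"]) (use assms in \<open>auto simp: end_domino_def\<close>)

lemma finite_DT: "finite C \<Longrightarrow> finite (DT C n)"
proof (induction n arbitrary: C)
  case 0
  have "DT C 0 \<subseteq> {\<lambda>_. 0}" by (auto simp: DT_def)
  then show ?case by (rule finite_subset) simp
next
  case (Suc n)
  then show ?case unfolding DT_Suc using finite_end_dominoes by (intro finite_UN_I) auto
qed

lemma add_domino_top:
  assumes "T \<in> DT C n" shows "{e. add_domino T c d (Suc n) e = Suc n} = {c, d}"
  using DT_le[OF assms] by (auto simp: add_domino_def) (metis Suc_n_not_le_n)+

lemma sum_DT_Suc: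
  fixes F :: "(nat \<times> nat \<Rightarrow> nat) \<Rightarrow> 'a::comm_ring_1"
  assumes C: "finite C" and E: "{p. end_domino C (fst p) (snd p)} = E"
  shows "(\<Sum>T\<in>DT C (Suc n). F T) =
    (\<Sum>p\<in>E. \<Sum>T\<in>DT (C - {fst p, snd p}) n. F (add_domino T (fst p) (snd p) (Suc n)))"
proof -
  have fE: "finite E" using finite_end_dominoes[OF C] E by simp
  let ?I = "\<lambda>p. (\<lambda>T. add_domino T (fst p) (snd p) (Suc n)) ` DT (C - {fst p, snd p}) n"
  have dis: "?I p \<inter> ?I p' = {}" if "p \<in> E" "p' \<in> E" "p \<noteq> p'" for p p'
  proof (rule ccontr)
    assume "?I p \<inter> ?I p' \<noteq> {}"
    then obtain T T' where T: "T \<in> DT (C - {fst p, snd p}) n" "T' \<in> DT (C - {fst p', snd p'}) n"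
      and eq: "add_domino T (fst p) (snd p) (Suc n) = add_domino T' (fst p') (snd p') (Suc n)"
      by auto
    have "{fst p, snd p} = {fst p', snd p'}"
      using add_domino_top[OF T(1), of "fst p" "snd p"] add_domino_top[OF T(2), of "fst p'" "snd p'"] eq by simp
    moreover have "end_domino C (fst p) (snd p)" "end_domino C (fst p') (snd p')" using that E by auto
    note this[THEN end_domino_dir]
    ultimately show False using that(3)
      by (auto simp: doubleton_eq_iff prod_eq_iff)
  qed
  have inj: "inj_on (\<lambda>T. add_domino T c d (Suc n)) (DT (C - {c, d}) n)" for c d
  proof (rule inj_onI)
    fix T T' assume T: "T \<in> DT (C - {c, d}) n" "T' \<in> DT (C - {c, d}) n" and eq: "add_domino T c d (Suc n) = add_domino T' c d (Suc n)"
    show "T = T'"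
    proof
      fix e
      show "T e = T' e"
        using DT_outside[OF T(1), of e] DT_outside[OF T(2), of e] fun_cong[OF eq, of e]
        by (cases "e \<in> {c, d}") (auto simp: add_domino_def)
    qed
  qed
  have "(\<Sum>T\<in>DT C (Suc n). F T) = (\<Sum>p\<in>E. \<Sum>T\<in>?I p. F T)"
    unfolding DT_Suc E using fE C dis finite_DT by (intro sum.UNION_disjoint) auto
  also have "\<dots> = (\<Sum>p\<in>E. \<Sum>T\<in>DT (C - {fst p, snd p}) n. F (add_domino T (fst p) (snd p) (Suc n)))"
    by (simp add: sum.reindex[OF inj])
  finally show ?thesis .
qed

lemma ne_row_add_domino:
  assumes "T \<in> DT C n" "end_domino C' c d"
  shows "ne_row (add_domino T c d (Suc n)) (Suc n) = fst c"
  using assms(2) unfolding ne_row_def add_domino_top[OF assms(1)] by (auto simp: end_domino_def)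

lemma ne_row_add_domino_old:
  assumes "T \<in> DT (C - {c, d}) n" "1 \<le> m" "m \<le> n"
  shows "ne_row (add_domino T c d (Suc n)) m = ne_row T m"
proof -
  have "{e. add_domino T c d (Suc n) e = m} = {e. T e = m}"
    using assms DT_outside[OF assms(1)] by (auto simp: add_domino_def)
  then show ?thesis by (simp add: ne_row_def)
qed

text \<open>Old labels keep their rows, so only n can become a new descent. At n = 0 a vertical
  domino could create the descent 0, which the last assumption excludes.\<close>

lemma tDesB_add_domino:
  assumes "T \<in> DT (C - {c, d}) n" "end_domino C c d" "n \<ge> 1 \<or> fst c = fst d"
  shows "tDesB (Suc n) (add_domino T c d (Suc n)) =
     (if n \<ge> 1 \<and> ne_row T n < fst c then insert n (tDesB n T) else tDesB n T)"
proof -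
  have old: "i \<in> {1..<n} \<Longrightarrow> ne_row (add_domino T c d (Suc n)) i = ne_row T i"
     "i \<in> {1..<n} \<Longrightarrow> ne_row (add_domino T c d (Suc n)) (Suc i) = ne_row T (Suc i)" for i
    using ne_row_add_domino_old[OF assms(1)] by auto
  have "tDes (Suc n) (add_domino T c d (Suc n)) = (if n \<ge> 1 \<and> ne_row T n < fst c then insert n (tDes n T) else tDes n T)"
    unfolding tDes_def
    using old ne_row_add_domino[OF assms(1,2)] ne_row_add_domino_old[OF assms(1), of n]
    by (auto simp: less_Suc_eq)
  moreover have "add_domino T c d (Suc n) (1,1) = 1 \<and> add_domino T c d (Suc n) (2,1) = 1 \<longleftrightarrow> T (1,1) = 1 \<and> T (2,1) = 1"
  proof (cases "n \<ge> 1")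
    case True
    then show ?thesis using DT_outside[OF assms(1)] by (auto simp: add_domino_def)
  next
    case False
    then have "fst c = fst d" using assms(3) by simp
    then have "\<not> (c = (1,1) \<and> d = (2,1))" "\<not> (d = (1,1) \<and> c = (2,1))" by force+
    moreover have "T e = 0" for e using DT_le[OF assms(1), of e] False by simp
    ultimately show ?thesis by (auto simp: add_domino_def)
  qed
  ultimately show ?thesis by (auto simp: tDesB_def)
qed

lemma ne_row_pos:
  assumes "T \<in> DT C n" "finite C" "\<And>e. e \<in> C \<Longrightarrow> 1 \<le> fst e" "n \<ge> 1"
  shows "1 \<le> ne_row T n"
proof -
  let ?A = "{c. T c = n}"
  have A: "?A \<subseteq> C"
  proof
    fix c assume "c \<in> ?A"
    then show "c \<in> C" using DT_outside[OF assms(1), of c] assms(4) by (cases "c \<in> C") auto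
  qed
  have "?A \<noteq> {}" using DT_label[OF assms(1), of n] assms(4) by fastforce
  moreover have "finite ?A" using A assms(2) finite_subset by blast
  ultimately have "ne_row T n \<in> fst ` ?A" unfolding ne_row_def by (intro Min_in) auto
  then obtain e where "e \<in> ?A" "ne_row T n = fst e" by blast
  then show ?thesis using A assms(3)[of e] by auto
qed

section \<open>Removable dominoes of the two families of shapes\<close>

definition R2 :: "nat \<Rightarrow> nat \<Rightarrow> (nat \<times> nat) set" where
  "R2 a b = {1} \<times> {1..a} \<union> {2} \<times> {1..b}"

definition R3 :: "nat \<Rightarrow> nat \<Rightarrow> (nat \<times> nat) set" where
  "R3 a b = insert (3, 1) (R2 a b)"

lemma finite_R2 [simp]: "finite (R2 a b)" and finite_R3 [simp]: "finite (R3 a b)"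
  by (simp_all add: R2_def R3_def)

lemma R2_row: "e \<in> R2 a b \<Longrightarrow> 1 \<le> fst e" and R3_row: "e \<in> R3 a b \<Longrightarrow> 1 \<le> fst e"
  by (auto simp: R2_def R3_def)

lemma cells_two: "cells [a, b] = R2 a b"
proof -
  have "(i, j) \<in> cells [a, b] \<longleftrightarrow> (i, j) \<in> R2 a b" for i j
    by (cases i; cases "i - 1") (auto simp: cells_def R2_def nth_Cons split: nat.splits)
  then show ?thesis by auto
qed

lemma cells_three: "cells [a, b, 1] = R3 a b"
proof -
  have "(i, j) \<in> cells [a, b, 1] \<longleftrightarrow> (i, j) \<in> R3 a b" for i j
    by (cases i; cases "i - 1"; cases "i - 2") (auto simp: cells_def R2_def R3_def nth_Cons split: nat.splits)
  then show ?thesis by auto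
qed

lemma R2_mem: "(i, j) \<in> R2 a b \<longleftrightarrow> i = 1 \<and> 1 \<le> j \<and> j \<le> a \<or> i = 2 \<and> 1 \<le> j \<and> j \<le> b"
  by (auto simp: R2_def)

lemma R3_mem: "(i, j) \<in> R3 a b \<longleftrightarrow> i = 3 \<and> j = 1 \<or> i = 1 \<and> 1 \<le> j \<and> j \<le> a \<or> i = 2 \<and> 1 \<le> j \<and> j \<le> b"
  by (auto simp: R3_def R2_def)

lemma end_domino_R2:
  assumes "b \<le> a"
  shows "end_domino (R2 a b) (i, j) (i', j') \<longleftrightarrow>
    (i = 1 \<and> i' = 1 \<and> j' = a \<and> a = Suc j \<and> b + 2 \<le> a) \<or>
    (i = 2 \<and> i' = 2 \<and> j' = b \<and> b = Suc j \<and> 1 \<le> j) \<or>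
    (i = 1 \<and> i' = 2 \<and> j = a \<and> j' = a \<and> a = b \<and> 1 \<le> b)"
proof -
  consider "i = 1" | "i = 2" | "i \<noteq> 1" "i \<noteq> 2" by blast
  then show ?thesis
  proof cases
    case 1
    then show ?thesis unfolding end_domino_iff R2_mem using assms by simp presburger
  next
    case 2
    then show ?thesis unfolding end_domino_iff R2_mem using assms by simp presburger
  next
    case 3
    then show ?thesis unfolding end_domino_iff R2_mem by simp
  qed
qed

text \<open>Oddness excludes b = 2, where the domino filling row 2 would rest on the cell (3, 1).
  That cell can leave only together with (2, 1), when b = 1.\<close>

lemma end_domino_R3:
  assumes "b < a" "odd b"
  shows "end_domino (R3 a b) (i, j) (i', j') \<longleftrightarrow>
    (i = 1 \<and> i' = 1 \<and> j' = a \<and> a = Suc j \<and> b + 2 \<le> a) \<or>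
    (i = 2 \<and> i' = 2 \<and> j' = b \<and> b = Suc j \<and> 2 \<le> j) \<or>
    (i = 2 \<and> i' = 3 \<and> j = 1 \<and> j' = 1 \<and> b = 1)"
proof -
  have b: "1 \<le> b" "b \<noteq> 2" using assms(2) by (cases b, auto)
  consider "i = 1" | "i = 2" | "i = 3" | "i \<noteq> 1" "i \<noteq> 2" "i \<noteq> 3" by blast
  then show ?thesis
  proof cases
    case 1
    then show ?thesis unfolding end_domino_iff R3_mem using assms(1) b by simp presburger
  next
    case 2
    show ?thesis
    proof (cases "j = 1")
      case True
      then show ?thesis unfolding end_domino_iff R3_mem using assms(1) b \<open>i = 2\<close> by auto
    next
      case False
      then show ?thesis unfolding end_domino_iff R3_mem using assms(1) b \<open>i = 2\<close> by auto
    qed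
  next
    case 3
    then show ?thesis unfolding end_domino_iff R3_mem by auto
  next
    case 4
    then have "(i, j) \<notin> R3 a b" by (simp add: R3_mem)
    then show ?thesis using 4 unfolding end_domino_iff by simp
  qed
qed

lemma R2_remove_row1: "R2 (Suc (Suc a)) b - {(1, Suc a), (1, Suc (Suc a))} = R2 a b"
proof -
  have "{1..Suc (Suc a)} - {Suc a, Suc (Suc a)} = {1..a}" by auto
  moreover have "({1::nat} \<times> A \<union> {2} \<times> B) - {(1, u), (1, v)} = {1} \<times> (A - {u, v}) \<union> {2} \<times> B" for A B :: "nat set" and u v
    by auto
  ultimately show ?thesis unfolding R2_def by metis
qed

lemma R2_remove_row2: "R2 a (Suc (Suc b)) - {(2, Suc b), (2, Suc (Suc b))} = R2 a b"
proof -
  have "{1..Suc (Suc b)} - {Suc b, Suc (Suc b)} = {1..b}" by auto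
  moreover have "({1::nat} \<times> A \<union> {2} \<times> B) - {(2, u), (2, v)} = {1} \<times> A \<union> {2} \<times> (B - {u, v})" for A B :: "nat set" and u v
    by auto
  ultimately show ?thesis unfolding R2_def by metis
qed

lemma R2_remove_vertical: "R2 (Suc a) (Suc a) - {(1, Suc a), (2, Suc a)} = R2 a a"
proof -
  have "{1..Suc a} - {Suc a} = {1..a}" by auto
  moreover have "({1::nat} \<times> A \<union> {2} \<times> B) - {(1, u), (2, u)} = {1} \<times> (A - {u}) \<union> {2} \<times> (B - {u})" for A B :: "nat set" and u
    by auto
  ultimately show ?thesis unfolding R2_def by metis
qed

lemma R3_remove_row1: "R3 (Suc (Suc a)) b - {(1, Suc a), (1, Suc (Suc a))} = R3 a b"
  unfolding R3_def by (subst insert_Diff_if) (simp add: R2_remove_row1[simplified])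

lemma R3_remove_row2: "R3 a (Suc (Suc b)) - {(2, Suc b), (2, Suc (Suc b))} = R3 a b"
  unfolding R3_def by (subst insert_Diff_if) (simp add: R2_remove_row2[simplified])

lemma R3_remove_vertical: "R3 a 1 - {(2, 1), (3, 1)} = R2 a 0"
proof -
  have "insert (3, 1) ({1::nat} \<times> A \<union> {2} \<times> {1::nat}) - {(2, 1), (3, 1)} = {1} \<times> A" for A
    by auto
  then show ?thesis by (simp add: R3_def R2_def)
qed

lemma R2_end_dominoes:
  assumes "b \<le> a"
  shows "{p. end_domino (R2 a b) (fst p) (snd p)} =
    (if b + 2 \<le> a then {((1, a - 1), (1, a))} else {}) \<union>
    (if 2 \<le> b then {((2, b - 1), (2, b))} else {}) \<union>
    (if a = b \<and> 1 \<le> b then {((1, a), (2, a))} else {})" (is "?L = ?R")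
proof -
  have "(x, y) \<in> ?L \<longleftrightarrow> (x, y) \<in> ?R" for x y
  proof -
    obtain i j i' j' where xy: "x = (i, j)" "y = (i', j')" by fastforce
    have m: "p \<in> (if Q then {p'} else {}) \<longleftrightarrow> Q \<and> p = p'" for p p' :: "(nat \<times> nat) \<times> nat \<times> nat" and Q
      by simp
    have "a = Suc j \<and> b + 2 \<le> a \<longleftrightarrow> b + 2 \<le> a \<and> j = a - 1" "b = Suc j \<and> u \<le> j \<longleftrightarrow> Suc u \<le> b \<and> j = b - 1" for u
      by auto
    then show ?thesis unfolding xy mem_Collect_eq fst_conv snd_conv end_domino_R2[OF assms] Un_iff m prod.inject disj_assoc
      by (intro arg_cong2[of _ _ _ _ "(\<or>)"]) auto
  qed
  from this[of "fst p" "snd p" for p] have "p \<in> ?L \<longleftrightarrow> p \<in> ?R" for p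
    by (simp only: prod.collapse)
  then show ?thesis by (rule set_eqI)
qed

lemma R3_end_dominoes:
  assumes "b < a" "odd b"
  shows "{p. end_domino (R3 a b) (fst p) (snd p)} =
    (if b + 2 \<le> a then {((1, a - 1), (1, a))} else {}) \<union>
    (if 3 \<le> b then {((2, b - 1), (2, b))} else {}) \<union>
    (if b = 1 then {((2, 1), (3, 1))} else {})" (is "?L = ?R")
proof -
  have "(x, y) \<in> ?L \<longleftrightarrow> (x, y) \<in> ?R" for x y
  proof -
    obtain i j i' j' where xy: "x = (i, j)" "y = (i', j')" by fastforce
    have m: "p \<in> (if Q then {p'} else {}) \<longleftrightarrow> Q \<and> p = p'" for p p' :: "(nat \<times> nat) \<times> nat \<times> nat" and Q
      by simp
    have "a = Suc j \<and> b + 2 \<le> a \<longleftrightarrow> b + 2 \<le> a \<and> j = a - 1" "b = Suc j \<and> u \<le> j \<longleftrightarrow> Suc u \<le> b \<and> j = b - 1" for u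
      by auto
    then show ?thesis unfolding xy mem_Collect_eq fst_conv snd_conv end_domino_R3[OF assms] Un_iff m prod.inject disj_assoc
      by (intro arg_cong2[of _ _ _ _ "(\<or>)"]) auto
  qed
  from this[of "fst p" "snd p" for p] have "p \<in> ?L \<longleftrightarrow> p \<in> ?R" for p
    by (simp only: prod.collapse)
  then show ?thesis by (rule set_eqI)
qed

section \<open>Domino tableaux with two rows, or three rows ending in one cell\<close>

definition tsum :: "(nat \<times> nat) set \<Rightarrow> nat \<Rightarrow> (nat set \<Rightarrow> 'a) \<Rightarrow> 'a::comm_ring_1" where
  "tsum C n f = (\<Sum>T\<in>DT C n. f (tDesB n T))"

text \<open>The counterpart of words ending in plus: a domino added with its north-east cell in row
  2 makes n a descent on exactly these tableaux.\<close>

definition usum :: "(nat \<times> nat) set \<Rightarrow> nat \<Rightarrow> (nat set \<Rightarrow> 'a) \<Rightarrow> 'a::comm_ring_1" where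
  "usum C n f = (\<Sum>T\<in>DT C n. if ne_row T n < 2 then f (tDesB n T) else 0)"

lemma sum_DT_R2_Suc:
  fixes F :: "(nat \<times> nat \<Rightarrow> nat) \<Rightarrow> 'a::comm_ring_1"
  assumes "b \<le> a"
  shows "(\<Sum>T\<in>DT (R2 a b) (Suc n). F T) =
    (if b + 2 \<le> a then \<Sum>T\<in>DT (R2 a b - {(1, a - 1), (1, a)}) n. F (add_domino T (1, a - 1) (1, a) (Suc n)) else 0) +
    (if 2 \<le> b then \<Sum>T\<in>DT (R2 a b - {(2, b - 1), (2, b)}) n. F (add_domino T (2, b - 1) (2, b) (Suc n)) else 0) +
    (if a = b \<and> 1 \<le> b then \<Sum>T\<in>DT (R2 a b - {(1, a), (2, a)}) n. F (add_domino T (1, a) (2, a) (Suc n)) else 0)"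
  by (subst sum_DT_Suc[OF finite_R2 R2_end_dominoes[OF assms]]) auto

lemma sum_DT_R3_Suc:
  fixes F :: "(nat \<times> nat \<Rightarrow> nat) \<Rightarrow> 'a::comm_ring_1"
  assumes "b < a" "odd b"
  shows "(\<Sum>T\<in>DT (R3 a b) (Suc n). F T) =
    (if b + 2 \<le> a then \<Sum>T\<in>DT (R3 a b - {(1, a - 1), (1, a)}) n. F (add_domino T (1, a - 1) (1, a) (Suc n)) else 0) +
    (if 3 \<le> b then \<Sum>T\<in>DT (R3 a b - {(2, b - 1), (2, b)}) n. F (add_domino T (2, b - 1) (2, b) (Suc n)) else 0) +
    (if b = 1 then \<Sum>T\<in>DT (R3 a b - {(2, 1), (3, 1)}) n. F (add_domino T (2, 1) (3, 1) (Suc n)) else 0)"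
  by (subst sum_DT_Suc[OF finite_R3 R3_end_dominoes[OF assms]]) auto

context
  fixes C :: "(nat \<times> nat) set" and c d :: "nat \<times> nat" and n :: nat
  assumes fin: "finite C" and row: "\<And>e. e \<in> C \<Longrightarrow> 1 \<le> fst e" and ed: "end_domino C c d"
begin

lemma tsum_add_domino_first:
  assumes "fst c = 1" "n \<ge> 1 \<or> fst c = fst d"
  shows "(\<Sum>T\<in>DT (C - {c, d}) n. f (tDesB (Suc n) (add_domino T c d (Suc n)))) = tsum (C - {c, d}) n f"
  unfolding tsum_def
proof (intro sum.cong refl)
  fix T assume T: "T \<in> DT (C - {c, d}) n"
  have "n \<ge> 1 \<Longrightarrow> 1 \<le> ne_row T n" using ne_row_pos[OF T] fin row by auto
  then have "\<not> (n \<ge> 1 \<and> ne_row T n < fst c)" using assms by auto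
  then show "f (tDesB (Suc n) (add_domino T c d (Suc n))) = f (tDesB n T)"
    unfolding tDesB_add_domino[OF T ed assms(2)] by (simp only: if_False)
qed

lemma tsum_add_domino_second:
  assumes "fst c = 2" "n \<ge> 1"
  shows "(\<Sum>T\<in>DT (C - {c, d}) n. f (tDesB (Suc n) (add_domino T c d (Suc n)))) =
     tsum (C - {c, d}) n f + usum (C - {c, d}) n (\<lambda>D. f (insert n D) - f D)"
  unfolding tsum_def usum_def sum.distrib[symmetric]
proof (intro sum.cong refl)
  fix T assume T: "T \<in> DT (C - {c, d}) n"
  show "f (tDesB (Suc n) (add_domino T c d (Suc n))) = f (tDesB n T) +
      (if ne_row T n < 2 then f (insert n (tDesB n T)) - f (tDesB n T) else 0)"
    using tDesB_add_domino[OF T ed disjI1[OF assms(2)]] assms by auto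
qed

lemma usum_add_domino_first:
  assumes "fst c = 1" "fst c = fst d"
  shows "(\<Sum>T\<in>DT (C - {c, d}) n. if ne_row (add_domino T c d (Suc n)) (Suc n) < 2 then f (tDesB (Suc n) (add_domino T c d (Suc n))) else 0) =
     tsum (C - {c, d}) n f"
  unfolding tsum_add_domino_first[OF assms(1) disjI2[OF assms(2)], symmetric]
  using assms(1) ne_row_add_domino[OF _ ed] by (intro sum.cong) auto

lemma usum_add_domino_second:
  assumes "fst c = 2"
  shows "(\<Sum>T\<in>DT (C - {c, d}) n. if ne_row (add_domino T c d (Suc n)) (Suc n) < 2 then f (tDesB (Suc n) (add_domino T c d (Suc n))) else 0) = 0"
  using assms(1) ne_row_add_domino[OF _ ed] by (intro sum.neutral) auto

end

lemma R2_row1_dom: "b + 2 \<le> a \<Longrightarrow> end_domino (R2 a b) (1, a - 1) (1, a)"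
  and R2_row2_dom: "b \<le> a \<Longrightarrow> 2 \<le> b \<Longrightarrow> end_domino (R2 a b) (2, b - 1) (2, b)"
  and R2_vert_dom: "1 \<le> a \<Longrightarrow> end_domino (R2 a a) (1, a) (2, a)"
  by (simp_all only: end_domino_R2[OF order_refl] end_domino_R2[OF order_trans[OF le_add1]] end_domino_R2) auto

lemma tsum_R2_Suc:
  assumes "b \<le> a" "n \<ge> 1"
  shows "tsum (R2 a b) (Suc n) f =
    (if b + 2 \<le> a then tsum (R2 a b - {(1, a - 1), (1, a)}) n f else 0) +
    (if 2 \<le> b then tsum (R2 a b - {(2, b - 1), (2, b)}) n f +
        usum (R2 a b - {(2, b - 1), (2, b)}) n (\<lambda>D. f (insert n D) - f D) else 0) +
    (if a = b \<and> 1 \<le> b then tsum (R2 a b - {(1, a), (2, a)}) n f else 0)"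
  unfolding tsum_def[of "R2 a b" "Suc n"] sum_DT_R2_Suc[OF assms(1)]
  using assms
  by (intro arg_cong2[of _ _ _ _ "(+)"])
     (auto simp del: One_nat_def simp: tsum_add_domino_first[OF finite_R2 R2_row] tsum_add_domino_second[OF finite_R2 R2_row] R2_row1_dom R2_row2_dom R2_vert_dom)

lemma usum_R2_Suc:
  assumes "b + 2 \<le> a"
  shows "usum (R2 a b) (Suc n) f = tsum (R2 a b - {(1, a - 1), (1, a)}) n f"
proof -
  have "b \<le> a" "a \<noteq> b" using assms by auto
  then show ?thesis
    unfolding usum_def sum_DT_R2_Suc[OF \<open>b \<le> a\<close>]
    using assms usum_add_domino_first[OF finite_R2 R2_row R2_row1_dom[OF assms], where n = n and f = f]
      usum_add_domino_second[OF finite_R2 R2_row R2_row2_dom[OF \<open>b \<le> a\<close>], where n = n and f = f]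
    by auto
qed

lemma R3_row1_dom: "b + 2 \<le> a \<Longrightarrow> odd b \<Longrightarrow> end_domino (R3 a b) (1, a - 1) (1, a)"
  and R3_row2_dom: "b < a \<Longrightarrow> odd b \<Longrightarrow> 3 \<le> b \<Longrightarrow> end_domino (R3 a b) (2, b - 1) (2, b)"
  and R3_vert_dom: "1 < a \<Longrightarrow> end_domino (R3 a 1) (2, 1) (3, 1)"
  by (auto simp: end_domino_R3)

lemma tsum_R3_Suc:
  assumes "b < a" "odd b" "n \<ge> 1"
  shows "tsum (R3 a b) (Suc n) f =
    (if b + 2 \<le> a then tsum (R3 a b - {(1, a - 1), (1, a)}) n f else 0) +
    (if 3 \<le> b then tsum (R3 a b - {(2, b - 1), (2, b)}) n f +
        usum (R3 a b - {(2, b - 1), (2, b)}) n (\<lambda>D. f (insert n D) - f D) else 0) +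
    (if b = 1 then tsum (R3 a b - {(2, 1), (3, 1)}) n f +
        usum (R3 a b - {(2, 1), (3, 1)}) n (\<lambda>D. f (insert n D) - f D) else 0)"
  unfolding tsum_def[of "R3 a b" "Suc n"] sum_DT_R3_Suc[OF assms(1,2)]
  using assms
  by (intro arg_cong2[of _ _ _ _ "(+)"])
     (auto simp del: One_nat_def simp: tsum_add_domino_first[OF finite_R3 R3_row] tsum_add_domino_second[OF finite_R3 R3_row] R3_row1_dom R3_row2_dom R3_vert_dom)

lemma usum_R3_Suc:
  assumes "b + 2 \<le> a" "odd b"
  shows "usum (R3 a b) (Suc n) f = tsum (R3 a b - {(1, a - 1), (1, a)}) n f"
proof -
  have "b < a" "a \<noteq> b" using assms by auto
  then show ?thesis
    unfolding usum_def sum_DT_R3_Suc[OF \<open>b < a\<close> assms(2)]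
    using assms usum_add_domino_first[OF finite_R3 R3_row R3_row1_dom[OF assms], where n = n and f = f]
      usum_add_domino_second[OF finite_R3 R3_row R3_row2_dom[OF \<open>b < a\<close> assms(2)], where n = n and f = f]
      usum_add_domino_second[OF finite_R3 R3_row R3_vert_dom[of a], where n = n and f = f]
    by auto
qed

text \<open>A shape \<open>(n + e, n - e)\<close> corresponds to a path with steps \<open>\<plusminus>1\<close> ending at \<open>e\<close> or \<open>-1 - e\<close>, whichever has
the parity of \<open>n\<close>; vertical dominoes are the crossings between \<open>0\<close> and \<open>-1\<close>.\<close>

definition minus_count :: "nat \<Rightarrow> nat \<Rightarrow> nat" where
  "minus_count n e = (if even (n - e) then (n - e) div 2 else (n + 1 + e) div 2)"

lemma tsum_0: "tsum (R2 0 0) 0 f = f {}"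
  by (simp add: tsum_def R2_def DT_0 tDesB_def tDes_def)

lemma tsum_R2_1:
  "tsum (R2 1 1) (Suc 0) f = f {0}" "tsum (R2 2 0) (Suc 0) f = f {}"
proof -
  have e: "R2 1 1 - {(1, 1), (2, 1)} = {}" "R2 2 0 - {(1, 2 - 1), (1, 2)} = {}"
    by (auto simp: R2_def)
  have "tDesB (Suc 0) (add_domino (\<lambda>_. 0) (1, 1) (2, 1) (Suc 0)) = {0}"
    by (simp add: tDesB_def tDes_def add_domino_def)
  then show "tsum (R2 1 1) (Suc 0) f = f {0}"
    unfolding tsum_def sum_DT_R2_Suc[OF order_refl] e(1) DT_0 by simp
  have "tDesB (Suc 0) (add_domino (\<lambda>_. 0) (1, 2 - 1) (1, 2) (Suc 0)) = {}"
    by (simp add: tDesB_def tDes_def add_domino_def)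
  then show "tsum (R2 2 0) (Suc 0) f = f {}"
    unfolding tsum_def sum_DT_R2_Suc[OF zero_le] e(2) DT_0 by simp
qed

text \<open>The last domino lies in row 1 (coming from e - 1), in row 2 (from e + 1), or is vertical
  (e = 0, from 0). Row 2 carries the correction: removing also a preceding domino of row 1 restores
  \<open>e\<close> at length n.\<close>

lemma tsum_two_row:
  assumes "e \<le> n"
  shows "tsum (R2 (n + e) (n - e)) n f = wsum n (minus_count n e) f"
  using assms
proof (induction n arbitrary: e f rule: induct_nat_012)
  case 0
  then show ?case by (simp add: tsum_0 minus_count_def)
next
  case 1
  then consider "e = 0" | "e = 1" by linarith
  then show ?case
  proof cases
    case 1
    then show ?thesis using tsum_R2_1(1)[of f] by (simp add: minus_count_def wsum_1_1)
  next
    case 2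
    then show ?thesis using tsum_R2_1(2)[of f] by (simp add: minus_count_def numeral_2_eq_2)
  qed
next
  case (ge2 n)
  let ?a = "Suc (Suc n) + e" and ?b = "Suc (Suc n) - e"
  let ?d = "\<lambda>D. f (insert (Suc n) D) - f D"
  have first: "tsum (R2 ?a ?b - {(1, ?a - 1), (1, ?a)}) (Suc n) f = wsum (Suc n) (minus_count (Suc n) (e - 1)) f"
    if "1 \<le> e"
  proof -
    have e: "?a = Suc (Suc (Suc n + (e - 1)))" "?b = Suc n - (e - 1)" using that ge2.prems by auto
    have "R2 ?a ?b - {(1, ?a - 1), (1, ?a)} = R2 (Suc n + (e - 1)) (Suc n - (e - 1))"
      using R2_remove_row1[of "Suc n + (e - 1)" "Suc n - (e - 1)"] unfolding e by simp
    then show ?thesis using ge2.IH(2)[of "e - 1" f] ge2.prems by simp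
  qed
  have vert: "tsum (R2 (Suc (Suc n) + 0) (Suc (Suc n) - 0) - {(1, Suc (Suc n) + 0), (2, Suc (Suc n) + 0)}) (Suc n) f =
      wsum (Suc n) (minus_count (Suc n) 0) f"
    using R2_remove_vertical[of "Suc n"] ge2.IH(2)[of 0 f] by simp
  have second: "R2 ?a ?b - {(2, ?b - 1), (2, ?b)} = R2 (Suc n + Suc e) (Suc n - Suc e)" if "e \<le> n"
  proof -
    have "?b = Suc (Suc (Suc n - Suc e))" "?a = Suc n + Suc e" using that by auto
    then show ?thesis using R2_remove_row2[of "Suc n + Suc e" "Suc n - Suc e"] by simp
  qed
  have third: "usum (R2 (Suc n + Suc e) (Suc n - Suc e)) (Suc n) ?d = wsum n (minus_count n e) ?d" if "e \<le> n"
  proof -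
    have "R2 (Suc n + Suc e) (Suc n - Suc e) - {(1, Suc n + Suc e - 1), (1, Suc n + Suc e)} = R2 (n + e) (n - e)"
      using R2_remove_row1[of "n + e" "n - e"] by simp
    then show ?thesis using ge2.IH(1)[OF that, of ?d] usum_R2_Suc[of "Suc n - Suc e" "Suc n + Suc e" n ?d] by simp
  qed
  have "tsum (R2 ?a ?b) (Suc (Suc n)) f =
      (if 1 \<le> e then wsum (Suc n) (minus_count (Suc n) (e - 1)) f else 0) +
      (if e \<le> n then wsum (Suc n) (minus_count (Suc n) (Suc e)) f + wsum n (minus_count n e) ?d else 0) +
      (if e = 0 then wsum (Suc n) (minus_count (Suc n) 0) f else 0)"
  proof -
    have c: "?b + 2 \<le> ?a \<longleftrightarrow> 1 \<le> e" "2 \<le> ?b \<longleftrightarrow> e \<le> n" "?a = ?b \<and> 1 \<le> ?b \<longleftrightarrow> e = 0"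
      using ge2.prems by auto
    have ba: "?b \<le> ?a" "1 \<le> Suc n" by auto
    show ?thesis
      unfolding tsum_R2_Suc[OF ba] c
      by (simp only: first vert second third ge2.IH(2) Suc_le_mono cong: if_cong)
  qed
  also have "\<dots> = wsum (Suc (Suc n)) (minus_count (Suc (Suc n)) e) f"
  proof -
    \<comment> \<open>For n - e even a domino in row 1 keeps the number of minus letters, for n - e
      odd it raises it by one. The recursion does not tell these apart, since the terms with m and m
      + 1 enter alike. At e = 0 the vertical domino takes the part of row 1.\<close>
    consider "e = Suc (Suc n)" | "e = Suc n" | "e \<le> n" "even (n - e)" | "e \<le> n" "odd (n - e)"
      using ge2.prems by linarith
    then show ?thesis
    proof cases
      case 1
      then show ?thesis by (simp add: minus_count_def)
    next
      case 2
      then have "minus_count (Suc (Suc n)) e = Suc (Suc n)" "minus_count (Suc n) (e - 1) = Suc n"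
        by (auto simp: minus_count_def)
      then show ?thesis using 2 by (simp add: wsum_full)
    next
      case 3
      then obtain j where j: "n = e + 2 * j" by (metis evenE le_add_diff_inverse)
      have "minus_count n e = j" "minus_count (Suc (Suc n)) e = Suc j" "minus_count (Suc n) (Suc e) = j"
        "1 \<le> e \<Longrightarrow> minus_count (Suc n) (e - 1) = Suc j" "e = 0 \<Longrightarrow> minus_count (Suc n) 0 = Suc j"
        using j by (auto simp: minus_count_def)
      then show ?thesis using 3 by (cases "e = 0") (simp_all add: wsum_Suc)
    next
      case 4
      then obtain i where i: "n = e + (2 * i + 1)" by (metis oddE le_add_diff_inverse)
      define j where "j = e + i + 1"
      have "minus_count n e = j" "minus_count (Suc (Suc n)) e = Suc j" "minus_count (Suc n) (Suc e) = Suc j"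
        "1 \<le> e \<Longrightarrow> minus_count (Suc n) (e - 1) = j" "e = 0 \<Longrightarrow> minus_count (Suc n) 0 = j"
        using i by (auto simp: minus_count_def j_def)
      then show ?thesis using 4 by (cases "e = 0") (simp_all add: wsum_Suc)
    qed
  qed
  finally show ?case .
qed

text \<open>The value at k = 0 is the single row left when the vertical domino leaves a shape with
  second row 1; there the recursion meets its start.\<close>

definition shape3 :: "nat \<Rightarrow> nat \<Rightarrow> (nat \<times> nat) set" where
  "shape3 n k = (if k = 0 then R2 (2 * n) 0 else R3 (2 * n - 2 * k) (2 * k - 1))"

text \<open>A last domino in row 1 plays the final plus of a ballot word; one in row 2, or in rows 2
  and 3 when the second row has length 1, plays the final minus.\<close>

lemma tsum_three_row:
  assumes "2 * k \<le> n"
  shows "tsum (shape3 n k) n f = bsum n k f"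
  using assms
proof (induction n arbitrary: k f rule: induct_nat_012)
  case 0
  then show ?case by (simp add: tsum_0 shape3_def)
next
  case 1
  then have "k = 0" by simp
  then show ?case using tsum_R2_1(2)[of f] by (simp add: shape3_def)
next
  case (ge2 n)
  let ?d = "\<lambda>D. f (insert (Suc n) D) - f D"
  show ?case
  proof (cases k)
    case 0
    have "tsum (R2 (Suc (Suc n) + Suc (Suc n)) (Suc (Suc n) - Suc (Suc n))) (Suc (Suc n)) f = f {}"
      by (subst tsum_two_row) (simp_all add: minus_count_def)
    then show ?thesis using 0 by (simp add: shape3_def mult_2)
  next
    case (Suc j)
    have j: "2 * j \<le> n" using Suc ge2.prems by simp
    let ?a = "2 * Suc (Suc n) - 2 * k" and ?b = "2 * k - 1"
    have ab: "?b < ?a" "odd ?b" "1 \<le> Suc n" using Suc ge2.prems by auto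
    have s: "shape3 (Suc (Suc n)) k = R3 ?a ?b" using Suc by (simp add: shape3_def)
    have first: "tsum (R3 ?a ?b - {(1, ?a - 1), (1, ?a)}) (Suc n) f = bsum (Suc n) k f" if "2 * k \<le> Suc n"
    proof -
      have "?a = Suc (Suc (2 * Suc n - 2 * k))" using that by simp
      then have "R3 ?a ?b - {(1, ?a - 1), (1, ?a)} = shape3 (Suc n) k"
        using R3_remove_row1[of "2 * Suc n - 2 * k" ?b] Suc by (simp add: shape3_def)
      then show ?thesis using ge2.IH(2)[of k f] that by simp
    qed
    have second: "R3 ?a ?b - {(2, ?b - 1), (2, ?b)} = shape3 (Suc n) j" if "3 \<le> ?b"
    proof -
      have "?b = Suc (Suc (2 * j - 1))" "?a = 2 * Suc n - 2 * j" "j \<noteq> 0" using that Suc by auto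
      then show ?thesis using R3_remove_row2[of ?a "2 * j - 1"] by (simp add: shape3_def)
    qed
    have vert: "R3 ?a 1 - {(2, 1), (3, 1)} = shape3 (Suc n) j" if "?b = 1"
    proof -
      have "j = 0" "?a = 2 * Suc n" using that Suc by auto
      then show ?thesis using R3_remove_vertical[of ?a] that by (simp add: shape3_def)
    qed
    have third: "usum (shape3 (Suc n) j) (Suc n) ?d = bsum n j ?d"
    proof (cases j)
      case 0
      have "2 * Suc n = Suc (Suc (2 * n))" by simp
      then have "R2 (2 * Suc n) 0 - {(1, 2 * Suc n - 1), (1, 2 * Suc n)} = R2 (2 * n) 0"
        using R2_remove_row1[of "2 * n" 0] by simp
      then show ?thesis using 0 ge2.IH(1)[of 0 ?d] usum_R2_Suc[of 0 "2 * Suc n" n ?d] by (simp add: shape3_def)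
    next
      case (Suc i)
      have e: "2 * Suc n - 2 * j = Suc (Suc (2 * n - 2 * j))" using j by simp
      then have "R3 (2 * Suc n - 2 * j) (2 * j - 1) - {(1, 2 * Suc n - 2 * j - 1), (1, 2 * Suc n - 2 * j)} =
          R3 (2 * n - 2 * j) (2 * j - 1)"
        using R3_remove_row1[of "2 * n - 2 * j" "2 * j - 1"] by simp
      then show ?thesis using Suc j ge2.IH(1)[OF j, of ?d]
          usum_R3_Suc[of "2 * j - 1" "2 * Suc n - 2 * j" n ?d] by (simp add: shape3_def)
    qed
    have "?b + 2 \<le> ?a \<longleftrightarrow> 2 * k \<le> Suc n" using Suc ge2.prems by (simp, presburger)
    moreover have "tsum (shape3 (Suc n) j) (Suc n) f = bsum (Suc n) j f"
      using ge2.IH(2)[of j f] j by simp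
    ultimately have "tsum (R3 ?a ?b) (Suc (Suc n)) f =
        (if 2 * k \<le> Suc n then bsum (Suc n) k f else 0) +
        (if 3 \<le> ?b then bsum (Suc n) j f + bsum n j ?d else 0) +
        (if ?b = 1 then bsum (Suc n) j f + bsum n j ?d else 0)"
      unfolding tsum_R3_Suc[OF ab] by (simp only: first second vert third cong: if_cong)
    moreover have "3 \<le> ?b \<and> ?b \<noteq> 1 \<or> \<not> 3 \<le> ?b \<and> ?b = 1" using Suc by auto
    ultimately have "tsum (R3 ?a ?b) (Suc (Suc n)) f = bsum (Suc n) k f + (bsum (Suc n) j f + bsum n j ?d)"
      by (auto simp: bsum_gt)
    then show ?thesis unfolding s using bsum_Suc[OF j, of f] Suc by (simp add: add.assoc)
  qed
qed

section \<open>The pattern class of fully commutative elements\<close>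

text \<open>The excluded signed patterns, contraposed; letters have distinct absolute values, so the
non-strict conclusions mean strict ones.\<close>

definition fc_pattern :: "int \<Rightarrow> (int \<Rightarrow> int) \<Rightarrow> bool" where
  "fc_pattern n w \<longleftrightarrow>
     (\<forall>i j. 1 \<le> i \<longrightarrow> i < j \<longrightarrow> j \<le> n \<longrightarrow> w j < w i \<longrightarrow> 0 \<le> w i) \<and>
     (\<forall>i j k. 1 \<le> i \<longrightarrow> i < j \<longrightarrow> j < k \<longrightarrow> k \<le> n \<longrightarrow> w j < \<bar>w i\<bar> \<longrightarrow> w j \<le> w k) \<and>
     (\<forall>i j k. 1 \<le> i \<longrightarrow> i < j \<longrightarrow> j < k \<longrightarrow> k \<le> n \<longrightarrow> 0 < w i \<longrightarrow> w i < - w j \<longrightarrow> w i \<le> w k)"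

lemma fc_pattern1: "fc_pattern n w \<Longrightarrow> 1 \<le> i \<Longrightarrow> i < j \<Longrightarrow> j \<le> n \<Longrightarrow> w j < w i \<Longrightarrow> 0 \<le> w i"
  and fc_pattern2: "fc_pattern n w \<Longrightarrow> 1 \<le> i \<Longrightarrow> i < j \<Longrightarrow> j < k \<Longrightarrow> k \<le> n \<Longrightarrow> w j < \<bar>w i\<bar> \<Longrightarrow> w j \<le> w k"
  and fc_pattern3: "fc_pattern n w \<Longrightarrow> 1 \<le> i \<Longrightarrow> i < j \<Longrightarrow> j < k \<Longrightarrow> k \<le> n \<Longrightarrow> 0 < w i \<Longrightarrow> w i < - w j \<Longrightarrow> w i \<le> w k"
  unfolding fc_pattern_def by blast+

lemma fc_pattern_cong: "(\<And>i. 1 \<le> i \<Longrightarrow> i \<le> n \<Longrightarrow> w i = v i) \<Longrightarrow> fc_pattern n w = fc_pattern n v"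
proof -
  have "fc_pattern n v" if "fc_pattern n w" "\<And>i. 1 \<le> i \<Longrightarrow> i \<le> n \<Longrightarrow> w i = v i" for w v
    unfolding fc_pattern_def
  proof (intro conjI allI impI)
    fix i j assume "1 \<le> i" "i < j" "j \<le> n" "v j < v i"
    then show "0 \<le> v i" using fc_pattern1[OF that(1), of i j] that(2)[of i] that(2)[of j] by simp
  next
    fix i j k assume "1 \<le> i" "i < j" "j < k" "k \<le> n" "v j < \<bar>v i\<bar>"
    then show "v j \<le> v k" using fc_pattern2[OF that(1), of i j k] that(2)[of i] that(2)[of j] that(2)[of k] by simp
  next
    fix i j k assume "1 \<le> i" "i < j" "j < k" "k \<le> n" "0 < v i" "v i < - v j"
    then show "v i \<le> v k" using fc_pattern3[OF that(1), of i j k] that(2)[of i] that(2)[of j] that(2)[of k] by simp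
  qed
  then show "(\<And>i. 1 \<le> i \<Longrightarrow> i \<le> n \<Longrightarrow> w i = v i) \<Longrightarrow> fc_pattern n w = fc_pattern n v"
    by (metis (no_types))
qed

section \<open>Stability of the pattern class under removal of a descent, and the converse\<close>

definition swp :: "int \<Rightarrow> int \<Rightarrow> int" where
  "swp a x = (if x = a then a + 1 else if x = a + 1 then a else x)"

lemma swp_less: "i < j \<Longrightarrow> \<not> (i = a \<and> j = a + 1) \<Longrightarrow> swp a i < swp a j"
  by (auto simp: swp_def)

lemma swp_range: "1 \<le> a \<Longrightarrow> a < n \<Longrightarrow> 1 \<le> x \<Longrightarrow> x \<le> n \<Longrightarrow> 1 \<le> swp a x \<and> swp a x \<le> n"
  by (auto simp: swp_def)

text \<open>The swap reverses only the positions a and a + 1. A violation that uses both comes from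
  one of another kind in \<open>w\<close>: of the second condition from the third, and
  conversely.\<close>

lemma fc_pattern_swap:
  assumes g: "fc_pattern n w" and a: "1 \<le> a" "a < n" "w (a + 1) < w a" and nz: "\<And>i. w i = 0 \<Longrightarrow> i = 0"
  shows "fc_pattern n (\<lambda>x. w (swp a x))"
  unfolding fc_pattern_def
proof (intro conjI allI impI)
  have sa: "swp a a = a + 1" "swp a (a + 1) = a" by (auto simp: swp_def)
  have r: "1 \<le> swp a x" "swp a x \<le> n" if "1 \<le> x" "x \<le> n" for x using swp_range a that by auto
  { fix i j assume *: "1 \<le> i" "i < j" "j \<le> n" "w (swp a j) < w (swp a i)"
    then have "\<not> (i = a \<and> j = a + 1)" using sa a(3) by auto
    then have "swp a i < swp a j" using swp_less *(2) by blast
    then show "0 \<le> w (swp a i)" using fc_pattern1[OF g] * r by force }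
  { fix i j k assume *: "1 \<le> i" "i < j" "j < k" "k \<le> n" "w (swp a j) < \<bar>w (swp a i)\<bar>"
    show "w (swp a j) \<le> w (swp a k)"
    proof (rule ccontr)
      assume "\<not> w (swp a j) \<le> w (swp a k)"
      then have lt: "w (swp a k) < w (swp a j)" by simp
      then have "\<not> (j = a \<and> k = a + 1)" using sa a(3) by auto
      then have jk: "swp a j < swp a k" using swp_less *(3) by blast
      show False
      proof (cases "i = a \<and> j = a + 1")
        case True
        then have k: "swp a k = k" "a + 1 < k" using * by (auto simp: swp_def)
        have "w a < \<bar>w (a + 1)\<bar>" "w k < w a" using True * lt sa k by auto
        moreover have "0 \<le> w a" using fc_pattern1[OF g, of a "a + 1"] a by simp
        moreover have "w a \<noteq> 0" using nz[of a] a by auto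
        \<comment> \<open>\<open>w (a + 1)\<close> is smaller than \<open>w a\<close> but larger in
          absolute value, hence negative.\<close>
        moreover have "w a < - w (a + 1)" using \<open>w a < \<bar>w (a + 1)\<bar>\<close> a(3) \<open>0 \<le> w a\<close> by arith
        ultimately show False using fc_pattern3[OF g, of a "a + 1" k] a * k by auto
      next
        case False
        then have "swp a i < swp a j" using swp_less *(2) by blast
        then show False using fc_pattern2[OF g, of "swp a i" "swp a j" "swp a k"] jk * lt r by force
      qed
    qed }
  { fix i j k assume *: "1 \<le> i" "i < j" "j < k" "k \<le> n" "0 < w (swp a i)" "w (swp a i) < - w (swp a j)"
    show "w (swp a i) \<le> w (swp a k)"
    proof (rule ccontr)
      assume "\<not> w (swp a i) \<le> w (swp a k)"
      then have lt: "w (swp a k) < w (swp a i)" by simp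
      have "\<not> (i = a \<and> j = a + 1)" using * sa a(3) by auto
      then have ij: "swp a i < swp a j" using swp_less *(2) by blast
      show False
      proof (cases "j = a \<and> k = a + 1")
        case True
        then have i: "swp a i = i" "i < a" using * by (auto simp: swp_def)
        then show False using fc_pattern2[OF g, of i a "a + 1"] True * lt sa a by auto
      next
        case False
        then have "swp a j < swp a k" using swp_less *(3) by blast
        then show False using fc_pattern3[OF g, of "swp a i" "swp a j" "swp a k"] ij * lt r by force
      qed
    qed }
qed

lemma fc_pattern_flip:
  assumes g: "fc_pattern n w" and "w 1 < 0"
  shows "fc_pattern n (w(1 := - w 1))"
  unfolding fc_pattern_def
proof (intro conjI allI impI)
  let ?v = "w(1 := - w 1)"
  { fix i j assume *: "1 \<le> i" "i < j" "j \<le> n" "?v j < ?v i"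
    then show "0 \<le> ?v i" using fc_pattern1[OF g, of i j] assms(2) by (cases "i = 1") auto }
  { fix i j k assume *: "1 \<le> i" "i < j" "j < k" "k \<le> n" "?v j < \<bar>?v i\<bar>"
    then show "?v j \<le> ?v k" using fc_pattern2[OF g, of i j k] by (cases "i = 1") auto }
  { fix i j k assume *: "1 \<le> i" "i < j" "j < k" "k \<le> n" "0 < ?v i" "?v i < - ?v j"
    then show "?v i \<le> ?v k"
      using fc_pattern3[OF g, of i j k] fc_pattern1[OF g, of i j] assms(2) by (cases "i = 1") auto }
qed

text \<open>A discrete intermediate value argument; it supplies a descent away from a given
  violation.\<close>

lemma sign_change:
  fixes w :: "int \<Rightarrow> int"
  assumes "1 \<le> i" "i \<le> m" "0 < w i" "w m < 0" "\<And>t. i \<le> t \<Longrightarrow> t \<le> m \<Longrightarrow> w t \<noteq> 0"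
  shows "\<exists>t. i \<le> t \<and> t < m \<and> w (t + 1) < w t"
  using assms(2,4,5)
proof (induction m rule: int_ge_induct)
  case base
  then show ?case using assms(3) by simp
next
  case (step m)
  show ?case
  proof (cases "w m < 0")
    case True
    then obtain t where "i \<le> t \<and> t < m \<and> w (t + 1) < w t" using step by force
    then show ?thesis by force
  next
    case False
    then show ?thesis using step.hyps step.prems(1) by (intro exI[of _ m]) auto
  qed
qed

text \<open>Contraposed: a violation forces two adjacent descents or survives the removal of some
  descent. Each of \<open>T1\<close> to \<open>T4\<close> shrinks or shifts a violation until a
  descent next to it or apart from it can be removed without destroying it.\<close>

lemma fc_pattern_from_descents:
  fixes w :: "int \<Rightarrow> int"
  assumes nz: "\<And>i. w i = 0 \<Longrightarrow> i = 0" and inj: "\<And>i j. w i = w j \<Longrightarrow> i = j"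
    and n1: "\<And>i. 1 \<le> i \<Longrightarrow> i + 2 \<le> n \<Longrightarrow> w (i + 1) < w i \<Longrightarrow> w (i + 2) < w (i + 1) \<Longrightarrow> False"
    and n2: "2 \<le> n \<Longrightarrow> w 1 < 0 \<Longrightarrow> w 2 < w 1 \<Longrightarrow> False"
    and sw: "\<And>a. 1 \<le> a \<Longrightarrow> a < n \<Longrightarrow> w (a + 1) < w a \<Longrightarrow> fc_pattern n (\<lambda>x. w (swp a x))"
    and s0: "1 \<le> n \<Longrightarrow> w 1 < 0 \<Longrightarrow> fc_pattern n (w(1 := - w 1))"
  shows "fc_pattern n w"
proof -
  have T1: "\<not> (w j < w i \<and> w i < 0)" if "1 \<le> i" "i < j" "j \<le> n" for i j
    using that
  proof (induction "nat j" arbitrary: i j rule: less_induct)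
    case less
    show ?case
    proof
      assume b: "w j < w i \<and> w i < 0"
      show False
      proof (cases "i < j - 1")
        case True
        show False
        proof (cases "w j < w (j - 1)")
          case True
          then have "fc_pattern n (\<lambda>x. w (swp (j - 1) x))" using sw[of "j - 1"] less.prems \<open>i < j - 1\<close> by simp
          from fc_pattern1[OF this, of i "j - 1"] show False using less.prems \<open>i < j - 1\<close> b by (simp add: swp_def)
        next
          case False
          then have "w (j - 1) < w i" using b inj[of "j - 1" j] by linarith
          then show False using less.hyps[of "j - 1" i] less.prems \<open>i < j - 1\<close> b by simp
        qed
      next
        case False
        then have j: "j = i + 1" using less.prems by simp
        show False
        proof (cases "i = 1")
          case True
          then show False using n2 b j less.prems by simp
        next
          case i1: False
          have "\<not> w i < w (i - 1)" using n1[of "i - 1"] i1 less.prems j b by (auto simp: add.commute)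
          then have neg: "w (i - 1) < 0" using b by simp
          show False
          \<comment> \<open>The two letters are adjacent, so a descent further left is removed: 0 if
            the first letter is negative, otherwise one at a sign change before i - 1.\<close>
          proof (cases "w 1 < 0")
            case True
            from fc_pattern1[OF s0[OF _ this], of i j] show False using i1 less.prems b by auto
          next
            case False
            then have "0 < w 1" using nz[of 1] by fastforce
            then obtain t where t: "1 \<le> t" "t < i - 1" "w (t + 1) < w t"
              using sign_change[of 1 "i - 1" w] neg nz i1 less.prems by fastforce
            then have "fc_pattern n (\<lambda>x. w (swp t x))" using sw less.prems by simp
            from fc_pattern1[OF this, of i j] show False using less.prems t b by (simp add: swp_def)
          qed
        qed
      qed
    qed
  qed
  have T2: "\<not> (w j < w i \<and> w k < w j)" if "1 \<le> i" "i < j" "j < k" "k \<le> n" for i j k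
    using that
  proof (induction "nat (k - i)" arbitrary: i j k rule: less_induct)
    case less
    show ?case
    proof
      assume b: "w j < w i \<and> w k < w j"
      consider "i < j - 1" | "j < k - 1" | "j = i + 1" "k = i + 2" using less.prems by linarith
      then show False
      proof cases
        case 1
        show False
        proof (cases "w (i + 1) < w j")
          case True
          then have "fc_pattern n (\<lambda>x. w (swp i x))" using sw[of i] b less.prems by simp
          from fc_pattern2[OF this, of "i + 1" j k] show False using less.prems 1 b abs_ge_self[of "w i"] by (simp add: swp_def)
        next
          case False
          then have "w j < w (i + 1)" using inj[of "i + 1" j] 1 by fastforce
          then show False using less.hyps[of k "i + 1" j] less.prems 1 b by simp
        qed
      next
        case 2
        show False
        proof (cases "w j < w (k - 1)")
          case True
          then have "fc_pattern n (\<lambda>x. w (swp (k - 1) x))" using sw[of "k - 1"] b less.prems by simp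
          from fc_pattern2[OF this, of i j "k - 1"] show False using less.prems 2 b abs_ge_self[of "w i"] by (simp add: swp_def)
        next
          case False
          then have "w (k - 1) < w j" using inj[of "k - 1" j] 2 by fastforce
          then show False using less.hyps[of "k - 1" i j] less.prems 2 b by simp
        qed
      next
        case 3
        then show False using n1[of i] less.prems(1,4) b unfolding \<open>j = i + 1\<close> \<open>k = i + 2\<close> by blast
      qed
    qed
  qed
  \<comment> \<open>The negative letter moves left past ascents, growing in absolute value, until a
    descent precedes it or it reaches position 1. There the sign flip leaves an ordinary
    321.\<close>
  have T3: "\<not> (w i < 0 \<and> w j < - w i \<and> w k < w j)" if "1 \<le> i" "i < j" "j < k" "k \<le> n" for i j k
    using that
  proof (induction "nat i" arbitrary: i rule: less_induct)
    case less
    show ?case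
    proof
      assume b: "w i < 0 \<and> w j < - w i \<and> w k < w j"
      show False
      proof (cases "i = 1")
        case True
        have "fc_pattern n (w(1 := - w 1))" using s0 b True less.prems by simp
        from fc_pattern2[OF this, of 1 j k] show False using b True less.prems by auto
      next
        case False
        show False
        proof (cases "w i < w (i - 1)")
          case True
          then have "fc_pattern n (\<lambda>x. w (swp (i - 1) x))" using sw[of "i - 1"] False less.prems by simp
          from fc_pattern2[OF this, of "i - 1" j k] show False using b False less.prems by (auto simp: swp_def)
        next
          case F: False
          then show False using less.hyps[of "i - 1"] False less.prems b by simp
        qed
      qed
    qed
  qed
  \<comment> \<open>Here the negative letter moves left towards i; once adjacent, removing the
    descent at i turns the third kind of violation into the second.\<close>
  have T4: "\<not> (0 < w i \<and> w i < - w j \<and> w k < w i)" if "1 \<le> i" "i < j" "j < k" "k \<le> n" for i j k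
    using that
  proof (induction "nat (j - i)" arbitrary: j rule: less_induct)
    case less
    show ?case
    proof
      assume b: "0 < w i \<and> w i < - w j \<and> w k < w i"
      show False
      proof (cases "j = i + 1")
        case True
        then have "fc_pattern n (\<lambda>x. w (swp i x))" using sw[of i] b less.prems by simp
        from fc_pattern2[OF this, of i "i + 1" k] show False using b True less.prems by (auto simp: swp_def)
      next
        case False
        show False
        proof (cases "w j < w (j - 1)")
          case True
          then have "fc_pattern n (\<lambda>x. w (swp (j - 1) x))" using sw[of "j - 1"] False less.prems by simp
          from fc_pattern3[OF this, of i "j - 1" k] show False using b False less.prems by (auto simp: swp_def)
        next
          case F: False
          then show False using less.hyps[of "j - 1"] False less.prems b by simp
        qed
      qed
    qed
  qed
  show ?thesis
    unfolding fc_pattern_def using T1 T2 T3 T4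
    by (auto simp: abs_if not_less split: if_splits) (meson linorder_not_le)+
qed

section \<open>Length and descents of signed permutations\<close>

lemma BnD:
  assumes "w \<in> Bn n"
  shows Bn_minus: "w (- i) = - w i" and Bn_inj: "w i = w j \<longleftrightarrow> i = j" and Bn_zero: "w i = 0 \<longleftrightarrow> i = 0"
    and Bn_fix: "int n < \<bar>i\<bar> \<Longrightarrow> w i = i" and Bn_range: "\<bar>i\<bar> \<le> int n \<Longrightarrow> \<bar>w i\<bar> \<le> int n"
proof -
  have b: "bij w" and m: "\<And>i. w (- i) = - w i" and f: "\<And>i. int n < \<bar>i\<bar> \<Longrightarrow> w i = i"
    using assms by (auto simp: Bn_def)
  show "w (- i) = - w i" by (rule m)
  show i: "w i = w j \<longleftrightarrow> i = j" for i j using b by (auto simp: bij_def inj_def)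
  have 0: "w 0 = 0" using m[of 0] by simp
  then show "w i = 0 \<longleftrightarrow> i = 0" using i[of i 0] by simp
  show "int n < \<bar>i\<bar> \<Longrightarrow> w i = i" by (rule f)
  show "\<bar>w i\<bar> \<le> int n" if "\<bar>i\<bar> \<le> int n"
  proof (rule ccontr)
    assume "\<not> \<bar>w i\<bar> \<le> int n"
    then have "w (w i) = w i" using f by simp
    then show False using i[of "w i" i] that \<open>\<not> \<bar>w i\<bar> \<le> int n\<close> by simp
  qed
qed

lemma gen_gen [simp]: "gen a (gen a j) = j"
  by (auto simp: gen_def abs_if)

lemma gen_comp [simp]: "gen a \<circ> gen a = id"
  by (rule ext) simp

lemma gen_minus: "gen a (- j) = - gen a j"
  by (auto simp: gen_def)

lemma gen_Bn: "a < n \<Longrightarrow> gen a \<in> Bn n"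
proof -
  assume a: "a < n"
  have "bij (gen a)" by (rule o_bij[of "gen a"]) simp_all
  moreover have "int n < \<bar>i\<bar> \<Longrightarrow> gen a i = i" for i using a by (auto simp: gen_def abs_if split: if_splits)
  ultimately show ?thesis by (simp add: Bn_def gen_minus)
qed

lemma Bn_comp: "w \<in> Bn n \<Longrightarrow> v \<in> Bn n \<Longrightarrow> w \<circ> v \<in> Bn n"
  by (auto simp: Bn_def intro: bij_comp)

lemma Bn_gen: "w \<in> Bn n \<Longrightarrow> a < n \<Longrightarrow> w \<circ> gen a \<in> Bn n"
  by (intro Bn_comp gen_Bn)

lemma id_Bn: "id \<in> Bn n" by (simp add: Bn_def)

lemma gen_swp: "1 \<le> a \<Longrightarrow> 1 \<le> x \<Longrightarrow> gen a x = swp (int a) x"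
  by (auto simp: gen_def swp_def)

lemma desB_iff: "a \<in> desB n w \<longleftrightarrow> a < n \<and> w (int a + 1) < w (int a)"
  by (auto simp: desB_def)

lemma desB_0: "w \<in> Bn n \<Longrightarrow> 0 \<in> desB n w \<longleftrightarrow> 0 < n \<and> w 1 < 0"
  using Bn_zero[of w n 0] by (simp add: desB_iff)

lemma gen_at: "1 \<le> a \<Longrightarrow> gen a (int a) = int a + 1" "1 \<le> a \<Longrightarrow> gen a (int a + 1) = int a"
  "gen 0 1 = -1" "gen 0 0 = 0"
  by (auto simp: gen_def)

lemma gen_other: "b + 2 \<le> a \<or> a + 2 \<le> b \<Longrightarrow> gen a (int b) = int b \<and> gen a (int b + 1) = int b + 1"
  by (auto simp: gen_def)

lemma desB_comp_gen:
  assumes "w \<in> Bn n" "a < n"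
  shows "a \<in> desB n (w \<circ> gen a) \<longleftrightarrow> a \<notin> desB n w"
proof (cases "a = 0")
  case True
  have "w (gen 0 1) = - w 1" using Bn_minus[OF assms(1), of 1] by (simp add: gen_at)
  moreover have "w 1 \<noteq> 0" using Bn_zero[OF assms(1)] by simp
  ultimately show ?thesis using True assms desB_0[OF Bn_gen[OF assms]] desB_0[OF assms(1)] by auto
next
  case False
  have "w (int a) \<noteq> w (int a + 1)" using Bn_inj[OF assms(1)] by simp
  then show ?thesis using False assms by (auto simp: desB_iff gen_at)
qed

definition ipairs :: "nat \<Rightarrow> (int \<Rightarrow> int) \<Rightarrow> (int \<times> int) set" where
  "ipairs n w = {(i, j). - int n \<le> i \<and> i < j \<and> j \<le> int n \<and> i \<noteq> 0 \<and> j \<noteq> 0 \<and> w j < w i}"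

definition negs :: "nat \<Rightarrow> (int \<Rightarrow> int) \<Rightarrow> int set" where
  "negs n w = {j. 1 \<le> j \<and> j \<le> int n \<and> w j < 0}"

text \<open>A pair \<open>(i, j)\<close> and its mirror image \<open>(-j, -i)\<close> represent the same root, and coincide only for
\<open>i = -j\<close>; counting the latter twice makes \<open>ilen\<close> twice the length.\<close>

definition ilen :: "nat \<Rightarrow> (int \<Rightarrow> int) \<Rightarrow> nat" where
  "ilen n w = card (ipairs n w) + card (negs n w)"

lemma finite_ipairs [simp]: "finite (ipairs n w)"
  by (rule finite_subset[of _ "{- int n..int n} \<times> {- int n..int n}"]) (auto simp: ipairs_def)

lemma finite_negs [simp]: "finite (negs n w)"
  by (rule finite_subset[of _ "{1..int n}"]) (auto simp: negs_def)

definition simple_pairs :: "nat \<Rightarrow> (int \<times> int) set" where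
  "simple_pairs a = (if a = 0 then {(-1, 1)} else {(int a, int a + 1), (- int a - 1, - int a)})"

lemma gen_less: "i < j \<Longrightarrow> i \<noteq> 0 \<Longrightarrow> j \<noteq> 0 \<Longrightarrow> (i, j) \<notin> simple_pairs a \<Longrightarrow>
    gen a i < gen a j \<and> (gen a i, gen a j) \<notin> simple_pairs a"
  by (cases "a = 0") (auto simp: gen_def simple_pairs_def abs_if split: if_splits)

lemma gen_range: "a < n \<Longrightarrow> - int n \<le> i \<Longrightarrow> i \<le> int n \<Longrightarrow> - int n \<le> gen a i \<and> gen a i \<le> int n"
  by (auto simp: gen_def)

lemma gen_nz: "gen a i = 0 \<longleftrightarrow> i = 0"
  by (auto simp: gen_def)

text \<open>A generator reverses only the pairs in \<open>simple_pairs\<close>, which at a descent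
  are inversions of \<open>w\<close>; it carries the other inversions along bijectively.\<close>

lemma ipairs_comp_gen:
  assumes w: "w \<in> Bn n" and a: "a \<in> desB n w"
  shows "ipairs n (w \<circ> gen a) = map_prod (gen a) (gen a) ` (ipairs n w - simple_pairs a)"
proof -
  have an: "a < n" using a by (simp add: desB_iff)
  have S: "(i, j) \<in> simple_pairs a \<Longrightarrow> w (gen a i) < w (gen a j)" for i j
  proof -
    assume "(i, j) \<in> simple_pairs a"
    then consider "a = 0" "i = -1" "j = 1" | "a \<ge> 1" "i = int a" "j = int a + 1"
      | "a \<ge> 1" "i = - (int a + 1)" "j = - int a"
      by (auto simp: simple_pairs_def split: if_splits)
    then show ?thesis
    proof cases
      case 1
      then show ?thesis using a desB_0[OF w] Bn_minus[OF w, of 1] gen_minus[of 0 1] by (auto simp: gen_at)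
    next
      case 2
      then show ?thesis using a by (simp add: gen_at desB_iff)
    next
      case 3
      then show ?thesis using a unfolding 3 gen_minus Bn_minus[OF w] by (simp add: gen_at desB_iff)
    qed
  qed
  show ?thesis
  proof (intro subset_antisym subsetI)
    fix p assume p: "p \<in> ipairs n (w \<circ> gen a)"
    obtain i j where ij: "p = (i, j)" by fastforce
    have h: "- int n \<le> i" "i < j" "j \<le> int n" "i \<noteq> 0" "j \<noteq> 0" "w (gen a j) < w (gen a i)"
      using p ij by (auto simp: ipairs_def)
    have "(i, j) \<notin> simple_pairs a" using S[of i j] h by auto
    then have g: "gen a i < gen a j" "(gen a i, gen a j) \<notin> simple_pairs a" using gen_less h by blast+
    have "- int n \<le> gen a i" "gen a j \<le> int n" using gen_range[OF an, of i] gen_range[OF an, of j] h by auto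
    then have "(gen a i, gen a j) \<in> ipairs n w - simple_pairs a"
      using g h by (simp add: ipairs_def gen_nz)
    then have "map_prod (gen a) (gen a) (gen a i, gen a j) \<in> map_prod (gen a) (gen a) ` (ipairs n w - simple_pairs a)"
      by (rule imageI)
    then show "p \<in> map_prod (gen a) (gen a) ` (ipairs n w - simple_pairs a)" using ij by simp
  next
    fix p assume "p \<in> map_prod (gen a) (gen a) ` (ipairs n w - simple_pairs a)"
    then obtain i j where ij: "p = (gen a i, gen a j)" "(i, j) \<in> ipairs n w" "(i, j) \<notin> simple_pairs a" by auto
    then have h: "- int n \<le> i" "i < j" "j \<le> int n" "i \<noteq> 0" "j \<noteq> 0" "w j < w i" by (auto simp: ipairs_def)
    then have "gen a i < gen a j" using gen_less ij by blast
    moreover have "- int n \<le> gen a i" "gen a j \<le> int n" using gen_range[OF an, of i] gen_range[OF an, of j] h by auto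
    ultimately show "p \<in> ipairs n (w \<circ> gen a)" using h ij(1) by (simp add: ipairs_def gen_nz)
  qed
qed

text \<open>For a >= 1 two mirror pairs disappear; for a = 0 it is the pair (-1, 1) and the negative
  position 1. The drop is 2 either way.\<close>

lemma ilen_descent:
  assumes w: "w \<in> Bn n" and a: "a \<in> desB n w"
  shows "ilen n w = ilen n (w \<circ> gen a) + 2"
proof -
  have an: "a < n" using a by (simp add: desB_iff)
  have inj: "inj_on (map_prod (gen a) (gen a)) A" for A
    by (rule inj_on_inverseI[of _ "map_prod (gen a) (gen a)"]) auto
  have sub: "simple_pairs a \<subseteq> ipairs n w"
  proof (cases "a = 0")
    case True
    then show ?thesis using a desB_0[OF w] Bn_minus[OF w, of 1] by (auto simp: simple_pairs_def ipairs_def)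
  next
    case False
    then show ?thesis using a an Bn_minus[OF w, of "int a"] Bn_minus[OF w, of "int a + 1"]
      by (auto simp: simple_pairs_def ipairs_def desB_iff)
  qed
  have c: "card (ipairs n w) = card (ipairs n (w \<circ> gen a)) + card (simple_pairs a)"
    unfolding ipairs_comp_gen[OF assms] card_image[OF inj]
    using sub by (simp add: card_Diff_subset finite_subset card_mono)
  show ?thesis
  proof (cases "a = 0")
    case True
    have "w (gen 0 x) = (if x = 1 then - w 1 else w x)" if "1 \<le> x" for x
      using that Bn_minus[OF w, of 1] by (simp add: gen_def)
    then have "negs n w = insert 1 (negs n (w \<circ> gen a))" "1 \<notin> negs n (w \<circ> gen a)"
      using True a desB_0[OF w] by (auto simp: negs_def split: if_splits)
    then show ?thesis using c True by (simp add: ilen_def simple_pairs_def)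
  next
    case False
    have "negs n (w \<circ> gen a) = gen a ` negs n w"
    proof (intro subset_antisym subsetI)
      have r: "1 \<le> gen a x \<and> gen a x \<le> int n" if "1 \<le> x" "x \<le> int n" for x
        using that False an by (auto simp: gen_def)
      { fix x assume "x \<in> negs n (w \<circ> gen a)"
        then have "gen a x \<in> negs n w" using r by (auto simp: negs_def)
        then show "x \<in> gen a ` negs n w" by (metis gen_gen image_eqI) }
      { fix x assume "x \<in> gen a ` negs n w"
        then show "x \<in> negs n (w \<circ> gen a)" using r by (auto simp: negs_def) }
    qed
    moreover have "inj_on (gen a) (negs n w)" by (rule inj_on_inverseI[of _ "gen a"]) simp
    ultimately have "card (negs n (w \<circ> gen a)) = card (negs n w)" by (simp add: card_image)
    then show ?thesis using c False by (simp add: ilen_def simple_pairs_def)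
  qed
qed

lemma ilen_ascent:
  assumes "w \<in> Bn n" "a < n" "a \<notin> desB n w"
  shows "ilen n (w \<circ> gen a) = ilen n w + 2"
proof -
  have "a \<in> desB n (w \<circ> gen a)" using desB_comp_gen assms by blast
  then show ?thesis using ilen_descent[OF Bn_gen[OF assms(1,2)]] by (simp add: comp_assoc)
qed

lemma ilen_id [simp]: "ilen n id = 0"
proof -
  have "ipairs n id = {}" "negs n id = {}" by (auto simp: ipairs_def negs_def)
  then show ?thesis by (simp add: ilen_def)
qed

text \<open>Without descents the window increases strictly from above 0 to at most n; bounding it
  from both ends leaves only the identity.\<close>

lemma desB_empty_id:
  assumes w: "w \<in> Bn n" and d: "desB n w = {}"
  shows "w = id"
proof -
  have step: "w (int a) < w (int a + 1)" if "a < n" for a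
  proof -
    have "a \<notin> desB n w" using d by simp
    then have "w (int a) \<le> w (int a + 1)" using that by (simp add: desB_iff)
    then show ?thesis using Bn_inj[OF w, of "int a" "int a + 1"] by simp
  qed
  have lo: "int i \<le> w (int i)" if "i \<le> n" for i
    using that
  proof (induction i)
    case 0 then show ?case using Bn_zero[OF w, of 0] by simp
  next
    case (Suc i) then show ?case using step[of i] by (simp add: add.commute)
  qed
  have hi: "w (int (n - i)) \<le> int (n - i)" if "i \<le> n" for i
    using that
  proof (induction i)
    case 0 then show ?case using Bn_range[OF w, of "int n"] by simp
  next
    case (Suc i)
    then have "n - i = Suc (n - Suc i)" by simp
    then show ?case using step[of "n - Suc i"] Suc by (simp add: add.commute)
  qed
  have pos: "w (int i) = int i" if "i \<le> n" for i
    using lo[OF that] hi[of "n - i"] that by simp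
  show ?thesis
  proof
    fix i
    consider "\<bar>i\<bar> > int n" | "0 \<le> i" "i \<le> int n" | "i < 0" "- i \<le> int n" by linarith
    then show "w i = id i"
    proof cases
      case 1 then show ?thesis using Bn_fix[OF w] by simp
    next
      case 2 then show ?thesis using pos[of "nat i"] by simp
    next
      case 3 then show ?thesis using pos[of "nat (- i)"] Bn_minus[OF w, of i] by simp
    qed
  qed
qed

section \<open>Reduced words\<close>

lemma wprod_Nil [simp]: "wprod [] = id"
  by (simp add: wprod_def)

lemma wprod_append: "wprod (u @ v) = wprod u \<circ> wprod v"
  by (induction u) (simp_all add: wprod_def comp_assoc)

lemma wprod_single [simp]: "wprod [a] = gen a"
  by (simp add: wprod_def)

lemma is_word_append [simp]: "is_word n (u @ v) \<longleftrightarrow> is_word n u \<and> is_word n v"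
  by (simp add: is_word_def)

lemma is_word_single [simp]: "is_word n [a] \<longleftrightarrow> a < n"
  by (simp add: is_word_def)

lemma wprod_Bn: "is_word n u \<Longrightarrow> wprod u \<in> Bn n"
  by (induction u rule: rev_induct) (simp_all add: wprod_append Bn_gen id_Bn)

lemma ilen_wprod: "is_word n u \<Longrightarrow> ilen n (wprod u) \<le> 2 * length u"
proof (induction u rule: rev_induct)
  case (snoc a u)
  then have u: "wprod u \<in> Bn n" "a < n" "ilen n (wprod u) \<le> 2 * length u" by (auto intro: wprod_Bn)
  have e: "wprod (u @ [a]) = wprod u \<circ> gen a" by (simp add: wprod_append)
  have "ilen n (wprod u \<circ> gen a) \<le> ilen n (wprod u) + 2"
    using ilen_ascent[OF u(1,2)] ilen_descent[OF u(1), of a] by linarith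
  moreover have "2 * length (u @ [a]) = 2 * length u + 2" by simp
  ultimately show ?case using u(3) unfolding e by linarith
qed simp

lemma word_exists:
  "w \<in> Bn n \<Longrightarrow> \<exists>u. is_word n u \<and> wprod u = w \<and> 2 * length u = ilen n w"
proof (induction "ilen n w" arbitrary: w rule: less_induct)
  case less
  show ?case
  proof (cases "desB n w = {}")
    case True
    then have "w = id" using desB_empty_id less.prems by blast
    then show ?thesis by (intro exI[of _ "[]"]) (simp add: is_word_def)
  next
    case False
    then obtain a where a: "a \<in> desB n w" by blast
    then have an: "a < n" by (simp add: desB_iff)
    obtain u where "is_word n u" "wprod u = w \<circ> gen a" "2 * length u = ilen n (w \<circ> gen a)"
      using less.hyps[of "w \<circ> gen a"] ilen_descent[OF less.prems a] Bn_gen[OF less.prems an] by auto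
    then show ?thesis using an ilen_descent[OF less.prems a]
      by (intro exI[of _ "u @ [a]"]) (simp add: wprod_append comp_assoc)
  qed
qed

lemma reduced_iff:
  assumes "w \<in> Bn n"
  shows "reduced_word n w u \<longleftrightarrow> is_word n u \<and> wprod u = w \<and> 2 * length u = ilen n w"
proof -
  obtain u0 where u0: "is_word n u0" "wprod u0 = w" "2 * length u0 = ilen n w"
    using word_exists[OF assms] by blast
  have "coxlen n w = length u0"
    unfolding coxlen_def
  proof (rule Least_equality)
    show "\<exists>ws. is_word n ws \<and> length ws = length u0 \<and> wprod ws = w" using u0 by blast
  next
    fix k assume "\<exists>ws. is_word n ws \<and> length ws = k \<and> wprod ws = w"
    then show "length u0 \<le> k" using ilen_wprod u0(3) by fastforce
  qed
  then show ?thesis using u0(3) by (auto simp: reduced_word_def)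
qed

lemma reduced_exists: "w \<in> Bn n \<Longrightarrow> \<exists>u. reduced_word n w u"
  using word_exists reduced_iff by blast

text \<open>The last letters of reduced words are the descents, so inductions on the length can work
  from the right end.\<close>

lemma reduced_snoc:
  assumes w: "w \<in> Bn n"
  shows "reduced_word n w (u @ [a]) \<longleftrightarrow> a \<in> desB n w \<and> reduced_word n (w \<circ> gen a) u"
proof
  assume "reduced_word n w (u @ [a])"
  then have h: "is_word n u" "a < n" "wprod u \<circ> gen a = w" "2 * length u + 2 = ilen n w"
    by (auto simp: reduced_iff[OF w] wprod_append)
  then have u: "wprod u = w \<circ> gen a" by (metis comp_assoc comp_id gen_comp)
  have "a \<in> desB n w"
  proof (rule ccontr)
    assume "a \<notin> desB n w"
    then show False using ilen_ascent[OF w h(2)] ilen_wprod[OF h(1)] u h(4) by simp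
  qed
  then show "a \<in> desB n w \<and> reduced_word n (w \<circ> gen a) u"
    using h u ilen_descent[OF w] Bn_gen[OF w h(2)] by (simp add: reduced_iff)
next
  assume h: "a \<in> desB n w \<and> reduced_word n (w \<circ> gen a) u"
  then have an: "a < n" by (simp add: desB_iff)
  then show "reduced_word n w (u @ [a])"
    using h ilen_descent[OF w, of a] Bn_gen[OF w an]
    by (simp add: reduced_iff[OF w] reduced_iff[OF Bn_gen[OF w an]] wprod_append comp_assoc)
qed

lemma fc_pattern_gen:
  assumes w: "w \<in> Bn n" and g: "fc_pattern (int n) w" and a: "a \<in> desB n w"
  shows "fc_pattern (int n) (w \<circ> gen a)"
proof (cases "a = 0")
  case True
  have "fc_pattern (int n) (w(1 := - w 1))" using fc_pattern_flip[OF g] a True desB_0[OF w] by simp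
  moreover have "(w \<circ> gen a) i = (w(1 := - w 1)) i" if "1 \<le> i" for i
    using that True Bn_minus[OF w, of 1] by (auto simp: gen_def)
  ultimately show ?thesis using fc_pattern_cong[of "int n" "w \<circ> gen a" "w(1 := - w 1)"] by blast
next
  case False
  have "fc_pattern (int n) (\<lambda>x. w (swp (int a) x))"
    using fc_pattern_swap[OF g, of "int a"] False a Bn_zero[OF w] by (auto simp: desB_iff)
  moreover have "(w \<circ> gen a) i = w (swp (int a) i)" if "1 \<le> i" for i
    using that False by (simp add: gen_swp)
  ultimately show ?thesis using fc_pattern_cong[of "int n" "w \<circ> gen a" "\<lambda>x. w (swp (int a) x)"] by blast
qed

lemma fc_pattern_no_adjacent:
  assumes w: "w \<in> Bn n" and g: "fc_pattern (int n) w" and a: "a \<in> desB n w" "Suc a \<in> desB n w"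
  shows False
proof (cases "a = 0")
  case True
  then show False using fc_pattern1[OF g, of 1 2] a desB_0[OF w] by (simp add: desB_iff)
next
  case False
  have "w (int a + 1) < \<bar>w (int a)\<bar>" "w (int a + 2) < w (int a + 1)" "int a + 2 \<le> int n"
    using a by (auto simp: desB_iff algebra_simps)
  then show False using fc_pattern2[OF g, of "int a" "int a + 1" "int a + 2"] False by simp
qed

lemma fc_pattern_if_descents:
  assumes w: "w \<in> Bn n" and n1: "\<And>a. a \<in> desB n w \<Longrightarrow> Suc a \<in> desB n w \<Longrightarrow> False"
    and n2: "\<And>a. a \<in> desB n w \<Longrightarrow> fc_pattern (int n) (w \<circ> gen a)"
  shows "fc_pattern (int n) w"
proof (rule fc_pattern_from_descents)
  show "w i = 0 \<Longrightarrow> i = 0" for i using Bn_zero[OF w] by simp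
  show "w i = w j \<Longrightarrow> i = j" for i j using Bn_inj[OF w] by simp
  show False if "1 \<le> i" "i + 2 \<le> int n" "w (i + 1) < w i" "w (i + 2) < w (i + 1)" for i
  proof -
    define m where "m = nat i"
    have "i = int m" using that by (simp add: m_def)
    then show False using n1[of m] that by (simp add: desB_iff algebra_simps)
  qed
  show False if "2 \<le> int n" "w 1 < 0" "w 2 < w 1"
    using n1[of 0] that desB_0[OF w] by (simp add: desB_iff)
  show "fc_pattern (int n) (\<lambda>x. w (swp a x))" if a: "1 \<le> a" "a < int n" "w (a + 1) < w a" for a
  proof -
    have "fc_pattern (int n) (w \<circ> gen (nat a))" using n2[of "nat a"] a by (simp add: desB_iff)
    moreover have "(w \<circ> gen (nat a)) i = w (swp a i)" if "1 \<le> i" for i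
      using gen_swp[of "nat a" i] that a by simp
    ultimately show ?thesis using fc_pattern_cong[of "int n" "w \<circ> gen (nat a)" "\<lambda>x. w (swp a x)"] by blast
  qed
  show "fc_pattern (int n) (w(1 := - w 1))" if "1 \<le> int n" "w 1 < 0"
  proof -
    have "fc_pattern (int n) (w \<circ> gen 0)" using n2[of 0] that desB_0[OF w] by simp
    moreover have "(w \<circ> gen 0) i = (w(1 := - w 1)) i" if "1 \<le> i" for i
      using that Bn_minus[OF w, of 1] by (auto simp: gen_def)
    ultimately show ?thesis using fc_pattern_cong[of "int n" "w \<circ> gen 0" "w(1 := - w 1)"] by blast
  qed
qed

section \<open>Commutation classes of reduced words\<close>

lemma comm_step_snoc: "comm_step u v \<Longrightarrow> comm_step (u @ [a]) (v @ [a])"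
  unfolding comm_step_def by (metis append.assoc)

lemma comm_steps_snoc: "comm_step\<^sup>*\<^sup>* u v \<Longrightarrow> comm_step\<^sup>*\<^sup>* (u @ [a]) (v @ [a])"
  by (induction rule: rtranclp_induct) (auto intro: rtranclp.rtrancl_into_rtrancl comm_step_snoc)

lemma comm_step_swap: "a + 2 \<le> b \<or> b + 2 \<le> a \<Longrightarrow> comm_step (u @ [a, b]) (u @ [b, a])"
  unfolding comm_step_def by (metis append_Nil2)

lemma gen_commute:
  assumes "a + 2 \<le> b \<or> b + 2 \<le> a"
  shows "gen a \<circ> gen b = gen b \<circ> gen a"
proof -
  have "gen a (gen b j) = gen b (gen a j)" if ab: "a + 2 \<le> b" for a b j
  proof (cases "a = 0")
    case True
    consider "j = 1" | "j = -1" | "j = int b" | "j = int b + 1" | "j = - int b" | "j = - int b - 1"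
      | "j \<notin> {1, -1, int b, int b + 1, - int b, - int b - 1}" by blast
    then show ?thesis by cases (use True ab in \<open>simp_all add: gen_def abs_if\<close>)
  next
    case False
    consider "j = int a" | "j = int a + 1" | "j = - int a" | "j = - int a - 1"
      | "j = int b" | "j = int b + 1" | "j = - int b" | "j = - int b - 1"
      | "j \<notin> {int a, int a + 1, - int a, - int a - 1, int b, int b + 1, - int b, - int b - 1}" by blast
    then show ?thesis by cases (use False ab in \<open>simp_all add: gen_def\<close>)
  qed
  then show ?thesis using assms by (intro ext) (auto simp del: gen_gen)
qed

text \<open>The last letters of two reduced words are descents, hence equal or commuting in the
  pattern class. If they commute, a reduced word z of \<open>w \<circ> gen a \<circ> gen b\<close>
  links both words through \<open>z @ [b, a]\<close> and \<open>z @ [a, b]\<close>.\<close>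

lemma fc_pattern_imp_FC:
  assumes "w \<in> Bn n" "fc_pattern (int n) w" "reduced_word n w u" "reduced_word n w v"
  shows "comm_step\<^sup>*\<^sup>* u v"
  using assms
proof (induction "ilen n w" arbitrary: w u v rule: less_induct)
  case less
  note w = less.prems(1)
  have len: "length u = length v" using less.prems by (simp add: reduced_iff)
  show ?case
  proof (cases "u = []")
    case True
    then show ?thesis using len by simp
  next
    case False
    then obtain u' a v' b where uv: "u = u' @ [a]" "v = v' @ [b]"
      using len by (metis length_0_conv rev_exhaust)
    have a: "a \<in> desB n w" "reduced_word n (w \<circ> gen a) u'" and b: "b \<in> desB n w" "reduced_word n (w \<circ> gen b) v'"
      using less.prems uv reduced_snoc[OF w] by auto
    have ab: "a < n" "b < n" using a b by (auto simp: desB_iff)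
    have IH: "comm_step\<^sup>*\<^sup>* x y" if "c \<in> desB n w" "reduced_word n (w \<circ> gen c) x" "reduced_word n (w \<circ> gen c) y" for c x y
      using less.hyps[of "w \<circ> gen c" x y] ilen_descent[OF w that(1)] Bn_gen[OF w] fc_pattern_gen[OF w less.prems(2) that(1)] that
      by (simp add: desB_iff)
    show ?thesis
    proof (cases "a = b")
      case True
      then show ?thesis using IH[of a u' v'] a b uv comm_steps_snoc by simp
    next
      case False
      then have far: "a + 2 \<le> b \<or> b + 2 \<le> a"
        using fc_pattern_no_adjacent[OF w less.prems(2), of a] fc_pattern_no_adjacent[OF w less.prems(2), of b] a b
        by (metis Suc_leI add_2_eq_Suc' antisym_conv2 linorder_neqE_nat)
      have ba: "b \<in> desB n (w \<circ> gen a)" using b far gen_other[of b a] by (auto simp: desB_iff)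
      have ab': "a \<in> desB n (w \<circ> gen b)" using a far gen_other[of a b] by (auto simp: desB_iff)
      obtain z where z: "reduced_word n (w \<circ> gen a \<circ> gen b) z"
        using reduced_exists[OF Bn_gen[OF Bn_gen[OF w ab(1)] ab(2)]] by blast
      have 1: "reduced_word n (w \<circ> gen a) (z @ [b])" using reduced_snoc[OF Bn_gen[OF w ab(1)]] z ba by simp
      have "w \<circ> gen a \<circ> gen b = w \<circ> gen b \<circ> gen a" using gen_commute[OF far] by (simp add: comp_assoc)
      then have 2: "reduced_word n (w \<circ> gen b) (z @ [a])" using reduced_snoc[OF Bn_gen[OF w ab(2)]] z ab' by simp
      have "comm_step\<^sup>*\<^sup>* u (z @ [b, a])"
        using comm_steps_snoc[OF IH[OF a(1) a(2) 1], of a] uv by simp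
      moreover have "comm_step\<^sup>*\<^sup>* (z @ [b, a]) (z @ [a, b])"
        using comm_step_swap far by blast
      moreover have "comm_step\<^sup>*\<^sup>* (z @ [a, b]) v"
        using comm_steps_snoc[OF IH[OF b(1) 2 b(2)], of b] uv by simp
      ultimately show ?thesis by (meson rtranclp_trans)
    qed
  qed
qed

text \<open>Commuting letters differ by at least 2, so at most one of the two swapped letters passes
  the filter.\<close>

lemma comm_step_filter:
  assumes "comm_step u v"
  shows "filter (\<lambda>x. x = c \<or> x = Suc c) u = filter (\<lambda>x. x = c \<or> x = Suc c) v"
  using assms unfolding comm_step_def by auto

lemma comm_steps_filter:
  assumes "comm_step\<^sup>*\<^sup>* u v"
  shows "filter (\<lambda>x. x = c \<or> x = Suc c) u = filter (\<lambda>x. x = c \<or> x = Suc c) v"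
  using assms by (induction rule: rtranclp_induct) (auto dest: comm_step_filter)

lemma adjacent_words:
  assumes w: "w \<in> Bn n" and d: "a \<in> desB n w" "Suc a \<in> desB n w"
  shows "\<exists>z z'. reduced_word n w (z @ [a]) \<and> reduced_word n w (z' @ [Suc a])"
proof -
  have "a < n" "Suc a < n" using d by (auto simp: desB_iff)
  then show ?thesis using reduced_exists[OF Bn_gen[OF w]] reduced_snoc[OF w] d by meson
qed

text \<open>Two words are told apart, up to commutations, by their subwords in the letters \<open>c\<close> and \<open>c + 1\<close>.\<close>

lemma bad_words:
  assumes "w \<in> Bn n" "\<not> fc_pattern (int n) w"
  shows "\<exists>u v c. reduced_word n w u \<and> reduced_word n w v \<and>
     filter (\<lambda>x. x = c \<or> x = Suc c) u \<noteq> filter (\<lambda>x. x = c \<or> x = Suc c) v"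
  using assms
proof (induction "ilen n w" arbitrary: w rule: less_induct)
  case less
  note w = less.prems(1)
  show ?case
  proof (cases "\<exists>a. a \<in> desB n w \<and> Suc a \<in> desB n w")
    case True
    then obtain a where "a \<in> desB n w" "Suc a \<in> desB n w" by blast
    then obtain z z' where z: "reduced_word n w (z @ [a])" "reduced_word n w (z' @ [Suc a])"
      using adjacent_words[OF w] by blast
    have "filter (\<lambda>x. x = a \<or> x = Suc a) (z @ [a]) \<noteq> filter (\<lambda>x. x = a \<or> x = Suc a) (z' @ [Suc a])"
      by simp
    then show ?thesis using z by blast
  next
    case False
    then obtain a where a: "a \<in> desB n w" "\<not> fc_pattern (int n) (w \<circ> gen a)"
      using fc_pattern_if_descents[OF w] less.prems(2) by blast
    then have an: "a < n" by (simp add: desB_iff)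
    obtain u v c where uv: "reduced_word n (w \<circ> gen a) u" "reduced_word n (w \<circ> gen a) v"
      "filter (\<lambda>x. x = c \<or> x = Suc c) u \<noteq> filter (\<lambda>x. x = c \<or> x = Suc c) v"
      using less.hyps[of "w \<circ> gen a"] ilen_descent[OF w a(1)] Bn_gen[OF w an] a(2) by auto
    have "reduced_word n w (u @ [a])" "reduced_word n w (v @ [a])"
      using uv a(1) reduced_snoc[OF w] by auto
    moreover have "filter (\<lambda>x. x = c \<or> x = Suc c) (u @ [a]) \<noteq> filter (\<lambda>x. x = c \<or> x = Suc c) (v @ [a])"
      using uv(3) by simp
    ultimately show ?thesis by blast
  qed
qed

lemma FC_iff: "w \<in> FC n \<longleftrightarrow> w \<in> Bn n \<and> fc_pattern (int n) w"
proof -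
  have "fully_commutative n w \<longleftrightarrow> fc_pattern (int n) w" if w: "w \<in> Bn n"
    using fc_pattern_imp_FC[OF w] bad_words[OF w] comm_steps_filter unfolding fully_commutative_def by metis
  then show ?thesis by (auto simp: FC_def)
qed

section \<open>Factoring a signed permutation through a minimal coset representative\<close>

definition Sn :: "nat \<Rightarrow> (int \<Rightarrow> int) set" where
  "Sn n = {s \<in> Bn n. \<forall>i. 1 \<le> i \<longrightarrow> i \<le> int n \<longrightarrow> 0 < s i}"

text \<open>\<open>shuf N\<close> is the signed permutation with negative positions \<open>N\<close> whose inverse is increasing
on \<open>1, \<dots>, n\<close>: a minimal coset representative.\<close>

definition shufp :: "int set \<Rightarrow> int \<Rightarrow> int" where
  "shufp N i = (if i \<in> N then - int (card {k \<in> N. i \<le> k}) else i + int (card {k \<in> N. i < k}))"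

definition shuf :: "int set \<Rightarrow> int \<Rightarrow> int" where
  "shuf N i = (if 0 < i then shufp N i else if i < 0 then - shufp N (- i) else 0)"

lemma SnD: "s \<in> Sn n \<Longrightarrow> s \<in> Bn n" "s \<in> Sn n \<Longrightarrow> 1 \<le> i \<Longrightarrow> i \<le> int n \<Longrightarrow> 1 \<le> s i \<and> s i \<le> int n"
  using Bn_range[of s n i] by (auto simp: Sn_def)

lemma shuf_minus: "shuf N (- i) = - shuf N i"
  by (simp add: shuf_def)

lemma surjI2: "(\<And>y. \<exists>x. y = f x) \<Longrightarrow> surj f"
  by blast

context
  fixes N :: "int set" and n :: nat
  assumes N: "N \<subseteq> {1..int n}"
begin

lemma finN: "finite N" using N finite_subset by blast

lemma shuf_neg: "i \<in> N \<Longrightarrow> - int (card N) \<le> shuf N i \<and> shuf N i \<le> -1"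
proof -
  assume i: "i \<in> N"
  then have "0 < i" using N by auto
  moreover have "card {k \<in> N. i \<le> k} \<le> card N" using finN by (intro card_mono) auto
  moreover have "0 < card {k \<in> N. i \<le> k}" using i finN by (auto simp: card_gt_0_iff)
  ultimately show ?thesis using i by (simp add: shuf_def shufp_def)
qed

lemma shuf_pos: "1 \<le> i \<Longrightarrow> i \<notin> N \<Longrightarrow> int (card N) < shuf N i"
proof -
  assume i: "1 \<le> i" "i \<notin> N"
  have "x < i \<or> i < x" if "x \<in> N" for x using that i(2) by (metis linorder_neqE)
  then have "N = {k \<in> N. k < i} \<union> {k \<in> N. i < k}" by blast
  then have "card N \<le> card {k \<in> N. k < i} + card {k \<in> N. i < k}" by (metis card_Un_le)
  moreover have "card {k \<in> N. k < i} \<le> card {1..i-1}" using N by (intro card_mono) auto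
  ultimately show ?thesis using i by (simp add: shuf_def shufp_def)
qed

lemma shuf_mono_in: "i \<in> N \<Longrightarrow> j \<in> N \<Longrightarrow> i < j \<Longrightarrow> shuf N i < shuf N j"
proof -
  assume h: "i \<in> N" "j \<in> N" "i < j"
  have "{k \<in> N. j \<le> k} \<subseteq> {k \<in> N. i \<le> k}" "i \<in> {k \<in> N. i \<le> k}" "i \<notin> {k \<in> N. j \<le> k}"
    using h by auto
  then have "{k \<in> N. j \<le> k} \<subset> {k \<in> N. i \<le> k}" by blast
  then have "card {k \<in> N. j \<le> k} < card {k \<in> N. i \<le> k}" using finN by (intro psubset_card_mono) auto
  moreover have "0 < i" "0 < j" using h N by auto
  ultimately show ?thesis using h by (simp add: shuf_def shufp_def)
qed

lemma shuf_mono_out: "i \<notin> N \<Longrightarrow> j \<notin> N \<Longrightarrow> 1 \<le> i \<Longrightarrow> i < j \<Longrightarrow> shuf N i < shuf N j"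
proof -
  assume h: "i \<notin> N" "j \<notin> N" "1 \<le> i" "i < j"
  have "x < j \<or> j < x" if "x \<in> N" for x using that h(2) by (metis linorder_neqE)
  then have "{k \<in> N. i < k} \<subseteq> {i+1..j-1} \<union> {k \<in> N. j < k}"
    by (intro subsetI) fastforce
  then have "card {k \<in> N. i < k} \<le> card ({i+1..j-1} \<union> {k \<in> N. j < k})" using finN by (intro card_mono) auto
  also have "\<dots> \<le> card {i+1..j-1} + card {k \<in> N. j < k}" by (rule card_Un_le)
  finally show ?thesis using h by (simp add: shuf_def shufp_def)
qed

lemma shuf_after: "1 \<le> i \<Longrightarrow> (\<And>k. k \<in> N \<Longrightarrow> k < i) \<Longrightarrow> shuf N i = i"
proof -
  assume i: "1 \<le> i" and lt: "\<And>k. k \<in> N \<Longrightarrow> k < i"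
  have e: "{k \<in> N. i < k} = {}" "i \<notin> N" using lt by fastforce+
  show ?thesis unfolding shuf_def shufp_def e(1) using i e(2) by simp
qed

lemma shuf_le: "1 \<le> i \<Longrightarrow> i \<notin> N \<Longrightarrow> i \<le> b \<Longrightarrow> (\<And>k. k \<in> N \<Longrightarrow> k \<le> b) \<Longrightarrow> shuf N i \<le> b"
proof -
  assume h: "1 \<le> i" "i \<notin> N" "i \<le> b" and b: "\<And>k. k \<in> N \<Longrightarrow> k \<le> b"
  have "card {k \<in> N. i < k} \<le> card {i+1..b}" using b by (intro card_mono) auto
  then show ?thesis using h by (simp add: shuf_def shufp_def)
qed

lemma shuf_last: "N \<noteq> {} \<Longrightarrow> shuf N (Max N) = -1"
proof -
  assume ne: "N \<noteq> {}"
  have m: "Max N \<in> N" using finN ne by simp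
  have "{k \<in> N. Max N \<le> k} = {Max N}" using finN m Max_ge[of N] by (auto intro: antisym)
  then show ?thesis using m N by (auto simp: shuf_def shufp_def)
qed

lemma shuf_inj: "shuf N i = shuf N j \<Longrightarrow> i = j"
proof -
  have pos: "shuf N i \<noteq> shuf N j" if "1 \<le> i" "i < j" for i j
  proof (cases "i \<in> N"; cases "j \<in> N")
    assume "i \<in> N" "j \<in> N" then show ?thesis using shuf_mono_in that by fastforce
  next
    assume "i \<in> N" "j \<notin> N" then show ?thesis using shuf_neg[of i] shuf_pos[of j] that by fastforce
  next
    assume "i \<notin> N" "j \<in> N" then show ?thesis using shuf_neg[of j] shuf_pos[of i] that by fastforce
  next
    assume "i \<notin> N" "j \<notin> N" then show ?thesis using shuf_mono_out that by fastforce
  qed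
  have mixed: "shuf N i \<noteq> - shuf N j" if "1 \<le> i" "1 \<le> j" for i j
  proof (cases "i \<in> N"; cases "j \<in> N")
    assume "i \<in> N" "j \<in> N" then show ?thesis using shuf_neg[of i] shuf_neg[of j] by linarith
  next
    assume "i \<in> N" "j \<notin> N" then show ?thesis using shuf_neg[of i] shuf_pos[of j] that by linarith
  next
    assume "i \<notin> N" "j \<in> N" then show ?thesis using shuf_neg[of j] shuf_pos[of i] that by linarith
  next
    assume "i \<notin> N" "j \<notin> N" then show ?thesis using shuf_pos[of i] shuf_pos[of j] that by linarith
  qed
  have nz: "shuf N i \<noteq> 0" if "1 \<le> i" for i
    using shuf_neg[of i] shuf_pos[of i] that by (cases "i \<in> N") fastforce+
  assume e: "shuf N i = shuf N j"
  have z: "shuf N 0 = 0" by (simp add: shuf_def)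
  consider "i \<ge> 1" "j \<ge> 1" | "i \<ge> 1" "j \<le> -1" | "i \<le> -1" "j \<ge> 1" | "i \<le> -1" "j \<le> -1" | "i = 0" | "j = 0" by linarith
  then show "i = j"
  proof cases
    case 1 then show ?thesis using pos[of i j] pos[of j i] e by fastforce
  next
    case 2 then show ?thesis using mixed[of i "- j"] e shuf_minus[of N j] by simp
  next
    case 3 then show ?thesis using mixed[of j "- i"] e shuf_minus[of N i] by simp
  next
    case 4 then show ?thesis using pos[of "- i" "- j"] pos[of "- j" "- i"] e shuf_minus[of N i] shuf_minus[of N j] by fastforce
  next
    case 5 then show ?thesis using nz[of j] nz[of "- j"] e z shuf_minus[of N j] by (cases "j = 0") (auto, linarith)
  next
    case 6 then show ?thesis using nz[of i] nz[of "- i"] e z shuf_minus[of N i] by (cases "i = 0") (auto, linarith)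
  qed
qed

lemma shuf_Bn: "shuf N \<in> Bn n"
proof -
  have fx: "shuf N i = i" if i: "int n < \<bar>i\<bar>" for i
  proof -
    have "shuf N j = j" if "int n < j" for j using shuf_after[of j] that N by fastforce
    then show ?thesis using i shuf_minus[of N i] by (cases "0 \<le> i") auto
  qed
  have r: "shuf N i \<in> {- int n..int n}" if "i \<in> {- int n..int n}" for i
  proof (rule ccontr)
    assume "shuf N i \<notin> {- int n..int n}"
    then have "shuf N (shuf N i) = shuf N i" by (intro fx) auto
    then have "shuf N i = i" by (rule shuf_inj)
    then show False using that \<open>shuf N i \<notin> {- int n..int n}\<close> by simp
  qed
  have inj: "inj (shuf N)" using shuf_inj by (auto intro: injI)
  have "shuf N ` {- int n..int n} = {- int n..int n}"
  proof (rule endo_inj_surj)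
    show "shuf N ` {- int n..int n} \<subseteq> {- int n..int n}" using r by blast
    show "inj_on (shuf N) {- int n..int n}" using inj inj_on_subset by blast
  qed simp
  then have "surj (shuf N)"
  proof (intro surjI2)
    fix y assume im: "shuf N ` {- int n..int n} = {- int n..int n}"
    show "\<exists>x. y = shuf N x"
    proof (cases "y \<in> {- int n..int n}")
      case True
      then have "y \<in> shuf N ` {- int n..int n}" using im by simp
      then show ?thesis by blast
    next
      case False
      then have "shuf N y = y" by (intro fx) auto
      then show ?thesis by (intro exI[of _ y]) simp
    qed
  qed
  then show ?thesis using inj fx shuf_minus by (simp add: Bn_def bij_def)
qed

end

lemma Bn_bij: "w \<in> Bn n \<Longrightarrow> bij w"
  by (simp add: Bn_def)

lemma Bn_inv:
  assumes "w \<in> Bn n" shows "inv w \<in> Bn n"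
proof -
  have b: "bij w" and m: "\<And>i. w (- i) = - w i" and f: "\<And>i. int n < \<bar>i\<bar> \<Longrightarrow> w i = i"
    using assms by (auto simp: Bn_def)
  have "inv w (- i) = - inv w i" for i
    using m[of "inv w i"] b by (metis bij_inv_eq_iff)
  moreover have "inv w i = i" if "int n < \<bar>i\<bar>" for i
    using f[OF that] b by (metis bij_inv_eq_iff)
  ultimately show ?thesis using b bij_imp_bij_inv by (auto simp: Bn_def)
qed

lemma Bn_inv_apply [simp]: "w \<in> Bn n \<Longrightarrow> w (inv w i) = i" "w \<in> Bn n \<Longrightarrow> inv w (w i) = i"
  using Bn_bij[of w n] by (auto simp: bij_is_surj surj_f_inv_f bij_is_inj)

lemma Sn_inv: "s \<in> Sn n \<Longrightarrow> inv s \<in> Sn n"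
proof -
  assume s: "s \<in> Sn n"
  note B = SnD(1)[OF s]
  have "0 < inv s i" if "1 \<le> i" "i \<le> int n" for i
  proof (rule ccontr)
    assume "\<not> 0 < inv s i"
    moreover have "inv s i \<noteq> 0" using Bn_zero[OF Bn_inv[OF B]] that by simp
    ultimately have "1 \<le> - inv s i" by simp
    moreover have "- inv s i \<le> int n" using Bn_range[OF Bn_inv[OF B], of i] that by simp
    ultimately have "1 \<le> s (- inv s i)" using SnD(2)[OF s] by blast
    then show False using Bn_minus[OF B, of "inv s i"] B that by simp
  qed
  then show ?thesis using Bn_inv[OF B] by (simp add: Sn_def)
qed

text \<open>The window of the inverse lists the negated elements of \<open>N\<close> first and the
  positions outside \<open>N\<close> after them; this lies behind its monotonicity.\<close>

lemma inv_shuf_pos: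
  assumes N: "N \<subseteq> {1..int n}" and t: "1 \<le> t" "t \<le> int n"
  shows "if t \<le> int (card N) then inv (shuf N) t < 0 \<and> - inv (shuf N) t \<in> N
     else 1 \<le> inv (shuf N) t \<and> inv (shuf N) t \<notin> N"
proof -
  let ?i = "inv (shuf N) t"
  note B = shuf_Bn[OF N]
  have e: "shuf N ?i = t" using B by simp
  have "?i \<noteq> 0" using Bn_zero[OF Bn_inv[OF B]] t by simp
  then consider "1 \<le> ?i" | "1 \<le> - ?i" by linarith
  then show ?thesis
  proof cases
    case 1
    then have "?i \<notin> N" using shuf_neg[OF N, of ?i] e t by auto
    then show ?thesis using shuf_pos[OF N 1] e 1 by simp
  next
    case 2
    have m: "shuf N (- ?i) = - t" using shuf_minus[of N ?i] e by simp
    then have "- ?i \<in> N" using shuf_pos[OF N 2] t by fastforce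
    then show ?thesis using shuf_neg[OF N, of "- ?i"] m 2 by simp
  qed
qed

lemma inv_shuf_mono:
  assumes N: "N \<subseteq> {1..int n}" and t: "1 \<le> t" "t < t'" "t' \<le> int n"
  shows "inv (shuf N) t < inv (shuf N) t'"
proof -
  let ?i = "inv (shuf N) t" and ?j = "inv (shuf N) t'"
  note B = shuf_Bn[OF N]
  have e: "shuf N ?i = t" "shuf N ?j = t'" using B by simp_all
  have ne: "?i \<noteq> ?j" using e t by auto
  have 1: "if t \<le> int (card N) then ?i < 0 \<and> - ?i \<in> N else 1 \<le> ?i \<and> ?i \<notin> N"
    using inv_shuf_pos[OF N, of t] t by simp
  have 2: "if t' \<le> int (card N) then ?j < 0 \<and> - ?j \<in> N else 1 \<le> ?j \<and> ?j \<notin> N"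
    using inv_shuf_pos[OF N, of t'] t by simp
  consider "t' \<le> int (card N)" | "t \<le> int (card N)" "\<not> t' \<le> int (card N)" | "\<not> t \<le> int (card N)"
    using t by linarith
  then show ?thesis
  proof cases
    case c1: 1
    then have "- ?i \<in> N" "- ?j \<in> N" using 1 2 t by (auto split: if_splits)
    then show ?thesis using shuf_mono_in[OF N, of "- ?i" "- ?j"] shuf_minus[of N ?i] shuf_minus[of N ?j] e t ne by linarith
  next
    case c2: 2
    then show ?thesis using 1 2 by auto
  next
    case 3
    then have "?i \<notin> N" "?j \<notin> N" "1 \<le> ?i" "1 \<le> ?j" using 1 2 t by auto
    then show ?thesis using shuf_mono_out[OF N, of ?j ?i] e t ne by linarith
  qed
qed

lemma negs_comp_shuf:
  assumes s: "s \<in> Sn n" and N: "N \<subseteq> {1..int n}"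
  shows "negs n (s \<circ> shuf N) = N"
proof -
  note B = SnD(1)[OF s]
  have "s (shuf N i) < 0 \<longleftrightarrow> i \<in> N" if i: "1 \<le> i" "i \<le> int n" for i
  proof -
    have r: "\<bar>shuf N i\<bar> \<le> int n" using Bn_range[OF shuf_Bn[OF N], of i] i by simp
    show ?thesis
    proof (cases "i \<in> N")
      case True
      then have "shuf N i \<le> -1" using shuf_neg[OF N] by blast
      then have "0 < s (- shuf N i)" using SnD(2)[OF s, of "- shuf N i"] r by simp
      then show ?thesis using True Bn_minus[OF B] by simp
    next
      case False
      then have "1 \<le> shuf N i" using shuf_pos[OF N, of i] i by simp
      then show ?thesis using False SnD(2)[OF s, of "shuf N i"] r by simp
    qed
  qed
  then show ?thesis using N by (auto simp: negs_def)
qed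

text \<open>\<open>N\<close> is recovered as the set of negative positions, and dividing by
  \<open>shuf N\<close> leaves only positive letters.\<close>

lemma bij_betw_shuf:
  "bij_betw (\<lambda>(s, N). s \<circ> shuf N) (Sn n \<times> Pow {1..int n}) (Bn n)"
proof (rule bij_betw_imageI)
  show "inj_on (\<lambda>(s, N). s \<circ> shuf N) (Sn n \<times> Pow {1..int n})"
  proof (rule inj_onI, clarsimp)
    fix s N s' N' assume h: "s \<in> Sn n" "N \<subseteq> {1..int n}" "s' \<in> Sn n" "N' \<subseteq> {1..int n}" "s \<circ> shuf N = s' \<circ> shuf N'"
    have NN: "N = N'" using negs_comp_shuf h by metis
    have "s i = s' i" for i
      using fun_cong[OF h(5), of "inv (shuf N) i"] shuf_Bn[OF h(2)] NN by simp
    then show "s = s' \<and> N = N'" using NN by blast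
  qed
  show "(\<lambda>(s, N). s \<circ> shuf N) ` (Sn n \<times> Pow {1..int n}) = Bn n"
  proof (intro subset_antisym subsetI)
    fix w assume "w \<in> (\<lambda>(s, N). s \<circ> shuf N) ` (Sn n \<times> Pow {1..int n})"
    then obtain s N where "s \<in> Sn n" "N \<subseteq> {1..int n}" "w = s \<circ> shuf N" by auto
    then show "w \<in> Bn n" using Bn_comp[OF SnD(1) shuf_Bn] by simp
  next
    fix w assume w: "w \<in> Bn n"
    let ?N = "negs n w"
    have N: "?N \<subseteq> {1..int n}" by (auto simp: negs_def)
    note B = shuf_Bn[OF N]
    let ?s = "w \<circ> inv (shuf ?N)"
    have sB: "?s \<in> Bn n" using w B by (intro Bn_comp Bn_inv)
    have "0 < ?s t" if t: "1 \<le> t" "t \<le> int n" for t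
    proof -
      let ?i = "inv (shuf ?N) t"
      have r: "\<bar>?i\<bar> \<le> int n" using Bn_range[OF Bn_inv[OF B], of t] t by simp
      have p: "?i < 0 \<and> - ?i \<in> ?N \<or> 1 \<le> ?i \<and> ?i \<notin> ?N"
        using inv_shuf_pos[OF N t] by (auto split: if_splits)
      have "w ?i \<noteq> 0" using Bn_zero[OF w, of ?i] p by auto
      then show ?thesis using p r Bn_minus[OF w, of ?i] by (auto simp: negs_def)
    qed
    then have "?s \<in> Sn n" using sB by (simp add: Sn_def)
    moreover have "w = ?s \<circ> shuf ?N" using B by (intro ext) simp
    ultimately show "w \<in> (\<lambda>(s, N). s \<circ> shuf N) ` (Sn n \<times> Pow {1..int n})"
      using N by (intro image_eqI[of _ _ "(?s, ?N)"]) auto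
  qed
qed

section \<open>Blocks of the inverse\<close>

lemma Max_less_Min_iff:
  fixes A B :: "int set"
  assumes "finite A" "A \<noteq> {}" "finite B" "B \<noteq> {}"
  shows "Max A < Min B \<longleftrightarrow> (\<forall>a\<in>A. \<forall>b\<in>B. a < b)"
  using assms by (simp add: Max_less_iff) blast

lemma bl_iff:
  "bl n w = 1 + card {i \<in> {1..<n}. \<forall>a b. 1 \<le> a \<longrightarrow> a \<le> int i \<longrightarrow> int i < b \<longrightarrow> b \<le> int n \<longrightarrow> w a < w b}"
proof -
  have "Max (w ` {1..int i}) < Min (w ` {int i + 1..int n}) \<longleftrightarrow>
     (\<forall>a b. 1 \<le> a \<longrightarrow> a \<le> int i \<longrightarrow> int i < b \<longrightarrow> b \<le> int n \<longrightarrow> w a < w b)" if "i \<in> {1..<n}" for i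
    using that by (subst Max_less_Min_iff) auto
  then show ?thesis unfolding bl_def by (metis (no_types, lifting) Collect_cong)
qed

text \<open>In the inverse, \<open>inv (shuf N)\<close> acts last and is increasing on 1..n, so all
  comparisons are those of \<open>inv s\<close>.\<close>

lemma bl_inv_comp_shuf:
  assumes s: "s \<in> Sn n" and N: "N \<subseteq> {1..int n}"
  shows "bl n (inv (s \<circ> shuf N)) = bl n (inv s)"
proof -
  have e: "inv (s \<circ> shuf N) = inv (shuf N) \<circ> inv s"
    using Bn_bij[OF SnD(1)[OF s]] Bn_bij[OF shuf_Bn[OF N]] by (simp add: o_inv_distrib)
  have "inv (shuf N) (inv s a) < inv (shuf N) (inv s b) \<longleftrightarrow> inv s a < inv s b"
    if "1 \<le> a" "a \<le> int n" "1 \<le> b" "b \<le> int n" for a b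
  proof -
    have "1 \<le> inv s a" "inv s a \<le> int n" "1 \<le> inv s b" "inv s b \<le> int n"
      using SnD(2)[OF Sn_inv[OF s]] that by blast+
    then show ?thesis using inv_shuf_mono[OF N, of "inv s a" "inv s b"] inv_shuf_mono[OF N, of "inv s b" "inv s a"]
      by (metis linorder_neqE_linordered_idom order_less_asym')
  qed
  then have c: "(\<forall>a b. 1 \<le> a \<longrightarrow> a \<le> int i \<longrightarrow> int i < b \<longrightarrow> b \<le> int n \<longrightarrow> inv (shuf N) (inv s a) < inv (shuf N) (inv s b)) \<longleftrightarrow>
     (\<forall>a b. 1 \<le> a \<longrightarrow> a \<le> int i \<longrightarrow> int i < b \<longrightarrow> b \<le> int n \<longrightarrow> inv s a < inv s b)" if "i \<in> {1..<n}" for i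
    using that by (smt (verit, best) atLeastLessThan_iff of_nat_1 of_nat_less_iff of_nat_le_iff)
  show ?thesis unfolding bl_iff e comp_apply
    by (intro arg_cong[of _ _ "\<lambda>A. 1 + card A"] Collect_cong conj_cong refl c)
qed

text \<open>The leading 1 in \<open>bl\<close> is the prefix i = n, which is always
  complete.\<close>

lemma bl_inv_Sn:
  assumes s: "s \<in> Sn n" and n: "n \<ge> 1"
  shows "bl n (inv s) = card {i \<in> {1..n}. s ` {1..int i} = {1..int i}}"
proof -
  note B = SnD(1)[OF s]
  have fin: "s ` {1..int n} = {1..int n}"
  proof (rule endo_inj_surj)
    show "s ` {1..int n} \<subseteq> {1..int n}" using SnD(2)[OF s] by auto
    show "inj_on s {1..int n}" using Bn_inj[OF B] by (auto intro: inj_onI)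
  qed simp
  have c: "(\<forall>a b. 1 \<le> a \<longrightarrow> a \<le> int i \<longrightarrow> int i < b \<longrightarrow> b \<le> int n \<longrightarrow> inv s a < inv s b) \<longleftrightarrow>
     s ` {1..int i} = {1..int i}" (is "?L \<longleftrightarrow> ?R") if i: "i \<in> {1..<n}" for i
  proof
    assume R: ?R
    show ?L
    proof (intro allI impI)
      fix a b assume ab: "1 \<le> a" "a \<le> int i" "int i < b" "b \<le> int n"
      then have "a \<in> s ` {1..int i}" using R by auto
      then have "inv s a \<le> int i" using B by auto
      moreover have "\<not> inv s b \<le> int i"
      proof
        assume "inv s b \<le> int i"
        moreover have "1 \<le> inv s b" using SnD(2)[OF Sn_inv[OF s], of b] ab by simp
        ultimately have "s (inv s b) \<in> s ` {1..int i}" by simp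
        then show False using R B ab by simp
      qed
      ultimately show "inv s a < inv s b" by simp
    qed
  next
    assume L: ?L
    have "s ` {1..int i} \<subseteq> {1..int i}"
    proof (rule ccontr)
      assume "\<not> s ` {1..int i} \<subseteq> {1..int i}"
      then have "\<exists>c\<in>{1..int i}. s c \<notin> {1..int i}" by blast
      then obtain c where c: "1 \<le> c" "c \<le> int i" "s c \<notin> {1..int i}" by auto
      then have sc: "int i < s c" "s c \<le> int n" using SnD(2)[OF s, of c] i by auto
      \<comment> \<open>All i values up to i would stand left of c, where only c - 1 < i places
        exist.\<close>
      have "inv s ` {1..int i} \<subseteq> {1..c-1}"
      proof
        fix x assume "x \<in> inv s ` {1..int i}"
        then obtain a where a: "1 \<le> a" "a \<le> int i" "x = inv s a" by auto
        then have "x < inv s (s c)" using L sc by blast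
        then show "x \<in> {1..c-1}" using a SnD(2)[OF Sn_inv[OF s], of a] i B by auto
      qed
      then have "card (inv s ` {1..int i}) \<le> card {1..c-1}" by (intro card_mono) auto
      moreover have "card (inv s ` {1..int i}) = i"
        using Bn_inj[OF Bn_inv[OF B]] by (subst card_image) (auto intro: inj_onI)
      ultimately show False using c by simp
    qed
    then show ?R using Bn_inj[OF B] by (intro endo_inj_surj) (auto intro: inj_onI)
  qed
  have "{i \<in> {1..n}. s ` {1..int i} = {1..int i}} = insert n {i \<in> {1..<n}. s ` {1..int i} = {1..int i}}"
    using fin n by auto
  then have "card {i \<in> {1..n}. s ` {1..int i} = {1..int i}} = 1 + card {i \<in> {1..<n}. s ` {1..int i} = {1..int i}}"
    by simp
  moreover have "{i \<in> {1..<n}. \<forall>a b. 1 \<le> a \<longrightarrow> a \<le> int i \<longrightarrow> int i < b \<longrightarrow> b \<le> int n \<longrightarrow> inv s a < inv s b} =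
      {i \<in> {1..<n}. s ` {1..int i} = {1..int i}}"
    by (intro Collect_cong conj_cong refl c)
  ultimately show ?thesis unfolding bl_iff by simp
qed

section \<open>Permutations avoiding 321 as lists\<close>

definition Av321 :: "nat \<Rightarrow> (int \<Rightarrow> int) set" where
  "Av321 n = {s \<in> Sn n. \<forall>i j k. 1 \<le> i \<longrightarrow> i < j \<longrightarrow> j < k \<longrightarrow> k \<le> int n \<longrightarrow> s j < s i \<longrightarrow> s j \<le> s k}"

lemma AvD: "s \<in> Av321 n \<Longrightarrow> s \<in> Sn n"
  "s \<in> Av321 n \<Longrightarrow> 1 \<le> i \<Longrightarrow> i < j \<Longrightarrow> j < k \<Longrightarrow> k \<le> int n \<Longrightarrow> s j < s i \<Longrightarrow> s j \<le> s k"
  by (auto simp: Av321_def)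

definition lst :: "(int \<Rightarrow> int) \<Rightarrow> nat \<Rightarrow> nat list" where
  "lst s i = rev (map (\<lambda>k. nat (s (int k))) [1..<Suc i])"

lemma lst_0 [simp]: "lst s 0 = []"
  by (simp add: lst_def)

lemma lst_Suc: "lst s (Suc i) = nat (s (int (Suc i))) # lst s i"
  by (simp add: lst_def)

lemma length_lst [simp]: "length (lst s i) = i"
  by (simp add: lst_def)

lemma set_lst: "set (lst s i) = (\<lambda>k. nat (s (int k))) ` {1..i}"
  by (auto simp: lst_def)

lemma Sn_image:
  assumes "s \<in> Sn n" shows "s ` {1..int n} = {1..int n}"
proof (rule endo_inj_surj)
  show "s ` {1..int n} \<subseteq> {1..int n}" using SnD(2)[OF assms] by auto
  show "inj_on s {1..int n}" using Bn_inj[OF SnD(1)[OF assms]] by (auto intro: inj_onI)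
qed simp

lemma Sn_surj:
  assumes "s \<in> Sn n" "1 \<le> v" "v \<le> n"
  obtains c where "1 \<le> c" "c \<le> n" "s (int c) = int v"
proof -
  have "int v \<in> s ` {1..int n}" using assms Sn_image by auto
  then obtain k where k: "1 \<le> k" "k \<le> int n" "s k = int v" by auto
  then show ?thesis using that[of "nat k"] by simp
qed

lemma in_set_lst:
  assumes s: "s \<in> Sn n" and "i \<le> n" "1 \<le> c" "c \<le> n"
  shows "nat (s (int c)) \<in> set (lst s i) \<longleftrightarrow> c \<le> i"
proof
  assume "nat (s (int c)) \<in> set (lst s i)"
  then obtain k where k: "1 \<le> k" "k \<le> i" "nat (s (int c)) = nat (s (int k))" by (auto simp: set_lst)
  have "1 \<le> s (int c)" "1 \<le> s (int k)"
    using SnD(2)[OF s, of "int c"] SnD(2)[OF s, of "int k"] assms k by auto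
  then have "s (int c) = s (int k)" using k(3) by linarith
  then show "c \<le> i" using Bn_inj[OF SnD(1)[OF s]] k by simp
qed (use assms in \<open>auto simp: set_lst\<close>)

text \<open>A letter that is not a new maximum must be the least missing value: otherwise the
  maximum, this letter and the smaller missing value that comes later form a 321.\<close>

lemma lst_prefix321:
  assumes s: "s \<in> Av321 n" and "i \<le> n"
  shows "\<exists>g. lst s i \<in> prefix321 i g"
  using assms(2)
proof (induction i)
  case (Suc i)
  note sS = AvD(1)[OF s]
  let ?l = "lst s i" and ?b = "nat (s (int (Suc i)))"
  obtain g where g: "?l \<in> prefix321 i g" using Suc by auto
  note inv = prefix321_inv[OF g]
  have b: "1 \<le> ?b" "?b \<le> n" "int ?b = s (int (Suc i))" using SnD(2)[OF sS, of "int (Suc i)"] Suc.prems by auto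
  have bl: "?b \<notin> set ?l" using in_set_lst[OF sS, of i "Suc i"] Suc.prems by simp
  show ?case
  proof (cases "i + g < ?b")
    case True
    then have "?b = Suc i + (?b - Suc i)" "g \<le> ?b - Suc i" by auto
    then have "?b # ?l \<in> prefix321 (Suc i) (?b - Suc i)" using g by auto
    then show ?thesis unfolding lst_Suc by blast
  next
    case False
    then have "i + g \<in> set ?l" using inv b by auto
    then have lt: "?b < i + g" using False bl by (metis linorder_neqE_nat)
    have "g \<noteq> 0"
    proof
      assume "g = 0"
      moreover have "i > 0" using lt b \<open>g = 0\<close> by simp
      ultimately have "set ?l = {1..i}" using prefix321_full[OF g] by simp
      then show False using bl b lt \<open>g = 0\<close> by simp
    qed
    then obtain g' where g': "g = Suc g'" by (cases g) auto
    have "mex ?l = ?b"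
    proof (rule ccontr)
      assume "mex ?l \<noteq> ?b"
      then have v: "mex ?l < ?b" using mex_le[OF b(1) bl] by simp
      obtain c where c: "1 \<le> c" "c \<le> n" "s (int c) = int (mex ?l)"
        using Sn_surj[OF sS, of "mex ?l"] mex_spec(1)[of ?l] v b by auto
      have "\<not> c \<le> i" using in_set_lst[OF sS, of i c] c mex_spec(2)[of ?l] Suc.prems by simp
      moreover have "c \<noteq> Suc i" using c v b by auto
      ultimately have ci: "Suc i < c" by simp
      obtain a where a: "1 \<le> a" "a \<le> i" "i + g = nat (s (int a))" using \<open>i + g \<in> set ?l\<close> by (auto simp: set_lst)
      then have "s (int (Suc i)) < s (int a)" using lt b by linarith
      then have "s (int (Suc i)) \<le> s (int c)"
        using AvD(2)[OF s, of "int a" "int (Suc i)" "int c"] a ci c by simp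
      then show False using c v b by linarith
    qed
    moreover have "mex ?l # ?l \<in> prefix321 (Suc i) g'" using g g' by auto
    ultimately have "?b # ?l \<in> prefix321 (Suc i) g'" by metis
    then show ?thesis unfolding lst_Suc by blast
  qed
qed (auto intro: exI[of _ 0])

lemma prefix321_tl: "b # l \<in> prefix321 (Suc n) g \<Longrightarrow> \<exists>h. l \<in> prefix321 n h"
  by auto

lemma prefix321_lst_prefix:
  assumes "lst s n \<in> prefix321 n g" "i \<le> n"
  shows "\<exists>h. lst s i \<in> prefix321 i h"
  using assms(2)
proof (induction i rule: inc_induct)
  case base
  then show ?case using assms(1) by blast
next
  case (step m)
  then show ?case using prefix321_tl unfolding lst_Suc by blast
qed

text \<open>The middle letter of a 321 has a larger one before it, so it was the least missing value
  when placed; but the third letter was missing too, and is smaller.\<close>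

lemma lst_prefix321_Av321:
  assumes s: "s \<in> Sn n" and l: "lst s n \<in> prefix321 n 0"
  shows "s \<in> Av321 n"
proof -
  have "s j \<le> s k" if h: "1 \<le> i" "i < j" "j < k" "k \<le> int n" "s j < s i" for i j k
  proof (rule ccontr)
    assume c: "\<not> s j \<le> s k"
    define m where "m = nat (j - 1)"
    have j: "j = int (Suc m)" "Suc m \<le> n" using h by (auto simp: m_def)
    obtain g where g: "lst s (Suc m) \<in> prefix321 (Suc m) g" using prefix321_lst_prefix[OF l j(2)] by blast
    have pos: "1 \<le> s i" "1 \<le> s j" "1 \<le> s k" using SnD(2)[OF s] h by force+
    have im: "nat (s i) \<in> set (lst s m)" using in_set_lst[OF s, of m "nat i"] h j by simp
    have km: "nat (s k) \<notin> set (lst s m)" using in_set_lst[OF s, of m "nat k"] h j by simp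
    from g consider h where "lst s m \<in> prefix321 m h" "h \<le> g" "nat (s j) = Suc m + g" | "nat (s j) = mex (lst s m)"
      unfolding lst_Suc j(1)[symmetric] by auto
    then show False
    proof cases
      case 1
      then have "nat (s i) \<le> m + h" using prefix321_inv[of "lst s m" m h] im by auto
      then show False using 1 h(5) pos by linarith
    next
      case 2
      have "mex (lst s m) \<le> nat (s k)" using mex_le[OF _ km] pos by simp
      then show False using 2 c pos by linarith
    qed
  qed
  then show ?thesis using s by (simp add: Av321_def)
qed

definition oflist :: "nat list \<Rightarrow> int \<Rightarrow> int" where
  "oflist l i = (if 1 \<le> i \<and> i \<le> int (length l) then int (rev l ! nat (i - 1))
     else if 1 \<le> - i \<and> - i \<le> int (length l) then - int (rev l ! nat (- i - 1)) else i)"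

lemma oflist_Sn:
  assumes d: "distinct l" and st: "set l = {1..n}" and len: "length l = n"
  shows "oflist l \<in> Sn n" "lst (oflist l) n = l"
proof -
  have val: "rev l ! k \<in> {1..n}" if "k < n" for k
    using nth_mem[of k "rev l"] that st len by simp
  have inj: "rev l ! k = rev l ! k' \<longleftrightarrow> k = k'" if "k < n" "k' < n" for k k'
    using d that len nth_eq_iff_index_eq[of "rev l"] by simp
  have m: "oflist l (- i) = - oflist l i" for i
    by (auto simp: oflist_def)
  have f: "int n < \<bar>i\<bar> \<Longrightarrow> oflist l i = i" for i
    using len by (auto simp: oflist_def)
  have p: "oflist l i \<in> {1..int n}" if "i \<in> {1..int n}" for i
    using val[of "nat (i - 1)"] that len by (auto simp: oflist_def)
  have injp: "inj_on (oflist l) {1..int n}"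
  proof (rule inj_onI)
    fix i j assume h: "i \<in> {1..int n}" "j \<in> {1..int n}" "oflist l i = oflist l j"
    then have "nat (i - 1) = nat (j - 1)"
      using inj[of "nat (i - 1)" "nat (j - 1)"] len by (auto simp: oflist_def)
    then show "i = j" using h by auto
  qed
  have im: "oflist l ` {1..int n} = {1..int n}"
    using p injp by (intro endo_inj_surj) auto
  have 0: "oflist l 0 = 0" by (simp add: oflist_def)
  have "surj (oflist l)"
  proof (rule surjI2)
    fix y
    consider "int n < \<bar>y\<bar>" | "y \<in> {1..int n}" | "- y \<in> {1..int n}" | "y = 0" by fastforce
    then show "\<exists>x. y = oflist l x"
    proof cases
      case 1
      then show ?thesis using f by metis
    next
      case 2
      then show ?thesis using im by blast
    next
      case 3
      then obtain x where "- y = oflist l x" using im by blast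
      then have "y = oflist l (- x)" using m by simp
      then show ?thesis by blast
    next
      case 4
      then show ?thesis using 0 by metis
    qed
  qed
  moreover have "inj (oflist l)"
  proof (rule injI)
    fix i j assume e: "oflist l i = oflist l j"
    have sgn: "int n < \<bar>k\<bar> \<and> oflist l k = k \<or> 1 \<le> k \<and> k \<le> int n \<and> 1 \<le> oflist l k \<and> oflist l k \<le> int n \<or>
        1 \<le> - k \<and> - k \<le> int n \<and> 1 \<le> - oflist l k \<and> - oflist l k \<le> int n \<or> k = 0 \<and> oflist l k = 0" for k
    proof -
      consider "int n < \<bar>k\<bar>" | "k \<in> {1..int n}" | "- k \<in> {1..int n}" | "k = 0" by fastforce
      then show ?thesis
        by cases (use f[of k] p[of k] p[of "- k"] m[of k] 0 in auto)
    qed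
    consider "i \<in> {1..int n}" "j \<in> {1..int n}" | "- i \<in> {1..int n}" "- j \<in> {1..int n}" | "i = j"
      using sgn[of i] sgn[of j] e by fastforce
    then show "i = j"
    proof cases
      case 1
      then show ?thesis using injp e by (auto dest: inj_onD)
    next
      case 2
      then have "oflist l (- i) = oflist l (- j)" using m e by simp
      then show ?thesis using inj_onD[OF injp, of "- i" "- j"] 2 by simp
    qed
  qed
  ultimately have "oflist l \<in> Bn n" using m f by (simp add: Bn_def bij_def)
  moreover have "0 < oflist l i" if "1 \<le> i" "i \<le> int n" for i using p[of i] that by simp
  ultimately show "oflist l \<in> Sn n" by (simp add: Sn_def)
  show "lst (oflist l) n = l"
  proof -
    have "map (\<lambda>k. nat (oflist l (int k))) [1..<Suc n] = rev l"
      using len by (intro nth_equalityI) (auto simp: oflist_def nat_diff_distrib simp del: upt_Suc)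
    then show ?thesis by (simp add: lst_def)
  qed
qed

lemma bij_betw_lst: "bij_betw (\<lambda>s. lst s n) (Av321 n) (prefix321 n 0)"
proof (rule bij_betw_imageI)
  show "inj_on (\<lambda>s. lst s n) (Av321 n)"
  proof (rule inj_onI)
    fix s t assume s: "s \<in> Av321 n" and t: "t \<in> Av321 n" and e: "lst s n = lst t n"
    note sB = SnD(1)[OF AvD(1)[OF s]] and tB = SnD(1)[OF AvD(1)[OF t]]
    have "nat (s (int k)) = nat (t (int k))" if "1 \<le> k" "k \<le> n" for k
      using e that unfolding lst_def rev_is_rev_conv by (auto simp del: upt_Suc)
    then have p: "s i = t i" if "1 \<le> i" "i \<le> int n" for i
      using that SnD(2)[OF AvD(1)[OF s], of i] SnD(2)[OF AvD(1)[OF t], of i] nat_eq_iff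
      by (smt (verit) int_nat_eq le_nat_iff nat_le_iff of_nat_1)
    show "s = t"
    proof
      fix i
      consider "int n < \<bar>i\<bar>" | "1 \<le> i" "i \<le> int n" | "1 \<le> - i" "- i \<le> int n" | "i = 0" by linarith
      then show "s i = t i"
      proof cases
        case 1
        then show ?thesis using Bn_fix[OF sB] Bn_fix[OF tB] by simp
      next
        case 2
        then show ?thesis by (rule p)
      next
        case 3
        then show ?thesis using p[of "- i"] Bn_minus[OF sB, of i] Bn_minus[OF tB, of i] by simp
      next
        case 4
        then show ?thesis using Bn_zero[OF sB, of 0] Bn_zero[OF tB, of 0] by simp
      qed
    qed
  qed
  show "(\<lambda>s. lst s n) ` Av321 n = prefix321 n 0"
  proof (intro subset_antisym subsetI)
    fix l assume "l \<in> (\<lambda>s. lst s n) ` Av321 n"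
    then obtain s where s: "s \<in> Av321 n" "l = lst s n" by blast
    obtain g where g: "l \<in> prefix321 n g" using lst_prefix321[OF s(1) order_refl] s(2) by blast
    show "l \<in> prefix321 n 0"
    proof (cases "n = 0")
      case True
      then show ?thesis using g by (auto split: if_splits)
    next
      case False
      then have "n + g \<in> set l" using prefix321_inv[OF g] by simp
      then obtain k where k: "1 \<le> k" "k \<le> n" "n + g = nat (s (int k))" using s(2) by (auto simp: set_lst)
      have "s (int k) \<le> int n" using SnD(2)[OF AvD(1)[OF s(1)], of "int k"] k by simp
      then have "n + g \<le> n" using k(3) by linarith
      then show ?thesis using g by simp
    qed
  next
    fix l assume l: "l \<in> prefix321 n 0"
    have d: "distinct l" "length l = n" using prefix321_inv[OF l] prefix321_length[OF l] by auto
    have st: "set l = {1..n}"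
      using prefix321_full[OF l] d(2) by (cases "n = 0") auto
    show "l \<in> (\<lambda>s. lst s n) ` Av321 n"
      using oflist_Sn[OF d(1) st d(2)] lst_prefix321_Av321[of "oflist l" n] l by (metis image_eqI)
  qed
qed

lemma ldes_set_lst:
  assumes s: "s \<in> Sn n" and "i \<le> n"
  shows "ldes_set (lst s i) = {k \<in> {1..<i}. s (int k + 1) < s (int k)}"
  using assms(2)
proof (induction i rule: induct_nat_012)
  case (ge2 i)
  have "1 \<le> s (int (Suc i))" "1 \<le> s (int (Suc (Suc i)))"
    using SnD(2)[OF s, of "int (Suc i)"] SnD(2)[OF s, of "int (Suc (Suc i))"] ge2.prems by auto
  then have "nat (s (int (Suc (Suc i)))) < nat (s (int (Suc i))) \<longleftrightarrow> s (int (Suc i) + 1) < s (int (Suc i))"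
    by (simp add: nat_less_eq_zless add.commute)
  moreover have "{k \<in> {1..<Suc (Suc i)}. s (int k + 1) < s (int k)} =
      (if s (int (Suc i) + 1) < s (int (Suc i)) then {Suc i} else {}) \<union> {k \<in> {1..<Suc i}. s (int k + 1) < s (int k)}"
    by (auto simp: less_Suc_eq)
  ultimately show ?case using ge2.IH(2) ge2.prems by (simp add: lst_Suc)
qed (auto simp: lst_Suc)

lemma desB_Sn: "s \<in> Sn n \<Longrightarrow> desB n s = {k \<in> {1..<n}. s (int k + 1) < s (int k)}"
proof -
  assume s: "s \<in> Sn n"
  have "0 \<notin> desB n s" using desB_0[OF SnD(1)[OF s]] SnD(2)[OF s, of 1] by auto
  then show ?thesis by (auto simp: desB_iff Suc_le_eq intro!: gr0I)
qed

lemma zcount_lst: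
  assumes s: "s \<in> Sn n" and "i \<le> n"
  shows "zcount (lst s i) = card {k \<in> {1..i}. s ` {1..int k} = {1..int k}}"
  using assms(2)
proof (induction i)
  case (Suc i)
  let ?A = "\<lambda>i. {k \<in> {1..i}. s ` {1..int k} = {1..int k}}"
  have "set (lst s (Suc i)) = nat ` s ` {1..int (Suc i)}"
  proof -
    have "int ` {1..Suc i} = {1..int (Suc i)}" by (simp add: image_int_atLeastAtMost)
    moreover have "(\<lambda>k. nat (s (int k))) ` {1..Suc i} = nat ` s ` int ` {1..Suc i}"
      by (simp only: image_image)
    ultimately show ?thesis by (metis set_lst)
  qed
  moreover have "nat ` s ` {1..int (Suc i)} = {1..Suc i} \<longleftrightarrow> s ` {1..int (Suc i)} = {1..int (Suc i)}"
  proof -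
    have "int ` nat ` s ` {1..int (Suc i)} = s ` {1..int (Suc i)}"
      using SnD(2)[OF s] Suc.prems by (force simp: image_image)
    moreover have "int ` {1..Suc i} = {1..int (Suc i)}" by (simp add: image_int_atLeastAtMost)
    ultimately show ?thesis by (metis inj_image_eq_iff inj_of_nat)
  qed
  moreover have "?A (Suc i) = (if s ` {1..int (Suc i)} = {1..int (Suc i)} then insert (Suc i) (?A i) else ?A i)"
    by (auto simp: le_Suc_eq)
  ultimately show ?case using Suc by (simp add: lst_Suc)
qed simp

lemma sum_Av321:
  fixes q :: "'a::comm_ring_1"
  assumes n: "n \<ge> 1"
  shows "(\<Sum>s\<in>Av321 n. q ^ bl n (inv s) * f (desB n s)) = (\<Sum>k\<le>n. ldsum q n k * bsum n k f)"
proof -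
  have "(\<Sum>s\<in>Av321 n. q ^ bl n (inv s) * f (desB n s)) = (\<Sum>s\<in>Av321 n. q ^ zcount (lst s n) * f (ldes_set (lst s n)))"
  proof (intro sum.cong refl)
    fix s assume "s \<in> Av321 n"
    then have s: "s \<in> Sn n" by (rule AvD)
    show "q ^ bl n (inv s) * f (desB n s) = q ^ zcount (lst s n) * f (ldes_set (lst s n))"
      using bl_inv_Sn[OF s n] zcount_lst[OF s order_refl] ldes_set_lst[OF s order_refl] desB_Sn[OF s] by simp
  qed
  also have "\<dots> = (\<Sum>l\<in>prefix321 n 0. q ^ zcount l * f (ldes_set l))"
    by (rule sum.reindex_bij_betw[OF bij_betw_lst])
  finally show ?thesis by (simp add: sum_prefix321)
qed

section \<open>Fibers of the factorization\<close>

lemma step_mono: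
  fixes s :: "int \<Rightarrow> int"
  assumes "\<And>i. a \<le> i \<Longrightarrow> i < b \<Longrightarrow> s i < s (i + 1)" "a \<le> i" "i < j" "j \<le> b"
  shows "s i < s j"
  using assms(3,4)
proof (induction j rule: int_gr_induct)
  case base
  then show ?case using assms(1,2) by simp
next
  case (step j)
  then have "s i < s j" "s j < s (j + 1)" using assms(1)[of j] assms(2) by auto
  then show ?case by simp
qed

lemma not_desB_less:
  assumes "s \<in> Sn n" "1 \<le> i" "i < int n" "nat i \<notin> desB n s"
  shows "s i < s (i + 1)"
proof -
  have "s i \<noteq> s (i + 1)" using Bn_inj[OF SnD(1)[OF assms(1)]] by simp
  then show ?thesis using assms by (auto simp: desB_iff)
qed

text \<open>End of the first increasing run; the default n means that the run is the whole
  window.\<close>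

definition first_des :: "nat \<Rightarrow> nat set \<Rightarrow> nat" where
  "first_des n D = (if D = {} then n else Min D)"

text \<open>For 1 in \<open>D\<close>, the end of the second increasing run, again n if no further
  descent stops it.\<close>

definition second_des :: "nat \<Rightarrow> nat set \<Rightarrow> nat" where
  "second_des n D = (if D = {1} then n else Min (D - {1}))"

lemma finite_desB [simp]: "finite (desB n w)"
  by (simp add: desB_def)

lemma desB_Sn_pos: "s \<in> Sn n \<Longrightarrow> d \<in> desB n s \<Longrightarrow> 1 \<le> d \<and> d < n"
  by (simp add: desB_Sn)

lemma first_des_props:
  assumes s: "s \<in> Sn n"
  shows "first_des n (desB n s) \<le> n" "d \<in> desB n s \<Longrightarrow> first_des n (desB n s) \<le> d"
    "first_des n (desB n s) < n \<Longrightarrow> first_des n (desB n s) \<in> desB n s"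
proof -
  let ?D = "desB n s"
  have "?D \<noteq> {} \<Longrightarrow> Min ?D \<in> ?D" by simp
  then show "first_des n ?D \<le> n" "first_des n ?D < n \<Longrightarrow> first_des n ?D \<in> ?D"
    using desB_Sn_pos[OF s, of "Min ?D"] by (auto simp: first_des_def less_imp_le)
  show "d \<in> ?D \<Longrightarrow> first_des n ?D \<le> d" by (auto simp: first_des_def)
qed

lemma increasing_first:
  assumes s: "s \<in> Sn n" and h: "1 \<le> i" "i < j" "j \<le> int (first_des n (desB n s))"
  shows "s i < s j"
proof (rule step_mono[where s = s and a = 1 and b = "int (first_des n (desB n s))" and i = i and j = j])
  fix i assume i: "1 \<le> i" "i < int (first_des n (desB n s))"
  then have "nat i \<notin> desB n s" using first_des_props(2)[OF s, of "nat i"] by auto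
  then show "s i < s (i + 1)" using not_desB_less[OF s i(1)] i first_des_props(1)[OF s] by simp
qed (use h in auto)

lemma second_des_props:
  assumes s: "s \<in> Sn n" "1 \<in> desB n s"
  shows "second_des n (desB n s) \<le> n" "2 \<le> second_des n (desB n s)"
    "d \<in> desB n s \<Longrightarrow> d \<noteq> 1 \<Longrightarrow> second_des n (desB n s) \<le> d"
    "second_des n (desB n s) < n \<Longrightarrow> second_des n (desB n s) \<in> desB n s - {1}"
proof -
  let ?D = "desB n s"
  have n: "2 \<le> n" using desB_Sn_pos[OF s] by simp
  have "?D \<noteq> {1} \<Longrightarrow> ?D - {1} \<noteq> {}" using s(2) by blast
  then have m: "?D \<noteq> {1} \<Longrightarrow> Min (?D - {1}) \<in> ?D - {1}" using Min_in[of "?D - {1}"] by simp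
  have m2: "?D \<noteq> {1} \<Longrightarrow> 2 \<le> Min (?D - {1}) \<and> Min (?D - {1}) < n"
  proof -
    assume "?D \<noteq> {1}"
    then have "Min (?D - {1}) \<in> ?D" "Min (?D - {1}) \<noteq> 1" using m by auto
    then show ?thesis using desB_Sn_pos[OF s(1), of "Min (?D - {1})"] by linarith
  qed
  show "second_des n ?D \<le> n" "2 \<le> second_des n ?D" using m2 n
    by (cases "?D = {1}"; simp add: second_des_def del: One_nat_def)+
  show "second_des n ?D < n \<Longrightarrow> second_des n ?D \<in> ?D - {1}" using m
    by (cases "?D = {1}"; simp add: second_des_def del: One_nat_def)
  show "d \<in> ?D \<Longrightarrow> d \<noteq> 1 \<Longrightarrow> second_des n ?D \<le> d"
    by (cases "?D = {1}") (auto simp: second_des_def)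
qed

lemma increasing_second:
  assumes s: "s \<in> Sn n" "1 \<in> desB n s" and h: "2 \<le> i" "i < j" "j \<le> int (second_des n (desB n s))"
  shows "s i < s j"
proof (rule step_mono[where s = s and a = 2 and b = "int (second_des n (desB n s))" and i = i and j = j])
  fix i assume i: "2 \<le> i" "i < int (second_des n (desB n s))"
  then have "nat i \<noteq> 1" by arith
  then have "nat i \<notin> desB n s" using second_des_props(3)[OF s, of "nat i"] i by fastforce
  then show "s i < s (i + 1)" using not_desB_less[OF s(1), of i] i second_des_props(1)[OF s] by simp
qed (use h in auto)

lemma shuf_single:
  assumes "1 \<le> i" "1 \<le> x"
  shows "shuf {i} x = (if x < i then x + 1 else if x = i then -1 else x)"
proof -
  have e: "{k \<in> {i}. x \<le> k} = (if x \<le> i then {i} else {})" "{k \<in> {i}. x < k} = (if x < i then {i} else {})"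
    by auto
  show ?thesis unfolding shuf_def shufp_def e using assms by simp
qed

text \<open>An unsigned letter of the run exceeds all earlier letters in absolute value, and the
  signed letters increase among themselves, so no violation has its middle letter in the run. One
  with a later middle letter yields a 321 in \<open>s\<close>.\<close>

lemma fc_pattern_first:
  assumes s: "s \<in> Av321 n" and N: "N \<subseteq> {1..int (first_des n (desB n s))}"
  shows "fc_pattern (int n) (s \<circ> shuf N)"
proof -
  let ?p = "int (first_des n (desB n s))" and ?w = "s \<circ> shuf N" and ?m = "int (card N)"
  note sS = AvD(1)[OF s]
  note B = SnD(1)[OF sS]
  have p: "?p \<le> int n" using first_des_props(1)[OF sS] by simp
  have Nn: "N \<subseteq> {1..int n}" using N p by auto
  have mp: "?m \<le> ?p"
    using card_mono[OF _ N] by simp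
  have bN: "b \<in> N \<Longrightarrow> 1 \<le> b \<and> b \<le> ?p" for b using N by auto
  have neg: "?w i = - s (- shuf N i) \<and> 1 \<le> - shuf N i \<and> - shuf N i \<le> ?m \<and> ?w i < 0" if "i \<in> N" for i
  proof -
    have r: "1 \<le> - shuf N i" "- shuf N i \<le> ?m" using shuf_neg[OF Nn that] by auto
    then have "0 < s (- shuf N i)" using SnD(2)[OF sS, of "- shuf N i"] mp p by simp
    then show ?thesis using r Bn_minus[OF B, of "shuf N i"] by simp
  qed
  have out: "?w i = s (shuf N i) \<and> ?m < shuf N i \<and> shuf N i \<le> ?p \<and> 0 < ?w i" if "i \<notin> N" "1 \<le> i" "i \<le> ?p" for i
  proof -
    have "?m < shuf N i" "shuf N i \<le> ?p" using shuf_pos[OF Nn that(2,1)] shuf_le[OF Nn that(2,1,3)] bN by blast+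
    then show ?thesis using SnD(2)[OF sS, of "shuf N i"] p by simp
  qed
  have aft: "?w i = s i" if "?p < i" for i
    using shuf_after[OF Nn, of i] N that by fastforce
  have aftpos: "0 < ?w i" if "?p < i" "i \<le> int n" for i
    using aft[OF that(1)] SnD(2)[OF sS, of i] that by simp
  have inc: "s x < s y" if "1 \<le> x" "x < y" "y \<le> ?p" for x y
    using increasing_first[OF sS that] .
  have small: "\<bar>?w a\<bar> < ?w b" if "a < b" "1 \<le> a" "b \<le> ?p" "b \<notin> N" for a b
  proof (cases "a \<in> N")
    case True
    then show ?thesis using neg[OF True] out[of b] that inc[of "- shuf N a" "shuf N b"] by auto
  next
    case False
    have "shuf N a < shuf N b" using shuf_mono_out[OF Nn False that(4,2,1)] .
    then show ?thesis using out[of a] out[of b] False that inc[of "shuf N a" "shuf N b"] by auto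
  qed
  show ?thesis
    unfolding fc_pattern_def
  proof (intro conjI allI impI)
    fix a b assume h: "1 \<le> a" "a < b" "b \<le> int n" "?w b < ?w a"
    show "0 \<le> ?w a"
    proof (rule ccontr)
      assume c: "\<not> 0 \<le> ?w a"
      then have aN: "a \<in> N" using out[of a] aftpos[of a] h by (cases "a \<le> ?p") auto
      have "b \<in> N" using out[of b] aftpos[of b] h c by (cases "b \<le> ?p") auto
      then have "shuf N a < shuf N b" using shuf_mono_in[OF Nn aN] h by simp
      then show False using neg[OF aN] neg[OF \<open>b \<in> N\<close>] inc[of "- shuf N b" "- shuf N a"] h mp by auto
    qed
  next
    fix a b c assume h: "1 \<le> a" "a < b" "b < c" "c \<le> int n" "?w b < \<bar>?w a\<bar>"
    show "?w b \<le> ?w c"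
    proof (rule ccontr)
      assume "\<not> ?w b \<le> ?w c"
      then have lt: "?w c < ?w b" by simp
      show False
      proof (cases "b \<le> ?p")
        case True
        have "b \<in> N" using small[of a b] h True by fastforce
        then have bneg: "?w b < 0" using neg by blast
        then have "c \<in> N" using out[of c] aftpos[of c] h lt by (cases "c \<le> ?p") auto
        then have "shuf N b < shuf N c" using shuf_mono_in[OF Nn \<open>b \<in> N\<close>] h by simp
        then show False using neg[OF \<open>b \<in> N\<close>] neg[OF \<open>c \<in> N\<close>] inc[of "- shuf N c" "- shuf N b"] lt mp by auto
      next
        case False
        then have bc: "?w b = s b" "?w c = s c" using aft h by auto
        \<comment> \<open>The absolute value of the first letter stands before b in \<open>s\<close>
          as well, at some t; then t, b, c is a 321 of \<open>s\<close>.\<close>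
        have "\<exists>t. 1 \<le> t \<and> t < b \<and> \<bar>?w a\<bar> = s t"
        proof (cases "a \<in> N")
          case True
          then show ?thesis using neg[OF True] mp False by (intro exI[of _ "- shuf N a"]) auto
        next
          case aN: False
          show ?thesis
          proof (cases "a \<le> ?p")
            case True
            then show ?thesis using out[OF aN h(1) True] False shuf_pos[OF Nn h(1) aN]
              by (intro exI[of _ "shuf N a"]) auto
          next
            case F: False
            then show ?thesis using aft[of a] aftpos[of a] h by (intro exI[of _ a]) auto
          qed
        qed
        then obtain t where t: "1 \<le> t" "t < b" "\<bar>?w a\<bar> = s t" by blast
        then show False using AvD(2)[OF s t(1,2) h(3,4)] h(5) lt bc by simp
      qed
    qed
  next
    fix a b c assume h: "1 \<le> a" "a < b" "b < c" "c \<le> int n" "0 < ?w a" "?w a < - ?w b"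
    have "b \<in> N" using out[of b] aftpos[of b] h by (cases "b \<le> ?p") auto
    moreover have "a \<notin> N" using neg[of a] h by auto
    ultimately have "s (- shuf N b) < s (shuf N a)"
      using neg[of b] out[of a] bN[of b] h inc[of "- shuf N b" "shuf N a"] by auto
    then show "?w a \<le> ?w c" using neg[OF \<open>b \<in> N\<close>] h by auto
  qed
qed

text \<open>The first letter of \<open>s\<close> is negated and moved to position i, within the
  second run. All other letters stay positive and those before i increase; what could still violate
  a condition pulls back to a 321 in \<open>s\<close>.\<close>

lemma fc_pattern_second:
  assumes s: "s \<in> Av321 n" "1 \<in> desB n s" and i: "2 \<le> i" "i \<le> int (second_des n (desB n s))"
  shows "fc_pattern (int n) (s \<circ> shuf {i})"
proof -
  let ?w = "s \<circ> shuf {i}"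
  note sS = AvD(1)[OF s(1)]
  note B = SnD(1)[OF sS]
  have i_n: "i \<le> int n" using i second_des_props(1)[OF sS s(2)] by simp
  have w: "?w x = (if x < i then s (x + 1) else if x = i then - s 1 else s x)" if "1 \<le> x" for x
    using shuf_single[of i x] i that Bn_minus[OF B, of 1] by auto
  have pos: "0 < s x" if "1 \<le> x" "x \<le> int n" for x using SnD(2)[OF sS that] by simp
  have inc: "s x < s y" if "2 \<le> x" "x < y" "y \<le> i" for x y
    using increasing_second[OF sS s(2)] that i by simp
  have wneg: "x = i" if "1 \<le> x" "x \<le> int n" "?w x < 0" for x
    using w[of x] pos[of x] pos[of "x + 1"] that i_n by (auto split: if_splits)
  \<comment> \<open>The position in \<open>s\<close> of the letter that stands, up to sign, at x in
    the new word.\<close>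
  define f where "f x = (if x < i then x + 1 else if x = i then 1 else x)" for x
  have f: "1 \<le> f x \<and> f x \<le> int n" "\<bar>?w x\<bar> = s (f x)" "x \<noteq> i \<Longrightarrow> ?w x = s (f x)" if "1 \<le> x" "x \<le> int n" for x
    using w[of x] pos[of x] pos[of "x + 1"] pos[of 1] that i_n i by (auto simp: f_def)
  have fmono: "x < y \<Longrightarrow> y \<noteq> i \<Longrightarrow> 1 \<le> x \<Longrightarrow> f x < f y" for x y by (auto simp: f_def)
  show ?thesis
    unfolding fc_pattern_def
  proof (intro conjI allI impI)
    fix a b assume h: "1 \<le> a" "a < b" "b \<le> int n" "?w b < ?w a"
    show "0 \<le> ?w a"
    proof (rule ccontr)
      assume "\<not> 0 \<le> ?w a"
      then have "a = i" "b = i" using wneg[of a] wneg[of b] h by auto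
      then show False using h by simp
    qed
  next
    fix a b c assume h: "1 \<le> a" "a < b" "b < c" "c \<le> int n" "?w b < \<bar>?w a\<bar>"
    show "?w b \<le> ?w c"
    proof (rule ccontr)
      assume "\<not> ?w b \<le> ?w c"
      then have lt: "?w c < ?w b" by simp
      consider "b = i" | "c = i" | "b \<noteq> i" "c \<noteq> i" by blast
      then show False
      proof cases
        case 1
        then have "?w b < 0" using w[of i] pos[of 1] i i_n by simp
        then show False using wneg[of c] lt h 1 by simp
      next
        case 2
        then have "?w a < ?w b" using w[of a] w[of b] h inc[of "a + 1" "b + 1"] by simp
        moreover have "0 < ?w a" using w[of a] pos[of "a + 1"] h 2 by simp
        ultimately show False using h(5) by simp
      next
        case 3
        have "s (f b) < s (f a)" "s (f c) < s (f b)"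
          using f(2)[of a] f(3)[of b] f(3)[of c] 3 h lt by auto
        moreover have "1 \<le> f a" "f c \<le> int n" using f(1)[of a] f(1)[of c] h by auto
        moreover have "f a < f b" "f b < f c" using fmono 3 h by auto
        ultimately show False using AvD(2)[OF s(1), of "f a" "f b" "f c"] by simp
      qed
    qed
  next
    fix a b c assume h: "1 \<le> a" "a < b" "b < c" "c \<le> int n" "0 < ?w a" "?w a < - ?w b"
    have b: "b = i" using wneg[of b] h by simp
    have wa: "?w a = s (a + 1)" "?w c = s c" "?w b = - s 1" using w[of a] w[of b] w[of c] h b by auto
    show "?w a \<le> ?w c"
      using AvD(2)[OF s(1), of 1 "a + 1" c] wa h b by simp
  qed
qed

text \<open>If \<open>N\<close> leaves the first run, the letter at j = Max N is - s 1. Being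
  negative and late, it forces \<open>s\<close> to increase from card N + 1 to j; this pins the
  first descent to card N, and then card N to 1.\<close>

lemma fc_pattern_imp_fiber:
  assumes s: "s \<in> Sn n" and N: "N \<subseteq> {1..int n}" and g: "fc_pattern (int n) (s \<circ> shuf N)"
  shows "s \<in> Av321 n"
    and "N \<subseteq> {1..int (first_des n (desB n s))} \<or>
      1 \<in> desB n s \<and> (\<exists>i. 2 \<le> i \<and> i \<le> int (second_des n (desB n s)) \<and> N = {i})"
proof -
  let ?w = "s \<circ> shuf N" and ?m = "int (card N)" and ?P = "inv (shuf N)"
  note B = SnD(1)[OF s] and U = shuf_Bn[OF N]
  have P: "if t \<le> ?m then ?P t < 0 \<and> - ?P t \<in> N else 1 \<le> ?P t \<and> ?P t \<notin> N" if "1 \<le> t" "t \<le> int n" for t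
    by (rule inv_shuf_pos[OF N that])
  have Pm: "?P t < ?P t'" if "1 \<le> t" "t < t'" "t' \<le> int n" for t t'
    by (rule inv_shuf_mono[OF N that])
  have Pr: "\<bar>?P t\<bar> \<le> int n" if "1 \<le> t" "t \<le> int n" for t
    using Bn_range[OF Bn_inv[OF U], of t] that by simp
  have wP: "?w (?P t) = s t" "?w (- ?P t) = - s t" for t
    using U shuf_minus[of N "?P t"] Bn_minus[OF B, of t] by simp_all
  have pos: "0 < s t" if "1 \<le> t" "t \<le> int n" for t using SnD(2)[OF s that] by simp
  have inj: "s x \<noteq> s y" if "x < y" for x y using Bn_inj[OF B, of x y] that by simp
  have mn: "?m \<le> int n" using card_mono[OF _ N] by simp
  have A: "s a < s b" if "1 \<le> a" "a < b" "b \<le> ?m" for a b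
  proof (rule ccontr)
    assume "\<not> s a < s b"
    then have lt: "s b < s a" using inj[of a b] that by simp
    have "?P a < 0" "?P b < 0" using P[of a] P[of b] that mn by auto
    moreover have "?P a < ?P b" using Pm that mn by simp
    moreover have "- ?P a \<le> int n" using Pr[of a] that mn by simp
    ultimately have "0 \<le> ?w (- ?P b)"
      using fc_pattern1[OF g, of "- ?P b" "- ?P a"] lt unfolding wP by simp
    then show False using pos[of b] that mn unfolding wP by simp
  qed
  show Av321: "s \<in> Av321 n"
  proof -
    have "s b \<le> s c" if h: "1 \<le> a" "a < b" "b < c" "c \<le> int n" "s b < s a" for a b c
    proof (rule ccontr)
      assume "\<not> s b \<le> s c"
      then have lt: "s c < s b" by simp
      have bm: "?m < b" using A[of a b] h by fastforce
      have Pb: "1 \<le> ?P b" "1 \<le> ?P c" "?P b < ?P c" "?P c \<le> int n"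
        using P[of b] P[of c] Pm[of b c] Pr[of c] h bm by auto
      show False
      proof (cases "a \<le> ?m")
        case False
        then have "1 \<le> ?P a" "?P a < ?P b" using P[of a] Pm[of a b] h by auto
        then show False using fc_pattern2[OF g, of "?P a" "?P b" "?P c"] Pb lt h pos[of a] unfolding wP by simp
      next
        case True
        \<comment> \<open>The letter s a occurs negated, before, between or after the other two;
          every order contradicts one of the conditions.\<close>
        define al where "al = - ?P a"
        have al: "1 \<le> al" "al \<in> N" "al \<le> int n" "?w al = - s a"
          using P[of a] Pr[of a] True h wP(2)[of a] by (auto simp: al_def)
        have "al \<noteq> ?P b" "al \<noteq> ?P c" using al(2) P[of b] P[of c] h bm by auto
        then consider "al < ?P b" | "?P b < al" "al < ?P c" | "?P c < al" by linarith
        then show False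
        proof cases
          case 1
          then show False using fc_pattern2[OF g, of al "?P b" "?P c"] Pb al lt h pos[of a] unfolding wP(1) al(4) by simp
        next
          case 2
          then show False using fc_pattern3[OF g, of "?P b" al "?P c"] Pb al lt h pos[of b] unfolding wP(1) al(4) by simp
        next
          case 3
          then have "s c \<le> - s a" using fc_pattern2[OF g, of "?P b" "?P c" al] Pb al lt h pos[of b] unfolding wP(1) al(4) by simp
          then show False using pos[of a] pos[of c] h by simp
        qed
      qed
    qed
    then show ?thesis using s by (simp add: Av321_def)
  qed
  let ?D = "desB n s" and ?p = "int (first_des n (desB n s))"
  show "N \<subseteq> {1..?p} \<or> 1 \<in> ?D \<and> (\<exists>i. 2 \<le> i \<and> i \<le> int (second_des n ?D) \<and> N = {i})"
  proof (cases "N \<subseteq> {1..?p}")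
    case False
    then have ne: "N \<noteq> {}" by auto
    have fin: "finite N" using N finite_subset by blast
    define j where "j = Max N"
    have jN: "j \<in> N" and jmax: "\<And>k. k \<in> N \<Longrightarrow> k \<le> j" using fin ne by (auto simp: j_def)
    have jn: "1 \<le> j" "j \<le> int n" using jN N by auto
    have "?p < j"
    proof (rule ccontr)
      assume "\<not> ?p < j"
      then have "N \<subseteq> {1..?p}" using N jmax by force
      then show False using False by blast
    qed
    then have pD: "first_des n ?D \<in> ?D" using first_des_props(3)[OF s] jn by simp
    then have p1: "1 \<le> ?p" "s (?p + 1) < s ?p" using desB_Sn_pos[OF s] by (auto simp: desB_iff)
    have wj: "?w j = - s 1" using shuf_last[OF N ne] Bn_minus[OF B, of 1] by (simp add: j_def)
    have wj0: "?w j < 0" using wj pos[of 1] jn by simp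
    have jm: "1 \<le> ?m" using ne fin by (simp add: Suc_leI card_gt_0_iff)
    \<comment> \<open>\<open>shuf N\<close> fixes all positions after j, so the letters s t with t
      from card N + 1 to j stand left of j.\<close>
    have Pj: "1 \<le> ?P t \<and> ?P t < j" if "?m < t" "t \<le> j" for t
    proof -
      have t: "1 \<le> ?P t" "?P t \<notin> N" using P[of t] that jn jm by auto
      have "\<not> j < ?P t"
      proof
        assume "j < ?P t"
        then have "shuf N (?P t) = ?P t" using shuf_after[OF N t(1)] jmax by fastforce
        then show False using U that \<open>j < ?P t\<close> by simp
      qed
      then show ?thesis using t jN by (metis linorder_neqE)
    qed
    have inc2: "s t < s t'" if "?m < t" "t < t'" "t' \<le> j" for t t'
    proof (rule ccontr)
      assume "\<not> s t < s t'"
      then have lt: "s t' < s t" using inj[of t t'] that by simp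
      have "?P t < ?P t'" using Pm that jm jn by simp
      then have "s t' \<le> ?w j"
        using fc_pattern2[OF g, of "?P t" "?P t'" j] Pj[of t] Pj[of t'] that lt jn unfolding wP(1) by simp
      then show False using wj0 pos[of t'] that jm jn by simp
    qed
    \<comment> \<open>\<open>s\<close> increases up to card N by \<open>A\<close> and from card N +
      1 to j by \<open>inc2\<close>, so its descent p < j can only be card N.\<close>
    have pm: "?p = ?m"
    proof -
      have "\<not> ?m < ?p" using inc2[of ?p "?p + 1"] p1 \<open>?p < j\<close> by fastforce
      moreover have "\<not> ?p + 1 \<le> ?m" using A[of ?p "?p + 1"] p1 by fastforce
      ultimately show ?thesis by simp
    qed
    \<comment> \<open>With two or more signs, the negated letter s m and the letter s (m + 1) both
      stand before j, where m = card N; in either order they form an excluded pattern with - s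
      1.\<close>
    have m1: "?m = 1"
    proof (rule ccontr)
      assume "?m \<noteq> 1"
      then have m2: "2 \<le> ?m" using jm by simp
      define al where "al = - ?P ?m"
      define be where "be = ?P (?m + 1)"
      have al: "al \<in> N" "?w al = - s ?m" using P[of ?m] jm mn wP(2)[of ?m] by (auto simp: al_def)
      have al1: "1 \<le> al" "al \<le> j" using al(1) N jmax by auto
      have "?w al \<noteq> ?w j" using al(2) wj inj[of 1 ?m] m2 by simp
      then have alj: "al < j" using al1(2) by (metis le_neq_trans)
      have be: "1 \<le> be" "be < j" "be \<notin> N" "?w be = s (?m + 1)"
        using Pj[of "?m + 1"] P[of "?m + 1"] pm \<open>?p < j\<close> jn wP(1)[of "?m + 1"] by (auto simp: be_def)
      have d: "s (?m + 1) < s ?m" using p1(2) pm by simp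
      have sp: "0 < s (?m + 1)" "0 < s ?m" using pos[of "?m + 1"] pos[of ?m] jm pm \<open>?p < j\<close> jn by auto
      have "al \<noteq> be" using al be by auto
      then consider "al < be" | "be < al" by linarith
      then show False
      proof cases
        case 1
        then have "?w be \<le> ?w j" using fc_pattern2[OF g, of al be j] al1 be(2) jn d sp unfolding al(2) be(4) by simp
        then show False using wj0 sp unfolding be(4) by simp
      next
        case 2
        then have "?w be \<le> ?w j" using fc_pattern3[OF g, of be al j] alj be(1) jn d sp unfolding al(2) be(4) by simp
        then show False using wj0 sp unfolding be(4) by simp
      qed
    qed
    then have Nj: "N = {j}" using jN by (metis card_1_singletonE of_nat_eq_1_iff singletonD)
    have "first_des n ?D = 1" using pm m1 by simp
    then have D1: "1 \<in> ?D" using pD by simp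
    have "j \<le> int (second_des n ?D)"
    proof (rule ccontr)
      assume c: "\<not> j \<le> int (second_des n ?D)"
      let ?r = "second_des n ?D"
      have "?r < n" using c jn by simp
      then have "?r \<in> ?D" "2 \<le> ?r" using second_des_props(2,4)[OF s D1] by auto
      then have "s (int ?r + 1) < s (int ?r)" by (simp add: desB_iff)
      moreover have "s (int ?r) < s (int ?r + 1)" using inc2[of "int ?r" "int ?r + 1"] m1 \<open>2 \<le> ?r\<close> c by simp
      ultimately show False by simp
    qed
    moreover have "2 \<le> j" using \<open>?p < j\<close> pm m1 by simp
    ultimately show ?thesis using D1 Nj by blast
  qed simp
qed

lemma fc_pattern_comp_shuf:
  assumes s: "s \<in> Sn n" and N: "N \<subseteq> {1..int n}"
  shows "fc_pattern (int n) (s \<circ> shuf N) \<longleftrightarrow> s \<in> Av321 n \<and>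
    (N \<subseteq> {1..int (first_des n (desB n s))} \<or>
      1 \<in> desB n s \<and> (\<exists>i. 2 \<le> i \<and> i \<le> int (second_des n (desB n s)) \<and> N = {i}))"
  using fc_pattern_imp_fiber[OF assms] fc_pattern_first[of s n N] fc_pattern_second[of s n] by blast

section \<open>The two generating functions\<close>

lemma comp_shuf_neg_iff:
  assumes "s \<in> Sn n" "N \<subseteq> {1..int n}" "1 \<le> j" "j \<le> int n"
  shows "(s \<circ> shuf N) j < 0 \<longleftrightarrow> j \<in> N"
proof -
  have "j \<in> negs n (s \<circ> shuf N) \<longleftrightarrow> (s \<circ> shuf N) j < 0" using assms(3,4) by (simp only: negs_def mem_Collect_eq) simp
  then show ?thesis using negs_comp_shuf[OF assms(1,2)] by simp
qed

text \<open>Within the run the signs alone decide, since unsigned letters increase and so do signed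
  ones. Its end p stays a descent only if unsigned, as a negative letter lies below the positive one
  after it.\<close>

lemma desB_first_fiber:
  assumes s: "s \<in> Av321 n" and p: "p = first_des n (desB n s)" and N: "N \<subseteq> {1..int p}"
  shows "i \<in> desB n (s \<circ> shuf N) \<longleftrightarrow> i < n \<and>
    (if i < p then int i \<notin> N \<and> int i + 1 \<in> N else if i = p then int p \<notin> N else i \<in> desB n s)"
proof (cases "i < n")
  case True
  let ?w = "s \<circ> shuf N"
  note sS = AvD(1)[OF s]
  have pn: "p \<le> n" using first_des_props(1)[OF sS] p by simp
  have Nn: "N \<subseteq> {1..int n}" using N pn by auto
  have wB: "?w \<in> Bn n" using Bn_comp[OF SnD(1)[OF sS] shuf_Bn[OF Nn]] .
  note neg = comp_shuf_neg_iff[OF sS Nn]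
  have g: "fc_pattern (int n) ?w" using fc_pattern_first[OF s] N p by simp
  have p1: "1 \<le> p"
  proof (cases "p < n")
    case False then show ?thesis using True pn by simp
  next
    case pl: True
    then have "p \<in> desB n s" using first_des_props(3)[OF sS] p by simp
    then show ?thesis using desB_Sn_pos[OF sS] by blast
  qed
  have aft: "?w j = s j" if "int p < j" for j
    using shuf_after[OF Nn, of j] N that by fastforce
  have nz: "?w j \<noteq> 0" if "1 \<le> j" for j using Bn_zero[OF wB, of j] that by auto
  consider "i = 0" | "1 \<le> i" "i < p" | "i = p" | "p < i" by linarith
  then have "?w (int i + 1) < ?w (int i) \<longleftrightarrow>
     (if i < p then int i \<notin> N \<and> int i + 1 \<in> N else if i = p then int p \<notin> N else i \<in> desB n s)"
  proof cases
    case 1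
    have "0 \<notin> N" using N by auto
    moreover have "?w 0 = 0" using Bn_zero[OF wB, of 0] by simp
    ultimately show ?thesis using 1 p1 neg[of 1] True by simp
  next
    case 2
    have i: "1 \<le> int i" "int i \<le> int n" "1 \<le> int i + 1" "int i + 1 \<le> int n" "int i + 1 \<le> int p" using 2 True by auto
    have "\<not> ?w (int i + 1) < ?w (int i)" if "int i \<notin> N" "int i + 1 \<notin> N"
    proof -
      have "shuf N (int i) < shuf N (int i + 1)" using shuf_mono_out[OF Nn that] i by simp
      moreover have "k \<in> N \<Longrightarrow> k \<le> int p" for k using N by auto
      then have "shuf N (int i + 1) \<le> int p" using shuf_le[OF Nn i(3) that(2) i(5)] by blast
      moreover have "1 \<le> shuf N (int i)" using shuf_pos[OF Nn i(1) that(1)] by simp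
      ultimately show ?thesis using increasing_first[OF sS, of "shuf N (int i)" "shuf N (int i + 1)"] p by simp
    qed
    moreover have "\<not> ?w (int i + 1) < ?w (int i)" if "int i \<in> N"
      using fc_pattern1[OF g, of "int i" "int i + 1"] neg[OF i(1,2)] that i by auto
    moreover have "?w (int i + 1) < ?w (int i)" if "int i \<notin> N" "int i + 1 \<in> N"
      using neg[OF i(1,2)] neg[OF i(3,4)] that nz[OF i(1)] by auto
    ultimately show ?thesis using 2 by auto
  next
    case 3
    have pD: "p \<in> desB n s" using first_des_props(3)[OF sS] p 3 True by simp
    have i: "1 \<le> int p" "int p \<le> int n" "1 \<le> int p + 1" "int p + 1 \<le> int n" using p1 3 True by auto
    have "int p + 1 \<notin> N" using N by auto
    then have pos: "\<not> ?w (int p + 1) < 0" using neg[OF i(3,4)] by blast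
    show ?thesis
    proof (cases "int p \<in> N")
      case True
      then show ?thesis using neg[OF i(1,2)] pos 3 by auto
    next
      case False
      have "k < int p" if "k \<in> N" for k using that False N by (metis atLeastAtMost_iff in_mono le_neq_trans)
      then have "?w (int p) = s (int p)" using shuf_after[OF Nn i(1)] by simp
      then show ?thesis using aft[of "int p + 1"] pD False 3 by (simp add: desB_iff)
    qed
  next
    case 4
    then show ?thesis using aft[of "int i"] aft[of "int i + 1"] True by (simp add: desB_iff)
  qed
  then show ?thesis using True by (simp add: desB_iff)
qed (simp add: desB_iff)

lemma desB_first_wdes:
  assumes s: "s \<in> Av321 n" and p: "p = first_des n (desB n s)" and N: "N \<subseteq> {1..p}"
  shows "desB n (s \<circ> shuf (int ` N)) =
    (if desB n s = {} then wdes N else wdes (insert (Suc p) N) \<union> (desB n s - {p}))"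
proof -
  note sS = AvD(1)[OF s]
  have "int ` N \<subseteq> {1..int p}" using N by auto
  note d = desB_first_fiber[OF s p this]
  have mem: "int i \<in> int ` N \<longleftrightarrow> i \<in> N" for i
    by (simp add: inj_image_mem_iff)
  have mem: "int i \<in> int ` N \<longleftrightarrow> i \<in> N" "int i + 1 \<in> int ` N \<longleftrightarrow> Suc i \<in> N" for i
    using mem[of i] mem[of "Suc i"] by (simp_all add: add.commute)
  have Np: "Suc i \<in> N \<Longrightarrow> i < p" for i using N by auto
  have pn: "p \<le> n" using first_des_props(1)[OF sS] p by simp
  show ?thesis
  proof (cases "desB n s = {}")
    case True
    then have "p = n" using p by (simp add: first_des_def)
    then show ?thesis using True d mem Np by (auto simp: wdes_def)
  next
    case False
    then have "Min (desB n s) \<in> desB n s" by simp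
    then have pD: "p \<in> desB n s" "p < n" using p False desB_Sn_pos[OF sS] by (auto simp: first_des_def)
    have le: "j \<in> desB n s \<Longrightarrow> p \<le> j \<and> j < n" for j
      using first_des_props(2)[OF sS] p desB_Sn_pos[OF sS] by blast
    have "i \<in> desB n (s \<circ> shuf (int ` N)) \<longleftrightarrow> i \<in> wdes (insert (Suc p) N) \<union> (desB n s - {p})" for i
    proof -
      consider "i < p" | "i = p" | "p < i" by linarith
      then show ?thesis
      proof cases
        case 1
        then show ?thesis using d[of i] mem[of i] le[of i] pD by (auto simp: wdes_def)
      next
        case 2
        then show ?thesis using d[of i] mem[of i] pD N by (auto simp: wdes_def)
      next
        case 3
        then show ?thesis using d[of i] mem[of i] le[of i] Np[of i] by (auto simp: wdes_def)
      qed
    qed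
    then show ?thesis using False by auto
  qed
qed

lemma sum_first_fiber:
  fixes x :: "nat \<Rightarrow> 'a::comm_ring_1"
  assumes s: "s \<in> Av321 n" and p: "p = first_des n (desB n s)"
  shows "(\<Sum>N\<in>Pow {1..int p}. prod x (desB n (s \<circ> shuf N))) = fiber_first x n (desB n s)"
proof -
  note sS = AvD(1)[OF s]
  have im: "int ` {1..p} = {1..int p}" by (simp add: image_int_atLeastAtMost)
  have "bij_betw (image int) (Pow {1..p}) (Pow {1..int p})"
    unfolding im[symmetric] by (rule bij_betw_Pow) (simp add: inj_on_imp_bij_betw)
  then have "(\<Sum>N\<in>Pow {1..int p}. prod x (desB n (s \<circ> shuf N))) =
      (\<Sum>N\<in>Pow {1..p}. prod x (desB n (s \<circ> shuf (int ` N))))"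
    by (rule sum.reindex_bij_betw[symmetric])
  also have "\<dots> = fiber_first x n (desB n s)"
  proof (cases "desB n s = {}")
    case True
    then have "p = n" using p by (simp add: first_des_def)
    then show ?thesis using True desB_first_wdes[OF s p] by (simp add: fiber_first_def word_total_def)
  next
    case False
    have pM: "p = Min (desB n s)" using False p by (simp add: first_des_def)
    have "prod x (desB n (s \<circ> shuf (int ` N))) = prod x (wdes (insert (Suc p) N)) * prod x (desB n s - {p})"
      if N: "N \<in> Pow {1..p}" for N
    proof -
      have "wdes (insert (Suc p) N) \<inter> (desB n s - {p}) = {}"
        using N first_des_props(2)[OF sS] p by (fastforce simp: wdes_def)
      moreover have "finite (wdes (insert (Suc p) N))" using N by (intro finite_wdes[of _ "Suc p"]) auto
      moreover have "desB n (s \<circ> shuf (int ` N)) = wdes (insert (Suc p) N) \<union> (desB n s - {p})"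
        using desB_first_wdes[OF s p, of N] N False by simp
      ultimately show ?thesis by (simp add: prod.union_disjoint)
    qed
    then have "(\<Sum>N\<in>Pow {1..p}. prod x (desB n (s \<circ> shuf (int ` N)))) = toggle x p * prod x (desB n s - {p})"
      by (simp add: toggle_def sum_distrib_right)
    then show ?thesis using False pM by (simp add: fiber_first_def)
  qed
  finally show ?thesis .
qed

text \<open>The negative letter at i creates the descent i - 1 and destroys one at i. The descent 1
  disappears with the first letter, and the letters before i increase.\<close>

lemma desB_second_fiber:
  assumes s: "s \<in> Av321 n" "1 \<in> desB n s" and i: "2 \<le> i" "i \<le> second_des n (desB n s)"
  shows "desB n (s \<circ> shuf {int i}) = insert (i - 1) {d \<in> desB n s. i < d}"
proof -
  let ?w = "s \<circ> shuf {int i}"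
  note sS = AvD(1)[OF s(1)]
  note B = SnD(1)[OF sS]
  have i_n: "i \<le> n" using i second_des_props(1)[OF sS s(2)] by simp
  have w: "?w y = (if y < int i then s (y + 1) else if y = int i then - s 1 else s y)" if "1 \<le> y" for y
    using shuf_single[of "int i" y] i that Bn_minus[OF B, of 1] by auto
  have wB: "?w \<in> Bn n" using Bn_comp[OF B shuf_Bn[of "{int i}"]] i i_n by auto
  have w0: "?w 0 = 0" using Bn_zero[OF wB, of 0] by simp
  have pos: "0 < s y" if "1 \<le> y" "y \<le> int n" for y using SnD(2)[OF sS that] by simp
  have inc: "s y < s z" if "2 \<le> y" "y < z" "z \<le> int i" for y z
    using increasing_second[OF sS s(2)] that i by simp
  have "j \<in> desB n ?w \<longleftrightarrow> j \<in> insert (i - 1) {d \<in> desB n s. i < d}" for j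
  proof -
    consider "j = 0" | "1 \<le> j" "j + 1 < i" | "j + 1 = i" | "j = i" | "i < j" using i by linarith
    then show ?thesis
    proof cases
      case 1
      then show ?thesis using i w[of 1] w0 pos[of 2] i_n by (simp add: desB_iff)
    next
      case 2
      have "j \<noteq> i - 1" "\<not> i < j" using 2 by auto
      moreover have "?w (int j) < ?w (int j + 1)"
        using w[of "int j"] w[of "int j + 1"] 2 inc[of "int j + 1" "int j + 2"] by (simp add: add.commute)
      ultimately show ?thesis by (simp add: desB_iff)
    next
      case 3
      then have "?w (int j + 1) = - s 1" "?w (int j) = s (int i)"
        using w[of "int j"] w[of "int j + 1"] i by (auto simp: add.commute)
      then show ?thesis using 3 pos[of 1] pos[of "int i"] i i_n by (auto simp: desB_iff)
    next
      case 4
      have "\<not> ?w (int j + 1) < ?w (int j)" if "j < n"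
        using w[of "int j"] w[of "int j + 1"] 4 i pos[of 1] pos[of "int j + 1"] that by simp
      then show ?thesis using 4 i by (auto simp: desB_iff)
    next
      case 5
      then show ?thesis using w[of "int j"] w[of "int j + 1"] i by (auto simp: desB_iff)
    qed
  qed
  then show ?thesis by blast
qed

text \<open>Position i contributes \<open>x (i - 1)\<close> and keeps the descents beyond i. If
  there is a second descent r, only i = r loses it, whence the summand \<open>x (r - 1)\<close>
  without the factor \<open>x r\<close> in \<open>fiber_second\<close>.\<close>

lemma sum_second_fiber:
  fixes x :: "nat \<Rightarrow> 'a::comm_ring_1"
  assumes s: "s \<in> Av321 n" "1 \<in> desB n s" and r: "r = second_des n (desB n s)"
  shows "(\<Sum>N\<in>(\<lambda>i. {i}) ` {2..int r}. prod x (desB n (s \<circ> shuf N))) = fiber_second x n (desB n s)"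
proof -
  let ?D = "desB n s"
  note sS = AvD(1)[OF s(1)]
  have r2: "2 \<le> r" "r \<le> n" using second_des_props(1,2)[OF sS s(2)] r by auto
  have "(\<lambda>i. {i}) ` {2..int r} = (\<lambda>i. {int i}) ` {2..r}"
  proof -
    have "{2..int r} = int ` {2..r}" by (simp add: image_int_atLeastAtMost)
    then show ?thesis by (simp add: image_image)
  qed
  moreover have "inj_on (\<lambda>i. {int i}) {2..r}" by (auto intro: inj_onI)
  ultimately have "(\<Sum>N\<in>(\<lambda>i. {i}) ` {2..int r}. prod x (desB n (s \<circ> shuf N))) =
      (\<Sum>i=2..r. prod x (desB n (s \<circ> shuf {int i})))"
    by (simp add: sum.reindex)
  also have "\<dots> = (\<Sum>i=2..r. x (i - 1) * prod x {d \<in> ?D. i < d})"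
  proof (intro sum.cong refl)
    fix i assume "i \<in> {2..r}"
    then have e: "desB n (s \<circ> shuf {int i}) = insert (i - 1) {d \<in> ?D. i < d}"
      using desB_second_fiber[OF s, of i] r by simp
    have nin: "i - 1 \<notin> {d \<in> ?D. i < d}" "finite {d \<in> ?D. i < d}" by auto
    show "prod x (desB n (s \<circ> shuf {int i})) = x (i - 1) * prod x {d \<in> ?D. i < d}"
      unfolding e by (rule prod.insert[OF nin(2,1)])
  qed
  also have "\<dots> = fiber_second x n ?D"
  proof (cases "?D = {1}")
    case True
    have "r = n" using True r by (simp add: second_des_def)
    have "{d \<in> ?D. i < d} = {}" if "i \<in> {2..r}" for i unfolding True using that by force
    then have "(\<Sum>i=2..r. x (i - 1) * prod x {d \<in> ?D. i < d}) = (\<Sum>i=2..r. x (i - 1))"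
      by (intro sum.cong refl) (simp only: prod.empty mult_1_right)
    also have "\<dots> = (\<Sum>i=2..n. x (i - 1))" by (simp only: \<open>r = n\<close>)
    also have "\<dots> = (\<Sum>i=1..<n. x i)"
      by (rule sum.reindex_bij_witness[of _ Suc "\<lambda>i. i - 1"]) auto
    finally show ?thesis using True by (simp add: fiber_second_def)
  next
    case False
    then have rM: "r = Min (?D - {1})" using r by (simp add: second_des_def)
    have "?D - {1} \<noteq> {}" using False s(2) by blast
    then have rD: "r \<in> ?D" "r \<noteq> 1" using Min_in[of "?D - {1}"] rM by auto
    have le: "d \<in> ?D \<Longrightarrow> d \<noteq> 1 \<Longrightarrow> r \<le> d" for d using rM by simp
    have small: "prod x {d \<in> ?D. i < d} = x r * prod x (?D - {1, r})" if "i \<in> {2..<r}" for i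
    proof -
      have "{d \<in> ?D. i < d} = insert r (?D - {1, r})" using that rD le by force
      then show ?thesis by simp
    qed
    have "{d \<in> ?D. r < d} = ?D - {1, r}" using le r2 by force
    then have "(\<Sum>i=2..r. x (i - 1) * prod x {d \<in> ?D. i < d}) =
        x (r - 1) * prod x (?D - {1, r}) + (\<Sum>i=2..<r. x (i - 1) * prod x {d \<in> ?D. i < d})"
      using r2(1) by (simp only: sum.last_plus)
    also have "(\<Sum>i=2..<r. x (i - 1) * prod x {d \<in> ?D. i < d}) = (\<Sum>i=2..<r. x (i - 1) * (x r * prod x (?D - {1, r})))"
      using small by (intro sum.cong) auto
    also have "\<dots> = (\<Sum>i=2..<r. x (i - 1)) * (x r * prod x (?D - {1, r}))"
      by (simp add: sum_distrib_right)
    also have "(\<Sum>i=2..<r. x (i - 1)) = (\<Sum>i=1..<r - 1. x i)"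
      by (rule sum.reindex_bij_witness[of _ Suc "\<lambda>i. i - 1"]) auto
    finally have "(\<Sum>i=2..r. x (i - 1) * prod x {d \<in> ?D. i < d}) =
        prod x (?D - {1, r}) * (x (r - 1) + x r * (\<Sum>i=1..<r - 1. x i))"
      by (simp only: algebra_simps)
    then show ?thesis using False s(2) rM by (simp only: fiber_second_def Let_def if_False not_True_eq_False)
  qed
  finally show ?thesis .
qed

definition fiber :: "nat \<Rightarrow> (int \<Rightarrow> int) \<Rightarrow> int set set" where
  "fiber n s = {N. N \<subseteq> {1..int n} \<and> fc_pattern (int n) (s \<circ> shuf N)}"

lemma finite_fiber [simp]: "finite (fiber n s)"
  by (rule finite_subset[of _ "Pow {1..int n}"]) (auto simp: fiber_def)

lemma sum_fiber:
  fixes x :: "nat \<Rightarrow> 'a::comm_ring_1"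
  assumes s: "s \<in> Av321 n"
  shows "(\<Sum>N\<in>fiber n s. prod x (desB n (s \<circ> shuf N))) = fiber_first x n (desB n s) + fiber_second x n (desB n s)"
proof -
  let ?D = "desB n s"
  note sS = AvD(1)[OF s]
  define p where "p = first_des n ?D"
  define r where "r = second_des n ?D"
  have pn: "p \<le> n" using first_des_props(1)[OF sS] p_def by simp
  show ?thesis
  proof (cases "1 \<in> ?D")
    case False
    have "N \<in> fiber n s \<longleftrightarrow> N \<in> Pow {1..int p}" for N
    proof (cases "N \<subseteq> {1..int n}")
      case True
      then show ?thesis using fc_pattern_comp_shuf[OF sS True] s False by (simp add: fiber_def p_def)
    next
      case F: False
      then show ?thesis using pn by (auto simp: fiber_def)
    qed
    then have "fiber n s = Pow {1..int p}" by blast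
    then show ?thesis using sum_first_fiber[OF s p_def, of x] False by (simp add: fiber_second_def)
  next
    case True
    have rn: "r \<le> n" using second_des_props(1)[OF sS True] r_def by simp
    have "Min ?D \<le> 1" "Min ?D \<in> ?D" using True by (auto intro: Min_in)
    then have p1: "p = 1" using True desB_Sn_pos[OF sS, of "Min ?D"] by (auto simp: p_def first_des_def)
    let ?S = "(\<lambda>i. {i}) ` {2..int r}"
    have "N \<in> fiber n s \<longleftrightarrow> N \<in> Pow {1..int p} \<union> ?S" for N
    proof (cases "N \<subseteq> {1..int n}")
      case N: True
      have "N \<in> ?S \<longleftrightarrow> (\<exists>i. 2 \<le> i \<and> i \<le> int r \<and> N = {i})" by auto
      then show ?thesis using fc_pattern_comp_shuf[OF sS N] s True N by (simp add: fiber_def p_def r_def)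
    next
      case F: False
      then show ?thesis using pn rn by (auto simp: fiber_def)
    qed
    then have "fiber n s = Pow {1..int p} \<union> ?S" by blast
    moreover have "{i} \<notin> Pow {1..int p}" if "2 \<le> i" for i using p1 that by simp
    then have "Pow {1..int p} \<inter> ?S = {}" by fastforce
    ultimately have "(\<Sum>N\<in>fiber n s. prod x (desB n (s \<circ> shuf N))) =
        (\<Sum>N\<in>Pow {1..int p}. prod x (desB n (s \<circ> shuf N))) + (\<Sum>N\<in>?S. prod x (desB n (s \<circ> shuf N)))"
      by (simp add: sum.union_disjoint)
    then show ?thesis using sum_first_fiber[OF s p_def, of x] sum_second_fiber[OF s True r_def, of x] by simp
  qed
qed

lemma finite_Av321 [simp]: "finite (Av321 n)"
  using bij_betw_finite[OF bij_betw_lst] by simp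

lemma sum_FC:
  fixes x :: "nat \<Rightarrow> 'a::comm_ring_1" and q :: 'a
  shows "(\<Sum>w\<in>FC n. (\<Prod>i\<in>desB n w. x i) * q ^ bl n (inv w)) =
    (\<Sum>s\<in>Av321 n. q ^ bl n (inv s) * (fiber_first x n (desB n s) + fiber_second x n (desB n s)))"
proof -
  let ?h = "\<lambda>(s, N). s \<circ> shuf N" and ?S = "Sigma (Av321 n) (fiber n)"
  have sub: "?S \<subseteq> Sn n \<times> Pow {1..int n}"
  proof (rule Sigma_mono)
    show "Av321 n \<subseteq> Sn n" using AvD(1) by blast
    show "fiber n s \<subseteq> Pow {1..int n}" for s unfolding fiber_def by blast
  qed
  have inj: "inj_on ?h ?S"
    using bij_betw_imp_inj_on[OF bij_betw_shuf] sub inj_on_subset by blast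
  have im: "?h ` ?S = FC n"
  proof (intro subset_antisym subsetI)
    fix w assume "w \<in> ?h ` ?S"
    then obtain s N where sN: "s \<in> Av321 n" "N \<in> fiber n s" "w = s \<circ> shuf N" by auto
    then have "w \<in> Bn n" using Bn_comp[OF SnD(1)[OF AvD(1)] shuf_Bn] by (simp add: fiber_def)
    then show "w \<in> FC n" using sN by (simp add: FC_iff fiber_def)
  next
    fix w assume "w \<in> FC n"
    then have w: "w \<in> Bn n" "fc_pattern (int n) w" by (auto simp: FC_iff)
    then have "w \<in> ?h ` (Sn n \<times> Pow {1..int n})" using bij_betw_imp_surj_on[OF bij_betw_shuf] by blast
    then obtain s N where sN: "s \<in> Sn n" "N \<subseteq> {1..int n}" "w = s \<circ> shuf N" by auto
    then have "s \<in> Av321 n" using fc_pattern_imp_fiber(1) w by blast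
    then show "w \<in> ?h ` ?S" using sN w by (intro image_eqI[of _ _ "(s, N)"]) (auto simp: fiber_def)
  qed
  have "(\<Sum>w\<in>FC n. (\<Prod>i\<in>desB n w. x i) * q ^ bl n (inv w)) =
     (\<Sum>(s, N)\<in>?S. prod x (desB n (s \<circ> shuf N)) * q ^ bl n (inv (s \<circ> shuf N)))"
    unfolding im[symmetric] sum.reindex[OF inj] by (intro sum.cong) auto
  also have "\<dots> = (\<Sum>s\<in>Av321 n. \<Sum>N\<in>fiber n s. prod x (desB n (s \<circ> shuf N)) * q ^ bl n (inv (s \<circ> shuf N)))"
    by (simp add: sum.Sigma)
  also have "\<dots> = (\<Sum>s\<in>Av321 n. q ^ bl n (inv s) * (\<Sum>N\<in>fiber n s. prod x (desB n (s \<circ> shuf N))))"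
  proof (intro sum.cong refl)
    fix s assume s: "s \<in> Av321 n"
    have "bl n (inv (s \<circ> shuf N)) = bl n (inv s)" if "N \<in> fiber n s" for N
      using bl_inv_comp_shuf[OF AvD(1)[OF s]] that by (simp add: fiber_def)
    then show "(\<Sum>N\<in>fiber n s. prod x (desB n (s \<circ> shuf N)) * q ^ bl n (inv (s \<circ> shuf N))) =
        q ^ bl n (inv s) * (\<Sum>N\<in>fiber n s. prod x (desB n (s \<circ> shuf N)))"
      by (simp add: sum_distrib_left mult.commute)
  qed
  finally show ?thesis by (simp add: sum_fiber)
qed

section \<open>Tableau sums as products, and the final comparison\<close>

lemma lq_tDesB: "q ^ (n - ldes n P) = lq q n (tDesB n P)"
proof -
  have "finite (tDesB n P)" by (simp add: tDesB_def tDes_def)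
  then show ?thesis by (simp add: ldes_def lq_def)
qed

lemma lq_insert_0: "lq q n (insert 0 D) = lq q n D"
  by (simp add: lq_def)

lemma sum_SDT_pairs:
  fixes x :: "nat \<Rightarrow> 'a::comm_ring_1" and q :: 'a
  assumes "SDT lam = DT C n"
  shows "(\<Sum>(P, Q)\<in>SDT lam \<times> SDT lam. (\<Prod>i\<in>tDesB n Q. x i) * q ^ (n - ldes n P)) =
    tsum C n (prod x) * tsum C n (lq q n)"
proof -
  have "(\<Sum>(P, Q)\<in>SDT lam \<times> SDT lam. (\<Prod>i\<in>tDesB n Q. x i) * q ^ (n - ldes n P)) =
     (\<Sum>P\<in>DT C n. \<Sum>Q\<in>DT C n. prod x (tDesB n Q) * lq q n (tDesB n P))"
    by (simp add: assms sum.cartesian_product lq_tDesB)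
  also have "\<dots> = (\<Sum>P\<in>DT C n. tsum C n (prod x) * lq q n (tDesB n P))"
    by (simp add: tsum_def sum_distrib_right)
  also have "\<dots> = tsum C n (prod x) * tsum C n (lq q n)"
    by (simp add: tsum_def[of C n "lq q n"] sum_distrib_left)
  finally show ?thesis .
qed

text \<open>Even k fill the range from below with k/2, odd k from above with n - (k - 1)/2.\<close>

lemma bij_minus_count: "bij_betw (\<lambda>k. minus_count n (n - k)) {0..n} {0..n}"
proof -
  have e: "minus_count n (n - j) = (if even j then j div 2 else (2 * n + 1 - j) div 2)" if "j \<le> n" for j
  proof -
    have e: "n - (n - j) = j" "n + 1 + (n - j) = 2 * n + 1 - j" using that by auto
    show ?thesis unfolding minus_count_def e by simp
  qed
  have inj: "inj_on (\<lambda>k. minus_count n (n - k)) {0..n}"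
  proof (rule inj_onI)
    fix k k' assume h: "k \<in> {0..n}" "k' \<in> {0..n}" "minus_count n (n - k) = minus_count n (n - k')"
    have s: "(if even k then k div 2 else (2 * n + 1 - k) div 2) = (if even k' then k' div 2 else (2 * n + 1 - k') div 2)"
      using h e by auto
    have kn: "k \<le> n" "k' \<le> n" using h by auto
    show "k = k'" using s kn by (cases "even k"; cases "even k'") (auto elim!: evenE oddE)
  qed
  moreover have "(\<lambda>k. minus_count n (n - k)) ` {0..n} = {0..n}"
  proof (rule endo_inj_surj[OF _ _ inj])
    show "(\<lambda>k. minus_count n (n - k)) ` {0..n} \<subseteq> {0..n}"
    proof (rule image_subsetI)
      fix k assume "k \<in> {0..n}"
      then show "minus_count n (n - k) \<in> {0..n}" using e[of k] by (cases "even k") (auto elim: oddE)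
    qed
  qed simp
  ultimately show ?thesis by (simp add: bij_betw_def)
qed

theorem mainTheorem11:
  fixes n :: nat and x :: "nat \<Rightarrow> 'a::comm_ring_1" and q :: 'a
  assumes "n \<ge> 1"
  shows "(\<Sum>w\<in>FC n. (\<Prod>i\<in>desB n w. x i) * q ^ bl n (inv w)) =
    (\<Sum>k=0..n. \<Sum>(P, Q)\<in>SDT [2*n - k, k] \<times> SDT [2*n - k, k].
        (\<Prod>i\<in>tDesB n Q. x i) * q ^ (n - ldes n P)) +
    (\<Sum>k=1..n div 2. \<Sum>(P, Q)\<in>SDT [2*n - 2*k, 2*k - 1, 1] \<times> SDT [2*n - 2*k, 2*k - 1, 1].
        (\<Prod>i\<in>tDesB n Q. x i) * q ^ (n - ldes n P))"
proof -
  let ?W = "\<lambda>m. wsum n m (prod x)" and ?s = "ldsum q n"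
  have two: "(\<Sum>(P, Q)\<in>SDT [2*n - k, k] \<times> SDT [2*n - k, k]. (\<Prod>i\<in>tDesB n Q. x i) * q ^ (n - ldes n P)) =
      ?W (minus_count n (n - k)) * wsum n (minus_count n (n - k)) (lq q n)" if "k \<in> {0..n}" for k
  proof -
    have "SDT [2*n - k, k] = DT (R2 (n + (n - k)) (n - (n - k))) n"
    proof -
      have "n + (n - k) = 2*n - k" "n - (n - k) = k" "sum_list [2*n - k, k] div 2 = n" using that by auto
      then show ?thesis unfolding SDT_DT cells_two by simp
    qed
    from sum_SDT_pairs[OF this] show ?thesis by (simp only: tsum_two_row[OF diff_le_self])
  qed
  have three: "(\<Sum>(P, Q)\<in>SDT [2*n - 2*k, 2*k - 1, 1] \<times> SDT [2*n - 2*k, 2*k - 1, 1].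
        (\<Prod>i\<in>tDesB n Q. x i) * q ^ (n - ldes n P)) = bsum n k (prod x) * ?s k"
    if k: "k \<in> {1..n div 2}" for k
  proof -
    have "SDT [2*n - 2*k, 2*k - 1, 1] = DT (shape3 n k) n"
    proof -
      have "sum_list [2*n - 2*k, 2*k - 1, 1] div 2 = n" "k \<noteq> 0" using k by auto
      then show ?thesis unfolding SDT_DT cells_three shape3_def by simp
    qed
    moreover have "2 * k \<le> n" using k by auto
    ultimately show ?thesis using sum_SDT_pairs[of _ "shape3 n k" n x q] by (simp only: tsum_three_row ldsum_def)
  qed
  have "(\<Sum>k=0..n. \<Sum>(P, Q)\<in>SDT [2*n - k, k] \<times> SDT [2*n - k, k].
        (\<Prod>i\<in>tDesB n Q. x i) * q ^ (n - ldes n P)) =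
      (\<Sum>k=0..n. ?W (minus_count n (n - k)) * wsum n (minus_count n (n - k)) (lq q n))"
    by (intro sum.cong refl two)
  also have "\<dots> = (\<Sum>m=0..n. ?W m * wsum n m (lq q n))"
    by (rule sum.reindex_bij_betw[OF bij_minus_count])
  \<comment> \<open>Only the P-factor is expanded, as its weight ignores 0. The bound min(m, n - m)
    is split into two inequalities so that the sums can be exchanged.\<close>
  also have "\<dots> = (\<Sum>m=0..n. \<Sum>k\<in>{k \<in> {0..n}. k \<le> m \<and> k \<le> n - m}. ?W m * ?s k)"
  proof (intro sum.cong refl)
    fix m assume m: "m \<in> {0..n}"
    then have "{0..min m (n - m)} = {k \<in> {0..n}. k \<le> m \<and> k \<le> n - m}" by auto
    then show "?W m * wsum n m (lq q n) = (\<Sum>k\<in>{k \<in> {0..n}. k \<le> m \<and> k \<le> n - m}. ?W m * ?s k)"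
      using wsum_eq_bsum[of m n "lq q n"] m by (simp add: lq_insert_0 ldsum_def sum_distrib_left)
  qed
  also have "\<dots> = (\<Sum>k=0..n. \<Sum>m\<in>{m \<in> {0..n}. k \<le> m \<and> k \<le> n - m}. ?W m * ?s k)"
    by (rule sum.swap_restrict) auto
  \<comment> \<open>For fixed k the admissible m form the interval of
    \<open>bsum_fiber_first\<close>.\<close>
  also have "\<dots> = (\<Sum>k\<le>n. ?s k * (\<Sum>m=k..n-k. ?W m))"
  proof -
    have "{m \<in> {0..n}. k \<le> m \<and> k \<le> n - m} = {k..n-k}" if "k \<le> n" for k using that by auto
    then show ?thesis by (simp add: atMost_atLeast0 sum_distrib_left mult.commute)
  qed
  finally have first: "(\<Sum>k=0..n. \<Sum>(P, Q)\<in>SDT [2*n - k, k] \<times> SDT [2*n - k, k].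
        (\<Prod>i\<in>tDesB n Q. x i) * q ^ (n - ldes n P)) = (\<Sum>k\<le>n. ?s k * bsum n k (fiber_first x n))"
    by (simp only: bsum_fiber_first)
  have "(\<Sum>k=1..n div 2. \<Sum>(P, Q)\<in>SDT [2*n - 2*k, 2*k - 1, 1] \<times> SDT [2*n - 2*k, 2*k - 1, 1].
        (\<Prod>i\<in>tDesB n Q. x i) * q ^ (n - ldes n P)) = (\<Sum>k=1..n div 2. bsum n k (prod x) * ?s k)"
    by (intro sum.cong refl three)
  also have "\<dots> = (\<Sum>k=1..n div 2. ?s k * bsum n k (fiber_second x n))"
    by (intro sum.cong refl) (simp add: bsum_fiber_second mult.commute)
  \<comment> \<open>The added terms vanish: at k = 0 only the empty descent set occurs, where
    \<open>fiber_second\<close> is zero, and for 2 k > n there is no ballot word.\<close>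
  also have "\<dots> = (\<Sum>k\<le>n. ?s k * bsum n k (fiber_second x n))"
  proof (rule sum.mono_neutral_left)
    show "\<forall>i\<in>{..n} - {1..n div 2}. ?s i * bsum n i (fiber_second x n) = 0"
    proof
      fix i assume "i \<in> {..n} - {1..n div 2}"
      then have "i = 0 \<or> n < 2 * i" by auto
      then show "?s i * bsum n i (fiber_second x n) = 0" by (auto simp: fiber_second_def ldsum_gt)
    qed
  qed auto
  finally have second: "(\<Sum>k=1..n div 2. \<Sum>(P, Q)\<in>SDT [2*n - 2*k, 2*k - 1, 1] \<times> SDT [2*n - 2*k, 2*k - 1, 1].
        (\<Prod>i\<in>tDesB n Q. x i) * q ^ (n - ldes n P)) = (\<Sum>k\<le>n. ?s k * bsum n k (fiber_second x n))" .
  have "(\<Sum>w\<in>FC n. (\<Prod>i\<in>desB n w. x i) * q ^ bl n (inv w)) =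
      (\<Sum>k\<le>n. ?s k * bsum n k (\<lambda>D. fiber_first x n D + fiber_second x n D))"
    unfolding sum_FC by (rule sum_Av321[OF assms])
  also have "\<dots> = (\<Sum>k\<le>n. ?s k * bsum n k (fiber_first x n)) + (\<Sum>k\<le>n. ?s k * bsum n k (fiber_second x n))"
    by (simp add: bsum_add sum.distrib algebra_simps)
  finally show ?thesis unfolding first second .
qed

end
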